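(* Let $G$ be a countable discrete ICC group with Kazhdan's property (T) and $\sigma:G\to\mathrm{Aut}(X,\mu)$ a Bernoulli shift action. Let $G_0$ be any countable discrete group and $\sigma_0:G_0\to\mathrm{Aut}(X_0,\mu_0)$ any free measure preserving action on a standard probability space. If $Y\subset X$ is a subset of positive measure and $\Delta_0:(X_0,\mu_0)\simeq(Y,\mu_{|Y})$ is an isomorphism of probability spaces satisfying $\Delta_0(\mathcal R_{\sigma_0})=\mathcal R^Y_\sigma$, then $Y=X$ (modulo null sets) and there exist $\alpha\in\mathrm{Inn}(\mathcal R_\sigma)$, a group isomorphism $\delta:G_0\simeq G$ and an isomorphism of probability spaces $\Delta:(X_0,\mu_0)\simeq(X,\mu)$ satisfying $\sigma(\delta(h))\Delta=\Delta\sigma_0(h)$ for all $h\in G_0$, such that $\Delta_0=\alpha\circ\Delta$. In particular, if $Y\subset X$ has measure $0\ne\mu(Y)<1$, then the equivalence relation $\mathcal R^Y_\sigma$ cannot be realized as the orbit equivalence relation of a free (measure preserving) action of a group.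
   Context: ICC means infinite with all non-trivial conjugacy classes infinite. Bernoulli shift action with base a standard probability space $(Y_0,\nu_0)$ (not a single point): $G$ acts on $(X,\mu)=\prod_{g\in G}(Y_0,\nu_0)_g$ by $\sigma_g((x_h)_h)=(x'_h)_h$, $x'_h=x_{g^{-1}h}$. $\mathcal R_\sigma$ is the orbit equivalence relation of $\sigma$, and $\mathcal R_\sigma^Y$ is the equivalence relation on $Y$ obtained by intersecting the orbits of $\sigma$ with $Y$; $\mu_{|Y}$ is the restriction of $\mu$ to $Y$ normalized to a probability measure. Equalities of equivalence relations are almost everywhere. $\mathrm{Inn}(\mathcal R_\sigma)$ is the group of automorphisms of $(X,\mu)$ whose graph is contained in $\mathcal R_\sigma$ (a.e.). *)

theory Defs
  imports "HOL-Probability.Probability" "HOL-Algebra.Module"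
begin

section \<open>ICC groups\<close>

definition conj_class :: "('g, 'r) monoid_scheme \<Rightarrow> 'g \<Rightarrow> 'g set" where
  "conj_class G g = (\<lambda>h. h \<otimes>\<^bsub>G\<^esub> g \<otimes>\<^bsub>G\<^esub> inv\<^bsub>G\<^esub> h) ` carrier G"

definition icc :: "('g, 'r) monoid_scheme \<Rightarrow> bool" where
  "icc G \<longleftrightarrow> infinite (carrier G) \<and> (\<forall>g\<in>carrier G - {\<one>\<^bsub>G\<^esub>}. infinite (conj_class G g))"

section \<open>Unitary representations and property (T)\<close>

definition complex_field :: "complex ring" where
  "complex_field = \<lparr>carrier = UNIV, mult = (*), one = 1, ring.zero = 0, add = (+)\<rparr>"

text \<open>The ring multiplication and unit that the record inherits through \<open>module\<close> are unused.\<close>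

record 'v hilbert = "(complex, 'v) module" +
  cinner :: "'v \<Rightarrow> 'v \<Rightarrow> complex"

definition hnorm :: "('v, 'r) hilbert_scheme \<Rightarrow> 'v \<Rightarrow> real" where
  "hnorm H v = sqrt (Re (cinner H v v))"

definition inner_product_space :: "('v, 'r) hilbert_scheme \<Rightarrow> bool" where
  "inner_product_space H \<longleftrightarrow>
     Module.module complex_field H \<and>
     (\<forall>u\<in>carrier H. \<forall>v\<in>carrier H. \<forall>w\<in>carrier H.
        cinner H (u \<oplus>\<^bsub>H\<^esub> v) w = cinner H u w + cinner H v w) \<and>
     (\<forall>c. \<forall>u\<in>carrier H. \<forall>v\<in>carrier H. cinner H (c \<odot>\<^bsub>H\<^esub> u) v = c * cinner H u v) \<and>
     (\<forall>u\<in>carrier H. \<forall>v\<in>carrier H. cinner H v u = cnj (cinner H u v)) \<and>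
     (\<forall>v\<in>carrier H - {\<zero>\<^bsub>H\<^esub>}. 0 < Re (cinner H v v))"

definition hilbert_space :: "('v, 'r) hilbert_scheme \<Rightarrow> bool" where
  "hilbert_space H \<longleftrightarrow>
     inner_product_space H \<and>
     (\<forall>s :: nat \<Rightarrow> 'v.
        (\<forall>n. s n \<in> carrier H) \<and>
        (\<forall>e>0. \<exists>N. \<forall>m\<ge>N. \<forall>n\<ge>N. hnorm H (s m \<ominus>\<^bsub>H\<^esub> s n) < e) \<longrightarrow>
        (\<exists>l\<in>carrier H. (\<lambda>n. hnorm H (s n \<ominus>\<^bsub>H\<^esub> l)) \<longlonglongrightarrow> 0))"

definition unitary_op :: "('v, 'r) hilbert_scheme \<Rightarrow> ('v \<Rightarrow> 'v) \<Rightarrow> bool" where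
  "unitary_op H U \<longleftrightarrow>
     bij_betw U (carrier H) (carrier H) \<and>
     (\<forall>u\<in>carrier H. \<forall>v\<in>carrier H. U (u \<oplus>\<^bsub>H\<^esub> v) = U u \<oplus>\<^bsub>H\<^esub> U v) \<and>
     (\<forall>c. \<forall>v\<in>carrier H. U (c \<odot>\<^bsub>H\<^esub> v) = c \<odot>\<^bsub>H\<^esub> U v) \<and>
     (\<forall>u\<in>carrier H. \<forall>v\<in>carrier H. cinner H (U u) (U v) = cinner H u v)"

definition unitary_rep ::
  "('g, 'r) monoid_scheme \<Rightarrow> ('v, 's) hilbert_scheme \<Rightarrow> ('g \<Rightarrow> 'v \<Rightarrow> 'v) \<Rightarrow> bool" where
  "unitary_rep G H \<pi> \<longleftrightarrow>
     (\<forall>g\<in>carrier G. unitary_op H (\<pi> g)) \<and>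
     (\<forall>g\<in>carrier G. \<forall>h\<in>carrier G. \<forall>v\<in>carrier H. \<pi> (g \<otimes>\<^bsub>G\<^esub> h) v = \<pi> g (\<pi> h v))"

text \<open>
  Kazhdan's property (T) of a discrete group: some Kazhdan pair \<open>(F, \<epsilon>)\<close> exists.
  A definition cannot quantify over types, so the Hilbert spaces are those whose underlying set
  is a subset of the type \<open>nat \<Rightarrow> complex\<close>, with arbitrary operations. Up to unitary
  equivalence this includes every separable Hilbert space. For countable \<open>G\<close> nothing is lost:
  the closed span of the orbit of a vector is a separable subrepresentation.
\<close>

definition property_T :: "('g, 'r) monoid_scheme \<Rightarrow> bool" where
  "property_T G \<longleftrightarrow>
     (\<exists>F \<epsilon>. finite F \<and> F \<subseteq> carrier G \<and> 0 < \<epsilon> \<and>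
       (\<forall>(H :: (nat \<Rightarrow> complex) hilbert) \<pi>.
          hilbert_space H \<and> unitary_rep G H \<pi> \<and>
          (\<exists>v\<in>carrier H - {\<zero>\<^bsub>H\<^esub>}. \<forall>g\<in>F. hnorm H (\<pi> g v \<ominus>\<^bsub>H\<^esub> v) < \<epsilon> * hnorm H v) \<longrightarrow>
          (\<exists>w\<in>carrier H - {\<zero>\<^bsub>H\<^esub>}. \<forall>g\<in>carrier G. \<pi> g w = w)))"

section \<open>Standard probability spaces and their isomorphisms\<close>

definition standard_borel :: "'a measure \<Rightarrow> bool" where
  "standard_borel M \<longleftrightarrow>
     (\<exists>T. completely_metrizable_space T \<and> second_countable T \<and>
          topspace T = space M \<and> sets M = sigma_sets (space M) {U. openin T U})"

definition standard_prob_space :: "'a measure \<Rightarrow> bool" where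
  "standard_prob_space M \<longleftrightarrow> prob_space M \<and> standard_borel M"

text \<open>
  Isomorphisms are taken modulo null sets: \<open>f\<close> is a representative, and it only needs an almost
  everywhere inverse.
\<close>

definition prob_iso :: "'a measure \<Rightarrow> 'b measure \<Rightarrow> ('a \<Rightarrow> 'b) \<Rightarrow> bool" where
  "prob_iso M N f \<longleftrightarrow>
     f \<in> measurable M N \<and> distr M N f = N \<and>
     (\<exists>g\<in>measurable N M. distr N M g = M \<and>
        (AE x in M. g (f x) = x) \<and> (AE y in N. f (g y) = y))"

text \<open>\<open>\<mu>\<^sub>|\<^sub>Y\<close>, a probability measure on the set \<open>Y\<close>.\<close>

definition normalized_restriction :: "'a measure \<Rightarrow> 'a set \<Rightarrow> 'a measure" where
  "normalized_restriction M Y = scale_measure (inverse (emeasure M Y)) (restrict_space M Y)"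

section \<open>Actions and orbit equivalence relations\<close>

text \<open>
  A homomorphism from \<open>G\<close> to \<open>Aut(M)\<close>. As \<open>Aut(M)\<close> consists of automorphisms modulo null sets,
  the homomorphism property is required almost everywhere.
\<close>

definition mp_action :: "('g, 'r) monoid_scheme \<Rightarrow> 'a measure \<Rightarrow> ('g \<Rightarrow> 'a \<Rightarrow> 'a) \<Rightarrow> bool" where
  "mp_action G M \<sigma> \<longleftrightarrow>
     (\<forall>g\<in>carrier G. prob_iso M M (\<sigma> g)) \<and>
     (\<forall>g\<in>carrier G. \<forall>h\<in>carrier G. AE x in M. \<sigma> (g \<otimes>\<^bsub>G\<^esub> h) x = \<sigma> g (\<sigma> h x))"

definition free_action :: "('g, 'r) monoid_scheme \<Rightarrow> 'a measure \<Rightarrow> ('g \<Rightarrow> 'a \<Rightarrow> 'a) \<Rightarrow> bool" where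
  "free_action G M \<sigma> \<longleftrightarrow> (\<forall>g\<in>carrier G - {\<one>\<^bsub>G\<^esub>}. AE x in M. \<sigma> g x \<noteq> x)"

definition orbit_rel :: "('g, 'r) monoid_scheme \<Rightarrow> 'a measure \<Rightarrow> ('g \<Rightarrow> 'a \<Rightarrow> 'a) \<Rightarrow> 'a rel" where
  "orbit_rel G M \<sigma> = {(x, \<sigma> g x) | x g. x \<in> space M \<and> g \<in> carrier G}"

definition restrict_rel :: "'a rel \<Rightarrow> 'a set \<Rightarrow> 'a rel" where
  "restrict_rel R Y = R \<inter> Y \<times> Y"

text \<open>
  \<open>\<Delta>(R) = S\<close> almost everywhere, for an isomorphism \<open>\<Delta>\<close> defined on \<open>M\<close>: equality holds after
  discarding a null set. The null set is removed in the domain and \<open>\<Delta>\<close> is required to be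
  injective on the rest, because \<open>\<Delta>\<close> may map a null set onto a set of positive measure, so that
  the image of all of \<open>R\<close> would depend on the representative \<open>\<Delta>\<close>.
\<close>

definition image_rel_ae ::
  "'a measure \<Rightarrow> ('a \<Rightarrow> 'b) \<Rightarrow> 'a rel \<Rightarrow> 'b rel \<Rightarrow> bool" where
  "image_rel_ae M \<Delta> R S \<longleftrightarrow>
     (\<exists>A\<in>sets M. (AE x in M. x \<in> A) \<and> inj_on \<Delta> A \<and>
        map_prod \<Delta> \<Delta> ` restrict_rel R A = restrict_rel S (\<Delta> ` A))"

definition Inn_rel :: "'a measure \<Rightarrow> 'a rel \<Rightarrow> ('a \<Rightarrow> 'a) set" where
  "Inn_rel M R = {\<alpha>. prob_iso M M \<alpha> \<and> (AE x in M. (x, \<alpha> x) \<in> R)}"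

section \<open>Bernoulli shifts\<close>

definition bernoulli_space :: "('g, 'r) monoid_scheme \<Rightarrow> 'y measure \<Rightarrow> ('g \<Rightarrow> 'y) measure" where
  "bernoulli_space G Y\<^sub>0 = PiM (carrier G) (\<lambda>_. Y\<^sub>0)"

definition bernoulli_shift :: "('g, 'r) monoid_scheme \<Rightarrow> 'g \<Rightarrow> ('g \<Rightarrow> 'y) \<Rightarrow> 'g \<Rightarrow> 'y" where
  "bernoulli_shift G g x = (\<lambda>h\<in>carrier G. x (inv\<^bsub>G\<^esub> g \<otimes>\<^bsub>G\<^esub> h))"

text \<open>
  A point of the underlying Borel space may be null, so ``not a single point'' is read modulo
  null sets: no point carries the whole mass.
\<close>

definition not_single_point :: "'a measure \<Rightarrow> bool" where
  "not_single_point M \<longleftrightarrow> \<not> (\<exists>y\<in>space M. measure M {y} = 1)"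

end

theory Submission
  imports Defs "HOL-Library.Function_Algebras"
begin

text \<open>
  The heart is Popa's cocycle superrigidity: every cocycle \<open>w\<close> of the shift with values in a countable
  group \<open>\<Gamma>\<close> is cohomologous to a homomorphism. Choose an independent copy \<open>y\<close> of the point \<open>x\<close> and
  replace the coordinates of \<open>x\<close> by those of \<open>y\<close>, in \<open>n\<close> steps, at random places. For large \<open>n\<close>,
  consecutive points \<open>p\<^sub>k\<close>, \<open>p\<^sub>k\<^sub>+\<^sub>1\<close> of this path give cocycles \<open>w(g, p\<^sub>k)\<close>, \<open>w(g, p\<^sub>k\<^sub>+\<^sub>1)\<close> that are close for
  \<open>g\<close> in a Kazhdan set, and property (T), applied to the action on \<open>Z \<times> \<Gamma>\<close> twisted by both, makes them
  cohomologous. Composing the steps, \<open>w(g, x)\<close> and \<open>w(g, y)\<close> are cohomologous on \<open>X \<times> X\<close>, and mixing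
  separates the variables in the transfer function.

  An orbit equivalence of \<open>\<sigma>\<^sub>0\<close> with the restriction to \<open>Y\<close> defines a cocycle of \<open>\<sigma>\<close> with values in
  \<open>G\<^sub>0\<close>, through a retraction of \<open>X\<close> to \<open>Y\<close> along orbits. Untwisting it to a homomorphism \<open>\<delta>\<close> gives an
  equivariant map \<open>\<alpha> : X \<rightarrow> Y\<close> that moves points along orbits. A nontrivial kernel of \<open>\<delta>\<close> would be infinite,
  against the mixing of \<open>\<sigma>\<close>, so \<open>\<alpha>\<close> is injective. It therefore preserves the measure, and \<open>Y\<close> has
  measure 1.
\<close>

section \<open>Semi-inner product spaces\<close>

text \<open>Property (T) speaks of Hilbert spaces carried by sets of sequences, whereas the vectors
  to which it is applied are functions on a measure space. Hilbert space theory is therefore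
  developed for semi-inner products, without a quotient by null vectors, and one cyclic
  subrepresentation at a time is moved to sequences.

  The path of points must commute with the shift, make sense for an arbitrary base space, and have
  every point distributed like \<open>x\<close>. Independent labels, uniform on \<open>n\<close>
  values and attached to the coordinates, achieve this: the labels form a Bernoulli shift of their
  own, so the space of paths is again mixing, and a given coordinate changes in a given step with
  probability \<open>1/n\<close>. Up to small probability a cocycle takes finitely many values and
  depends on finitely many coordinates, so one step rarely changes it.

  The Koopman representation and the twisted action are genuine only if the action and cocycle
  identities hold at every point. The shift satisfies them exactly; the cocycle of the orbit
  equivalence is made to, by declaring it trivial off an invariant conull set.\<close>

lemma quadratic_nonneg_bound:
  fixes a b c :: real
  assumes "\<And>t. 0 \<le> a - 2 * t * b + t\<^sup>2 * b * c" and "0 \<le> b" and "0 \<le> c"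
  shows "b \<le> a * c"
proof (cases "c = 0")
  case True
  \<comment> \<open>With \<open>c = 0\<close> the expression is linear in \<open>t\<close>; at
    \<open>t = (a + 1) / (2 * b)\<close> it would equal \<open>-1\<close>.\<close>
  have "b = 0"
  proof (rule ccontr)
    assume "b \<noteq> 0"
    then show False using assms(1)[of "(a + 1) / (2 * b)"] True by (simp add: field_simps)
  qed
  then show ?thesis using True by simp
next
  case False
  then have c: "c > 0" using assms(3) by simp
  \<comment> \<open>The quadratic is smallest at \<open>t = 1 / c\<close>.\<close>
  have "0 \<le> a - 2 * (1 / c) * b + (1 / c)\<^sup>2 * b * c" by (rule assms(1))
  also have "\<dots> = a - b / c" using c by (simp add: field_simps power2_eq_square)
  finally show ?thesis using c by (simp add: field_simps)
qed

definition ip_norm :: "('v \<Rightarrow> 'v \<Rightarrow> complex) \<Rightarrow> 'v \<Rightarrow> real" where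
  "ip_norm ip v = sqrt (Re (ip v v))"

locale semi_inner = vector_space sc
  for sc :: "complex \<Rightarrow> 'v::ab_group_add \<Rightarrow> 'v" +
  fixes L :: "'v set" and ip :: "'v \<Rightarrow> 'v \<Rightarrow> complex"
  assumes L_zero: "0 \<in> L"
    and L_add: "u \<in> L \<Longrightarrow> v \<in> L \<Longrightarrow> u + v \<in> L"
    and L_sc: "u \<in> L \<Longrightarrow> sc c u \<in> L"
    and ip_add: "u \<in> L \<Longrightarrow> v \<in> L \<Longrightarrow> w \<in> L \<Longrightarrow> ip (u + v) w = ip u w + ip v w"
    and ip_sc: "u \<in> L \<Longrightarrow> v \<in> L \<Longrightarrow> ip (sc c u) v = c * ip u v"
    and ip_sym: "u \<in> L \<Longrightarrow> v \<in> L \<Longrightarrow> ip v u = cnj (ip u v)"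
    and ip_nonneg: "v \<in> L \<Longrightarrow> 0 \<le> Re (ip v v)"
begin

abbreviation nrm :: "'v \<Rightarrow> real" where "nrm \<equiv> ip_norm ip"

lemma L_uminus: "u \<in> L \<Longrightarrow> - u \<in> L"
  using L_sc[of u "-1"] by simp

lemma L_diff: "u \<in> L \<Longrightarrow> v \<in> L \<Longrightarrow> u - v \<in> L"
  using L_add[of u "-v"] L_uminus by simp

lemma ip_uminus: "u \<in> L \<Longrightarrow> v \<in> L \<Longrightarrow> ip (- u) v = - ip u v"
  using ip_sc[of u v "-1"] by simp

lemma ip_diff: "u \<in> L \<Longrightarrow> v \<in> L \<Longrightarrow> w \<in> L \<Longrightarrow> ip (u - v) w = ip u w - ip v w"
  using ip_add[of u "-v" w] ip_uminus[of v w] L_uminus by simp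

lemma ip_add2: "u \<in> L \<Longrightarrow> v \<in> L \<Longrightarrow> w \<in> L \<Longrightarrow> ip w (u + v) = ip w u + ip w v"
  by (metis L_add complex_cnj_add ip_add ip_sym)

lemma ip_sc2: "u \<in> L \<Longrightarrow> v \<in> L \<Longrightarrow> ip u (sc c v) = cnj c * ip u v"
  by (metis L_sc complex_cnj_mult ip_sc ip_sym)

lemma ip_diff2: "u \<in> L \<Longrightarrow> v \<in> L \<Longrightarrow> w \<in> L \<Longrightarrow> ip w (u - v) = ip w u - ip w v"
  by (metis L_diff complex_cnj_diff ip_diff ip_sym)

lemma nrm_nonneg: "v \<in> L \<Longrightarrow> 0 \<le> nrm v"
  using ip_nonneg by (simp add: ip_norm_def)

lemma nrm_sq: "v \<in> L \<Longrightarrow> (nrm v)\<^sup>2 = Re (ip v v)"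
  using ip_nonneg by (simp add: ip_norm_def)

text \<open>The coefficient of \<open>v\<close> carries the phase of \<open>ip u v\<close>, so both
  cross terms become real multiples of \<open>(cmod (ip u v))\<^sup>2\<close>. This leaves a real
  quadratic in \<open>t\<close>, in the shape of \<open>quadratic_nonneg_bound\<close>.\<close>

lemma nrm_sub_scaled:
  assumes "u \<in> L" "v \<in> L"
  shows "(nrm (u - sc (of_real t * ip u v) v))\<^sup>2
    = (nrm u)\<^sup>2 - 2 * t * (cmod (ip u v))\<^sup>2 + t\<^sup>2 * (cmod (ip u v))\<^sup>2 * (nrm v)\<^sup>2"
proof -
  define a where "a = ip u v"
  define c where "c = of_real t * a"
  have in_L: "sc c v \<in> L" "u - sc c v \<in> L" using assms L_sc L_diff by auto
  have vu: "ip v u = cnj a" using ip_sym[of u v] assms a_def by simp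
  have "ip (u - sc c v) (u - sc c v) = ip u u - cnj c * a - c * cnj a + c * cnj c * ip v v"
    using assms in_L by (simp add: ip_diff ip_diff2 ip_sc ip_sc2 vu a_def algebra_simps)
  also have "\<dots> = ip u u - of_real (2 * t * (cmod a)\<^sup>2) + of_real (t\<^sup>2 * (cmod a)\<^sup>2) * ip v v"
  proof -
    have aa: "a * cnj a = of_real ((cmod a)\<^sup>2)" by (simp add: complex_norm_square[symmetric])
    have 1: "cnj c * a = of_real (t * (cmod a)\<^sup>2)" "c * cnj a = of_real (t * (cmod a)\<^sup>2)"
      "c * cnj c = of_real (t\<^sup>2 * (cmod a)\<^sup>2)"
      using aa by (simp_all add: c_def power2_eq_square mult_ac)
    show ?thesis unfolding 1 by simp
  qed
  finally show ?thesis
    unfolding nrm_sq[OF in_L(2), unfolded c_def a_def] using assms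
    by (simp add: nrm_sq a_def[symmetric] c_def[symmetric])
qed

lemma Cauchy_Schwarz:
  assumes "u \<in> L" "v \<in> L"
  shows "cmod (ip u v) \<le> nrm u * nrm v"
proof -
  have "(cmod (ip u v))\<^sup>2 \<le> (nrm u)\<^sup>2 * (nrm v)\<^sup>2"
    by (rule quadratic_nonneg_bound) (simp_all flip: nrm_sub_scaled[OF assms])
  then have "(cmod (ip u v))\<^sup>2 \<le> (nrm u * nrm v)\<^sup>2" by (simp add: power_mult_distrib)
  then show ?thesis
    using nrm_nonneg assms by (meson mult_nonneg_nonneg power2_le_imp_le)
qed

lemma nrm_add_sq:
  assumes "u \<in> L" "v \<in> L"
  shows "(nrm (u + v))\<^sup>2 = (nrm u)\<^sup>2 + 2 * Re (ip u v) + (nrm v)\<^sup>2"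
proof -
  have "Re (ip v u) = Re (ip u v)" using ip_sym[of u v] assms by simp
  then show ?thesis using assms by (simp add: nrm_sq L_add ip_add ip_add2)
qed

lemma nrm_sc:
  assumes "v \<in> L" shows "nrm (sc c v) = cmod c * nrm v"
proof -
  have "ip (sc c v) (sc c v) = (c * cnj c) * ip v v"
    using assms by (simp add: ip_sc ip_sc2 L_sc mult_ac)
  also have "c * cnj c = of_real ((cmod c)\<^sup>2)" by (rule complex_norm_square[symmetric])
  finally have "ip (sc c v) (sc c v) = of_real ((cmod c)\<^sup>2) * ip v v" .
  then show ?thesis by (simp add: ip_norm_def real_sqrt_mult)
qed

lemma nrm_triangle:
  assumes "u \<in> L" "v \<in> L"
  shows "nrm (u + v) \<le> nrm u + nrm v"
proof -
  have "Re (ip u v) \<le> nrm u * nrm v"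
    using Cauchy_Schwarz[OF assms] complex_Re_le_cmod order_trans by blast
  then have "(nrm (u + v))\<^sup>2 \<le> (nrm u + nrm v)\<^sup>2"
    unfolding nrm_add_sq[OF assms] by (simp add: power2_sum)
  then show ?thesis
    using assms nrm_nonneg by (meson add_nonneg_nonneg power2_le_imp_le)
qed

lemma nrm_zero [simp]: "nrm 0 = 0"
  using nrm_sc[OF L_zero, of 0] by simp

lemma nrm_uminus: "v \<in> L \<Longrightarrow> nrm (- v) = nrm v"
  using nrm_sc[of v "-1"] by simp

lemma nrm_diff_commute: "u \<in> L \<Longrightarrow> v \<in> L \<Longrightarrow> nrm (u - v) = nrm (v - u)"
  by (metis L_diff minus_diff_eq nrm_uminus)

lemma nrm_triangle_diff:
  "u \<in> L \<Longrightarrow> v \<in> L \<Longrightarrow> w \<in> L \<Longrightarrow> nrm (u - w) \<le> nrm (u - v) + nrm (v - w)"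
  using nrm_triangle[of "u - v" "v - w"] L_diff by simp

lemma ip_null:
  assumes "u \<in> L" "v \<in> L" "nrm u = 0" shows "ip u v = 0" "ip v u = 0"
proof -
  show "ip u v = 0" using Cauchy_Schwarz[of u v] assms by simp
  then show "ip v u = 0" using ip_sym[of u v] assms by simp
qed

text \<open>Stands in for the quotient by null vectors: a representative chosen arbitrarily up to a
  null vector does not affect inner products.\<close>

lemma ip_cong_null:
  assumes "u \<in> L" "u' \<in> L" "v \<in> L" "v' \<in> L" "nrm (u - u') = 0" "nrm (v - v') = 0"
  shows "ip u v = ip u' v'"
proof -
  have "ip (u - u') v = 0" "ip u' (v - v') = 0" using assms ip_null L_diff by auto
  then show ?thesis using assms by (simp add: ip_diff ip_diff2)
qed

section \<open>Closed subspaces and orthogonal complements\<close>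

definition subsp :: "'v set \<Rightarrow> bool" where
  "subsp V \<longleftrightarrow> V \<subseteq> L \<and> 0 \<in> V \<and> (\<forall>u\<in>V. \<forall>v\<in>V. u + v \<in> V) \<and> (\<forall>c. \<forall>v\<in>V. sc c v \<in> V) \<and>
    (\<forall>s l. (\<forall>n. s n \<in> V) \<and> l \<in> L \<and> (\<lambda>n. nrm (s n - l)) \<longlonglongrightarrow> 0 \<longrightarrow> l \<in> V)"

definition orth :: "'v set \<Rightarrow> 'v set" where
  "orth S = {v \<in> L. \<forall>s\<in>S. ip v s = 0}"

text \<open>Limits stay orthogonal because the inner product with a fixed vector is continuous, by
  Cauchy-Schwarz.\<close>

lemma subsp_orth:
  assumes "S \<subseteq> L" shows "subsp (orth S)"
  unfolding subsp_def
proof (intro conjI ballI allI impI)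
  show "orth S \<subseteq> L" by (auto simp: orth_def)
  show "0 \<in> orth S" using assms ip_null[OF L_zero] by (auto simp: orth_def L_zero)
  show "u + v \<in> orth S" if "u \<in> orth S" "v \<in> orth S" for u v
    using that assms by (auto simp: orth_def L_add ip_add subset_iff)
  show "sc c v \<in> orth S" if "v \<in> orth S" for c v
    using that assms by (auto simp: orth_def L_sc ip_sc subset_iff)
  fix s l assume "(\<forall>n. s n \<in> orth S) \<and> l \<in> L \<and> (\<lambda>n. nrm (s n - l)) \<longlonglongrightarrow> 0"
  then have s: "\<And>n. s n \<in> L" "\<And>n x. x \<in> S \<Longrightarrow> ip (s n) x = 0" and l: "l \<in> L"
    and lim: "(\<lambda>n. nrm (s n - l)) \<longlonglongrightarrow> 0" by (auto simp: orth_def)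
  have "ip l x = 0" if x: "x \<in> S" for x
  proof -
    have "cmod (ip l x) \<le> nrm (s n - l) * nrm x" for n
    proof -
      have "cmod (ip l x) = cmod (ip (s n - l) x)"
        using s x l assms by (simp add: ip_diff subset_iff)
      then show ?thesis using Cauchy_Schwarz[of "s n - l" x] s l x assms L_diff by auto
    qed
    moreover have "(\<lambda>n. nrm (s n - l) * nrm x) \<longlonglongrightarrow> 0" using tendsto_mult_left_zero[OF lim] .
    ultimately have "cmod (ip l x) \<le> 0" by (meson LIMSEQ_le_const)
    then show ?thesis by simp
  qed
  then show "l \<in> orth S" using l by (auto simp: orth_def)
qed

end

section \<open>Completeness and orthogonal projection\<close>

locale semi_hilbert = semi_inner +
  assumes complete: "(\<And>n::nat. s n \<in> L) \<Longrightarrow>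
    (\<And>e. e > 0 \<Longrightarrow> \<exists>N. \<forall>m\<ge>N. \<forall>n\<ge>N. ip_norm ip (s m - s n) < e) \<Longrightarrow>
    \<exists>l\<in>L. (\<lambda>n. ip_norm ip (s n - l)) \<longlonglongrightarrow> 0"
begin

text \<open>The parallelogram law for \<open>x - u\<close> and \<open>x - v\<close>, whose half sum
  is \<open>x\<close> minus the midpoint of \<open>u\<close> and \<open>v\<close>.\<close>

lemma parallelogram_midpoint:
  assumes "x \<in> L" "u \<in> L" "v \<in> L"
  shows "(nrm (u - v))\<^sup>2
    = 2 * (nrm (x - u))\<^sup>2 + 2 * (nrm (x - v))\<^sup>2 - 4 * (nrm (x - sc (1/2) (u + v)))\<^sup>2"
proof -
  define p q where "p = x - u" and "q = x - v"
  have pq: "p \<in> L" "q \<in> L" "- p \<in> L" using assms L_diff L_uminus by (auto simp: p_def q_def)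
  have half: "sc (1/2) (p + q) = x - sc (1/2) (u + v)"
  proof -
    have "p + q = sc 2 x - (u + v)" using scale_left_distrib[of 1 1 x] by (simp add: p_def q_def)
    then show ?thesis by (simp add: scale_right_diff_distrib)
  qed
  have "u - v = q + (- p)" by (simp add: p_def q_def)
  then have "(nrm (u - v))\<^sup>2 = (nrm q)\<^sup>2 - 2 * Re (ip q p) + (nrm p)\<^sup>2"
    using nrm_add_sq[OF pq(2,3)] pq ip_sc2[of q p "-1"] by (simp add: nrm_uminus)
  moreover have "(nrm (x - sc (1/2) (u + v)))\<^sup>2 = (nrm (p + q))\<^sup>2 / 4"
    unfolding half[symmetric] using pq by (simp add: nrm_sc L_add power_mult_distrib power2_eq_square)
  moreover have "(nrm (p + q))\<^sup>2 = (nrm q)\<^sup>2 + 2 * Re (ip q p) + (nrm p)\<^sup>2"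
    using nrm_add_sq[OF pq(2,1)] by (simp add: add.commute)
  ultimately show ?thesis unfolding p_def[symmetric] q_def[symmetric] by simp
qed

text \<open>A minimising sequence for the distance to \<open>x\<close> is Cauchy, because midpoints
  stay in \<open>V\<close> and cannot be closer than the infimum. Its limit is the foot of the
  perpendicular, which is determined only up to null vectors.\<close>

lemma projection:
  assumes V: "subsp V" and x: "x \<in> L"
  shows "\<exists>w\<in>V. \<forall>v\<in>V. ip (x - w) v = 0"
proof -
  have VL: "V \<subseteq> L" and V0: "0 \<in> V" and Vadd: "\<And>u v. u \<in> V \<Longrightarrow> v \<in> V \<Longrightarrow> u + v \<in> V"
    and Vsc: "\<And>c v. v \<in> V \<Longrightarrow> sc c v \<in> V"
    and Vcl: "\<And>s l. (\<And>n. s n \<in> V) \<Longrightarrow> l \<in> L \<Longrightarrow> (\<lambda>n. nrm (s n - l)) \<longlonglongrightarrow> 0 \<Longrightarrow> l \<in> V"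
    using V unfolding subsp_def by blast+
  define D where "D = (\<lambda>v. (nrm (x - v))\<^sup>2) ` V"
  define d where "d = Inf D"
  have bdd: "bdd_below D" unfolding D_def by (rule bdd_belowI2[of _ 0]) simp
  have d_le: "d \<le> (nrm (x - v))\<^sup>2" if "v \<in> V" for v
    unfolding d_def using bdd that by (auto simp: D_def intro: cInf_lower)
  have "\<exists>v\<in>V. (nrm (x - v))\<^sup>2 < d + 1 / Suc n" for n
    using cInf_lessD[of D "d + 1 / Suc n"] V0 unfolding d_def[symmetric] by (auto simp: D_def)
  then obtain s where s: "\<And>n. s n \<in> V" "\<And>n. (nrm (x - s n))\<^sup>2 < d + 1 / Suc n" by metis
  have sL: "s n \<in> L" for n using s VL by auto
  have dist: "(nrm (s m - s n))\<^sup>2 \<le> 2 / Suc m + 2 / Suc n" for m n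
  proof -
    have "sc (1/2) (s m + s n) \<in> V" using s Vadd Vsc by auto
    then have "d \<le> (nrm (x - sc (1/2) (s m + s n)))\<^sup>2" by (rule d_le)
    then show ?thesis
      using parallelogram_midpoint[OF x sL sL, of m n] s(2)[of m] s(2)[of n] by simp
  qed
  have "\<exists>l\<in>L. (\<lambda>n. nrm (s n - l)) \<longlonglongrightarrow> 0"
  proof (rule complete)
    fix e :: real assume e: "e > 0"
    obtain N :: nat where N: "4 / Suc N < e\<^sup>2"
    proof -
      obtain N where "inverse (real (Suc N)) < e\<^sup>2 / 4" using reals_Archimedean[of "e\<^sup>2 / 4"] e by auto
      then show ?thesis using that[of N] by (simp add: field_simps)
    qed
    have "nrm (s m - s n) < e" if "m \<ge> N" "n \<ge> N" for m n
    proof -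
      have "2 / Suc m \<le> 2 / real (Suc N)" "2 / Suc n \<le> 2 / real (Suc N)"
        using that by (auto intro!: divide_left_mono)
      then have "(nrm (s m - s n))\<^sup>2 < e\<^sup>2" using dist[of m n] N by simp
      then show ?thesis using e power2_less_imp_less[of "nrm (s m - s n)" e] by simp
    qed
    then show "\<exists>N. \<forall>m\<ge>N. \<forall>n\<ge>N. nrm (s m - s n) < e" by blast
  qed (rule sL)
  then obtain w where w: "w \<in> L" and lim: "(\<lambda>n. nrm (s n - w)) \<longlonglongrightarrow> 0" by blast
  have wV: "w \<in> V" using Vcl[OF s(1) w lim] .
  have xw: "x - w \<in> L" using x w L_diff by simp
  have "nrm (x - w) \<le> sqrt (d + 1 / Suc n) + nrm (s n - w)" for n
  proof -
    have "nrm (x - s n) \<le> sqrt (d + 1 / Suc n)"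
      using s(2)[of n] by (simp add: real_le_rsqrt)
    then show ?thesis using nrm_triangle_diff[OF x sL w, of n] by simp
  qed
  moreover have "(\<lambda>n. sqrt (d + 1 / Suc n) + nrm (s n - w)) \<longlonglongrightarrow> sqrt (d + 0) + 0"
    by (intro tendsto_intros lim LIMSEQ_Suc[OF lim_1_over_n])
  ultimately have "nrm (x - w) \<le> sqrt (d + 0) + 0"
    by (intro LIMSEQ_le_const) auto
  then have le: "nrm (x - w) \<le> sqrt d" by simp
  then have "0 \<le> sqrt d" using nrm_nonneg[OF xw] by linarith
  then have min: "(nrm (x - w))\<^sup>2 \<le> d"
    using power_mono[OF le nrm_nonneg[OF xw], of 2] by simp
  have "ip (x - w) v = 0" if v: "v \<in> V" for v
  proof -
    have vL: "v \<in> L" using v VL by auto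
    \<comment> \<open>Moving \<open>w\<close> inside \<open>V\<close> along \<open>v\<close> cannot
      reduce the distance, so the quadratic in \<open>t\<close> is nonnegative with constant term
      \<open>a = 0\<close>.\<close>
    have "(cmod (ip (x - w) v))\<^sup>2 \<le> 0 * (nrm v)\<^sup>2"
    proof (rule quadratic_nonneg_bound)
      fix t :: real
      define c where "c = of_real t * ip (x - w) v"
      have "w + sc c v \<in> V" using wV v Vadd Vsc by auto
      from d_le[OF this] have "d \<le> (nrm (x - w - sc c v))\<^sup>2" by (simp add: diff_diff_eq)
      then show "0 \<le> 0 - 2 * t * (cmod (ip (x - w) v))\<^sup>2
          + t\<^sup>2 * (cmod (ip (x - w) v))\<^sup>2 * (nrm v)\<^sup>2"
        using min nrm_sub_scaled[OF xw vL, of t] unfolding c_def by simp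
    qed simp_all
    then show ?thesis by simp
  qed
  then show ?thesis using wV by blast
qed

end

section \<open>Kazhdan's property for almost invariant vectors\<close>

lemma cring_complex_field: "cring complex_field"
proof (rule cringI)
  show "abelian_group complex_field"
    by (rule abelian_groupI) (auto simp: complex_field_def add.assoc intro: exI[of _ "- x" for x] ab_left_minus)
  show "comm_monoid complex_field"
    by (rule comm_monoidI) (auto simp: complex_field_def)
  show "(x \<oplus>\<^bsub>complex_field\<^esub> y) \<otimes>\<^bsub>complex_field\<^esub> z =
     x \<otimes>\<^bsub>complex_field\<^esub> z \<oplus>\<^bsub>complex_field\<^esub> y \<otimes>\<^bsub>complex_field\<^esub> z" for x y z
    by (simp add: complex_field_def algebra_simps)
qed

definition kazhdan_pair :: "('g, 'r) monoid_scheme \<Rightarrow> 'g set \<Rightarrow> real \<Rightarrow> bool" where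
  "kazhdan_pair G F \<epsilon> \<longleftrightarrow> finite F \<and> F \<subseteq> carrier G \<and> 0 < \<epsilon> \<and>
       (\<forall>(H :: (nat \<Rightarrow> complex) hilbert) \<pi>.
          hilbert_space H \<and> unitary_rep G H \<pi> \<and>
          (\<exists>v\<in>carrier H - {\<zero>\<^bsub>H\<^esub>}. \<forall>g\<in>F. hnorm H (\<pi> g v \<ominus>\<^bsub>H\<^esub> v) < \<epsilon> * hnorm H v) \<longrightarrow>
          (\<exists>w\<in>carrier H - {\<zero>\<^bsub>H\<^esub>}. \<forall>g\<in>carrier G. \<pi> g w = w))"

lemma property_T_iff: "property_T G \<longleftrightarrow> (\<exists>F \<epsilon>. kazhdan_pair G F \<epsilon>)"
  by (simp add: property_T_def kazhdan_pair_def)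

text \<open>Countability of \<open>G\<close> is what allows the coefficients of a vector against an
  orbit to be listed as a sequence.\<close>

locale semi_rep = semi_hilbert sc L ip + G: group G
  for sc :: "complex \<Rightarrow> 'v::ab_group_add \<Rightarrow> 'v" and L ip and G :: "('g, 'r) monoid_scheme" (structure) +
  fixes \<pi> :: "'g \<Rightarrow> 'v \<Rightarrow> 'v"
  assumes countable_G: "countable (carrier G)"
    and \<pi>_in: "g \<in> carrier G \<Longrightarrow> v \<in> L \<Longrightarrow> \<pi> g v \<in> L"
    and \<pi>_add: "g \<in> carrier G \<Longrightarrow> u \<in> L \<Longrightarrow> v \<in> L \<Longrightarrow> \<pi> g (u + v) = \<pi> g u + \<pi> g v"
    and \<pi>_sc: "g \<in> carrier G \<Longrightarrow> v \<in> L \<Longrightarrow> \<pi> g (sc c v) = sc c (\<pi> g v)"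
    and \<pi>_ip: "g \<in> carrier G \<Longrightarrow> u \<in> L \<Longrightarrow> v \<in> L \<Longrightarrow> ip (\<pi> g u) (\<pi> g v) = ip u v"
    and \<pi>_one: "v \<in> L \<Longrightarrow> \<pi> \<one> v = v"
    and \<pi>_mult: "g \<in> carrier G \<Longrightarrow> h \<in> carrier G \<Longrightarrow> v \<in> L \<Longrightarrow> \<pi> (g \<otimes> h) v = \<pi> g (\<pi> h v)"
begin

lemma \<pi>_diff: "g \<in> carrier G \<Longrightarrow> u \<in> L \<Longrightarrow> v \<in> L \<Longrightarrow> \<pi> g (u - v) = \<pi> g u - \<pi> g v"
  using \<pi>_add[of g u "-v"] \<pi>_sc[of g v "-1"] L_uminus by simp

lemma \<pi>_nrm: "g \<in> carrier G \<Longrightarrow> v \<in> L \<Longrightarrow> nrm (\<pi> g v) = nrm v"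
  by (simp add: ip_norm_def \<pi>_ip)

lemma \<pi>_adjoint:
  assumes "g \<in> carrier G" "u \<in> L" "v \<in> L"
  shows "ip (\<pi> g u) v = ip u (\<pi> (inv g) v)"
proof -
  have "\<pi> g (\<pi> (inv g) v) = v" using assms by (simp flip: \<pi>_mult add: \<pi>_one)
  then show ?thesis using \<pi>_ip[of g u "\<pi> (inv g) v"] assms by (simp add: \<pi>_in)
qed

text \<open>Invariance is asked up to null vectors: this is all that a fixed vector of the coded
  representation gives back, since coding forgets null vectors.\<close>

definition Inv :: "'v set" where
  "Inv = {v \<in> L. \<forall>g\<in>carrier G. nrm (\<pi> g v - v) = 0}"

lemma subsp_Inv: "subsp Inv"
  unfolding subsp_def
proof (intro conjI ballI allI impI)
  show "Inv \<subseteq> L" by (auto simp: Inv_def)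
  have "\<pi> g 0 = 0" if "g \<in> carrier G" for g using \<pi>_diff[OF that L_zero L_zero] by simp
  then show "0 \<in> Inv" by (auto simp: Inv_def L_zero)
  show "u + v \<in> Inv" if uv: "u \<in> Inv" "v \<in> Inv" for u v
  proof -
    have "nrm (\<pi> g (u + v) - (u + v)) = 0" if g: "g \<in> carrier G" for g
    proof -
      have eq: "\<pi> g (u + v) - (u + v) = (\<pi> g u - u) + (\<pi> g v - v)"
        using g uv by (simp add: \<pi>_add Inv_def)
      moreover have "nrm ((\<pi> g u - u) + (\<pi> g v - v)) \<le> 0"
        using nrm_triangle[of "\<pi> g u - u" "\<pi> g v - v"] g uv L_diff \<pi>_in by (auto simp: Inv_def)
      ultimately show ?thesis unfolding eq
        using nrm_nonneg[of "(\<pi> g u - u) + (\<pi> g v - v)"] g uv L_diff L_add \<pi>_in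
        by (auto simp: Inv_def)
    qed
    then show ?thesis using uv by (auto simp: Inv_def L_add)
  qed
  show "sc c v \<in> Inv" if v: "v \<in> Inv" for c v
  proof -
    have "nrm (\<pi> g (sc c v) - sc c v) = 0" if g: "g \<in> carrier G" for g
    proof -
      have "\<pi> g (sc c v) - sc c v = sc c (\<pi> g v - v)"
        using g v by (simp add: \<pi>_sc Inv_def scale_right_diff_distrib)
      then show ?thesis using g v nrm_sc L_diff \<pi>_in by (auto simp: Inv_def)
    qed
    then show ?thesis using v by (auto simp: Inv_def L_sc)
  qed
  fix s l assume "(\<forall>n. s n \<in> Inv) \<and> l \<in> L \<and> (\<lambda>n. nrm (s n - l)) \<longlonglongrightarrow> 0"
  then have s: "\<And>n. s n \<in> L" "\<And>n g. g \<in> carrier G \<Longrightarrow> nrm (\<pi> g (s n) - s n) = 0" and l: "l \<in> L"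
    and lim: "(\<lambda>n. nrm (s n - l)) \<longlonglongrightarrow> 0" by (auto simp: Inv_def)
  have "nrm (\<pi> g l - l) = 0" if g: "g \<in> carrier G" for g
  proof -
    have "nrm (\<pi> g l - l) \<le> nrm (s n - l) + nrm (s n - l)" for n
    proof -
      have "nrm (\<pi> g l - l) \<le> nrm (\<pi> g l - \<pi> g (s n)) + nrm (\<pi> g (s n) - l)"
        using g s l \<pi>_in by (intro nrm_triangle_diff) auto
      also have "nrm (\<pi> g (s n) - l) \<le> nrm (\<pi> g (s n) - s n) + nrm (s n - l)"
        using g s l \<pi>_in by (intro nrm_triangle_diff) auto
      also have "nrm (\<pi> g l - \<pi> g (s n)) = nrm (s n - l)"
        using g s l nrm_diff_commute[of l "s n"] by (simp flip: \<pi>_diff add: \<pi>_nrm L_diff)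
      finally show ?thesis using s(2)[OF g, of n] by simp
    qed
    moreover have "(\<lambda>n. nrm (s n - l) + nrm (s n - l)) \<longlonglongrightarrow> 0 + 0" by (intro tendsto_intros lim)
    ultimately have "nrm (\<pi> g l - l) \<le> 0 + 0" by (meson LIMSEQ_le_const)
    then show ?thesis using nrm_nonneg[of "\<pi> g l - l"] g l \<pi>_in L_diff by auto
  qed
  then show "l \<in> Inv" using l by (auto simp: Inv_def)
qed

section \<open>Cyclic subrepresentations in sequence coordinates\<close>

definition orbit :: "'v \<Rightarrow> 'v set" where "orbit y = (\<lambda>g. \<pi> g y) ` carrier G"

text \<open>The double orthogonal complement is the closed linear span of the orbit. In this form
  closedness comes from \<open>subsp_orth\<close>, and a vector of it that is orthogonal to the
  orbit is orthogonal to itself.\<close>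

definition cyc :: "'v \<Rightarrow> 'v set" where "cyc y = orth (orth (orbit y))"

definition code :: "'v \<Rightarrow> 'v \<Rightarrow> nat \<Rightarrow> complex" where
  "code y v n = ip v (\<pi> (from_nat_into (carrier G) n) y)"

text \<open>A choice of preimage. On the image of \<open>code\<close>, two choices differ by a null
  vector (\<open>code_inj\<close>), which inner products do not see.\<close>

definition decode :: "'v \<Rightarrow> (nat \<Rightarrow> complex) \<Rightarrow> 'v" where
  "decode y c = (SOME v. v \<in> cyc y \<and> code y v = c)"

text \<open>Addition and scalars are pointwise because coefficients are linear in the vector. The
  inner product is pulled back through \<open>decode\<close> from the original space.\<close>

definition code_space :: "'v \<Rightarrow> (nat \<Rightarrow> complex) hilbert" where
  "code_space y = \<lparr>carrier = code y ` cyc y, mult = (\<lambda>a b. a), one = (\<lambda>_. 0), ring.zero = (\<lambda>_. 0),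
     add = (\<lambda>a b n. a n + b n), smult = (\<lambda>c a n. c * a n),
     cinner = (\<lambda>a b. ip (decode y a) (decode y b))\<rparr>"

definition code_rep :: "'v \<Rightarrow> 'g \<Rightarrow> (nat \<Rightarrow> complex) \<Rightarrow> nat \<Rightarrow> complex" where
  "code_rep y g c = code y (\<pi> g (decode y c))"

context
  fixes y assumes y: "y \<in> L"
begin

lemma subsp_cyc: "subsp (cyc y)"
  unfolding cyc_def by (rule subsp_orth) (auto simp: orth_def)

lemma cyc_L: "v \<in> cyc y \<Longrightarrow> v \<in> L"
  and cyc_zero: "0 \<in> cyc y"
  and cyc_add: "u \<in> cyc y \<Longrightarrow> v \<in> cyc y \<Longrightarrow> u + v \<in> cyc y"
  and cyc_sc: "v \<in> cyc y \<Longrightarrow> sc c v \<in> cyc y"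
  and cyc_closed: "(\<And>n. s n \<in> cyc y) \<Longrightarrow> l \<in> L \<Longrightarrow> (\<lambda>n. nrm (s n - l)) \<longlonglongrightarrow> 0 \<Longrightarrow> l \<in> cyc y"
  using subsp_cyc unfolding subsp_def by blast+

lemma cyc_diff: "u \<in> cyc y \<Longrightarrow> v \<in> cyc y \<Longrightarrow> u - v \<in> cyc y"
  using cyc_add[of u "-v"] cyc_sc[of v "-1"] by simp

lemma cyc_generator: "y \<in> cyc y"
proof -
  have "ip y s = 0" if "s \<in> orth (orbit y)" for s
  proof -
    have "y \<in> orbit y" using \<pi>_one[OF y] by (auto simp: orbit_def image_iff intro!: bexI[of _ "\<one>"])
    then have "ip s y = 0" using that by (auto simp: orth_def)
    then show ?thesis using that ip_sym[of s y] y by (auto simp: orth_def)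
  qed
  then show ?thesis using y by (auto simp: cyc_def orth_def[of "orth _"])
qed

text \<open>The adjoint \<open>\<pi> (inv g)\<close> preserves the orthogonal complement of the
  orbit, hence \<open>\<pi> g\<close> preserves the complement of that.\<close>

lemma cyc_rep:
  assumes g: "g \<in> carrier G" and v: "v \<in> cyc y" shows "\<pi> g v \<in> cyc y"
proof -
  have "ip (\<pi> g v) s = 0" if s: "s \<in> orth (orbit y)" for s
  proof -
    have sL: "s \<in> L" using s by (auto simp: orth_def)
    have "ip (\<pi> (inv g) s) (\<pi> h y) = 0" if h: "h \<in> carrier G" for h
    proof -
      have "ip (\<pi> (inv g) s) (\<pi> h y) = ip s (\<pi> (g \<otimes> h) y)"
        using g h sL y by (simp add: \<pi>_adjoint \<pi>_in \<pi>_mult)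
      then show ?thesis using s g h by (auto simp: orth_def orbit_def)
    qed
    then have "\<pi> (inv g) s \<in> orth (orbit y)" using g sL \<pi>_in by (auto simp: orth_def orbit_def)
    then have "ip v (\<pi> (inv g) s) = 0" using v by (auto simp: cyc_def orth_def[of "orth _"])
    then show ?thesis using g v sL cyc_L by (simp add: \<pi>_adjoint)
  qed
  moreover have "\<pi> g v \<in> L" using \<pi>_in[OF g cyc_L[OF v]] .
  ultimately show ?thesis by (auto simp: cyc_def orth_def[of "orth _"])
qed

lemma enum_G: "from_nat_into (carrier G) n \<in> carrier G"
  by (rule from_nat_into) blast

lemma code_add: "u \<in> L \<Longrightarrow> v \<in> L \<Longrightarrow> code y (u + v) = (\<lambda>n. code y u n + code y v n)"
  and code_diff: "u \<in> L \<Longrightarrow> v \<in> L \<Longrightarrow> code y (u - v) = (\<lambda>n. code y u n - code y v n)"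
  and code_sc: "v \<in> L \<Longrightarrow> code y (sc c v) = (\<lambda>n. c * code y v n)"
  using y by (auto simp: code_def fun_eq_iff ip_add ip_diff ip_sc \<pi>_in enum_G)

lemma code_zero: "code y 0 = (\<lambda>_. 0)"
  using code_diff[OF L_zero L_zero] by simp

lemma code_null: "v \<in> L \<Longrightarrow> nrm v = 0 \<Longrightarrow> code y v = (\<lambda>_. 0)"
  using y by (auto simp: code_def fun_eq_iff ip_null \<pi>_in enum_G)

lemma code_eq_zero_orth:
  assumes "v \<in> L" "code y v = (\<lambda>_. 0)" shows "v \<in> orth (orbit y)"
proof -
  have "ip v (\<pi> g y) = 0" if g: "g \<in> carrier G" for g
    using fun_cong[OF assms(2), of "to_nat_on (carrier G) g"] countable_G g by (simp add: code_def)
  then show ?thesis using assms by (auto simp: orth_def orbit_def)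
qed

lemma cyc_orth_null:
  assumes "v \<in> cyc y" "v \<in> orth (orbit y)" shows "nrm v = 0"
proof -
  have "ip v v = 0" using assms by (auto simp: cyc_def orth_def[of "orth _"])
  then show ?thesis by (simp add: ip_norm_def)
qed

lemma code_inj:
  assumes "u \<in> cyc y" "v \<in> cyc y" "code y u = code y v" shows "nrm (u - v) = 0"
  using assms by (intro cyc_orth_null code_eq_zero_orth) (auto simp: cyc_diff cyc_L L_diff code_diff)

lemma decode: "v \<in> cyc y \<Longrightarrow> decode y (code y v) \<in> cyc y \<and> code y (decode y (code y v)) = code y v"
  unfolding decode_def by (rule someI[of _ v]) simp

lemma decode_near: "v \<in> cyc y \<Longrightarrow> nrm (decode y (code y v) - v) = 0"
  using decode code_inj by blast

lemma cinner_code: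
  assumes "u \<in> cyc y" "v \<in> cyc y" shows "cinner (code_space y) (code y u) (code y v) = ip u v"
  using assms decode decode_near cyc_L by (auto simp: code_space_def intro!: ip_cong_null)

lemma hnorm_code: "v \<in> cyc y \<Longrightarrow> hnorm (code_space y) (code y v) = nrm v"
  by (simp add: hnorm_def cinner_code ip_norm_def)

text \<open>\<open>decode\<close> returns a vector at distance zero from \<open>v\<close>; the
  isometry \<open>\<pi> g\<close> keeps the difference null, and \<open>code\<close> sends it to the
  zero sequence.\<close>

lemma code_rep_code:
  assumes g: "g \<in> carrier G" and v: "v \<in> cyc y" shows "code_rep y g (code y v) = code y (\<pi> g v)"
proof -
  define u where "u = decode y (code y v)"
  have u: "u \<in> cyc y" "nrm (u - v) = 0" using decode decode_near v by (auto simp: u_def)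
  have L: "u \<in> L" "v \<in> L" using u v cyc_L by auto
  have "code y (\<pi> g (u - v)) = (\<lambda>_. 0)"
    using g u L by (intro code_null) (auto simp: \<pi>_nrm \<pi>_in L_diff)
  then show ?thesis
    using g L by (auto simp: code_rep_def u_def[symmetric] \<pi>_diff code_diff \<pi>_in fun_eq_iff)
qed

lemma carrier_code_space: "carrier (code_space y) = code y ` cyc y"
  and zero_code_space: "\<zero>\<^bsub>code_space y\<^esub> = (\<lambda>_. 0)"
  and add_code_space: "a \<oplus>\<^bsub>code_space y\<^esub> b = (\<lambda>n. a n + b n)"
  and smult_code_space: "c \<odot>\<^bsub>code_space y\<^esub> a = (\<lambda>n. c * a n)"
  by (simp_all add: code_space_def)

lemmas code_space_simps = carrier_code_space zero_code_space add_code_space smult_code_space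

lemma module_code_space: "Module.module complex_field (code_space y)"
proof (rule moduleI)
  show "abelian_group (code_space y)"
  proof (rule abelian_groupI)
    fix a assume "a \<in> carrier (code_space y)"
    then obtain v where v: "v \<in> cyc y" "a = code y v" by (auto simp: code_space_simps)
    have "code y (sc (-1) v) \<oplus>\<^bsub>code_space y\<^esub> a = \<zero>\<^bsub>code_space y\<^esub>"
      using v by (simp add: code_space_simps code_sc cyc_L del: scale_minus_left)
    then show "\<exists>b\<in>carrier (code_space y). b \<oplus>\<^bsub>code_space y\<^esub> a = \<zero>\<^bsub>code_space y\<^esub>"
      using v cyc_sc by (intro bexI[of _ "code y (sc (-1) v)"])
        (simp_all add: code_space_simps(1) del: scale_minus_left)
  next
    show "\<zero>\<^bsub>code_space y\<^esub> \<in> carrier (code_space y)"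
      using cyc_zero code_zero by (force simp: code_space_simps)
    show "a \<oplus>\<^bsub>code_space y\<^esub> b \<in> carrier (code_space y)"
      if "a \<in> carrier (code_space y)" "b \<in> carrier (code_space y)" for a b
      using that by (auto simp: code_space_simps cyc_L cyc_add simp flip: code_add)
  qed (auto simp: code_space_simps add_ac)
  show "c \<odot>\<^bsub>code_space y\<^esub> a \<in> carrier (code_space y)"
    if "a \<in> carrier (code_space y)" for a c
    using that by (auto simp: code_space_simps cyc_L cyc_sc simp flip: code_sc)
qed (rule cring_complex_field, auto simp: code_space_simps complex_field_def algebra_simps)

lemma minus_code_space:
  assumes "u \<in> cyc y" "v \<in> cyc y"
  shows "code y u \<ominus>\<^bsub>code_space y\<^esub> code y v = code y (u - v)"
proof -
  interpret Module.module complex_field "code_space y" by (rule module_code_space)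
  have v': "sc (-1) v \<in> cyc y" using assms cyc_sc by blast
  then have "code y (sc (-1) v) \<oplus>\<^bsub>code_space y\<^esub> code y v = \<zero>\<^bsub>code_space y\<^esub>"
    using assms by (simp add: code_space_simps code_sc cyc_L del: scale_minus_left)
  then have "\<ominus>\<^bsub>code_space y\<^esub> code y v = code y (sc (-1) v)"
    using assms v' by (intro M.minus_equality) (auto simp: code_space_simps(1))
  then show ?thesis
    unfolding M.minus_eq using assms
    by (simp add: code_space_simps code_sc code_diff cyc_L del: scale_minus_left)
qed

text \<open>Coding is isometric, so a Cauchy sequence lifts to one in the cyclic space, and the
  limit lies there because that space is closed.\<close>

lemma hilbert_space_code_space: "hilbert_space (code_space y)"
proof -
  have 1: "\<forall>u\<in>carrier (code_space y). \<forall>v\<in>carrier (code_space y). \<forall>w\<in>carrier (code_space y).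
        cinner (code_space y) (u \<oplus>\<^bsub>code_space y\<^esub> v) w
        = cinner (code_space y) u w + cinner (code_space y) v w"
    by (auto simp: code_space_simps cyc_L cyc_add cinner_code ip_add simp flip: code_add)
  have 2: "\<forall>c. \<forall>u\<in>carrier (code_space y). \<forall>v\<in>carrier (code_space y).
        cinner (code_space y) (c \<odot>\<^bsub>code_space y\<^esub> u) v = c * cinner (code_space y) u v"
    by (auto simp: code_space_simps cyc_L cyc_sc cinner_code ip_sc simp flip: code_sc)
  have 3: "\<forall>u\<in>carrier (code_space y). \<forall>v\<in>carrier (code_space y).
        cinner (code_space y) v u = cnj (cinner (code_space y) u v)"
    by (auto simp: code_space_simps cyc_L cinner_code intro: ip_sym)
  have 4: "\<forall>v\<in>carrier (code_space y) - {\<zero>\<^bsub>code_space y\<^esub>}. 0 < Re (cinner (code_space y) v v)"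
  proof
    fix a assume "a \<in> carrier (code_space y) - {\<zero>\<^bsub>code_space y\<^esub>}"
    then obtain v where v: "v \<in> cyc y" "code y v \<noteq> (\<lambda>_. 0)" "a = code y v"
      by (auto simp: code_space_simps)
    then have "nrm v \<noteq> 0" using code_null cyc_L by blast
    then show "0 < Re (cinner (code_space y) a a)" using ip_nonneg[of v] v cyc_L
      by (auto simp: cinner_code ip_norm_def order.order_iff_strict)
  qed
  have ips: "inner_product_space (code_space y)"
    unfolding inner_product_space_def using module_code_space 1 2 3 4 by blast
  have "\<exists>l\<in>carrier (code_space y). (\<lambda>n. hnorm (code_space y) (s n \<ominus>\<^bsub>code_space y\<^esub> l)) \<longlonglongrightarrow> 0"
    if s: "\<And>n. s n \<in> carrier (code_space y)"
      and cauchy: "\<And>e. e > 0 \<Longrightarrow> \<exists>N. \<forall>m\<ge>N. \<forall>n\<ge>N. hnorm (code_space y) (s m \<ominus>\<^bsub>code_space y\<^esub> s n) < e"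
    for s :: "nat \<Rightarrow> nat \<Rightarrow> complex"
  proof -
    obtain r where r: "\<And>n. r n \<in> cyc y" and s_eq: "\<And>n. s n = code y (r n)"
      using s unfolding code_space_simps image_iff by metis
    have "\<exists>l\<in>L. (\<lambda>n. nrm (r n - l)) \<longlonglongrightarrow> 0"
    proof (rule complete)
      show "r n \<in> L" for n using r cyc_L by blast
      show "\<exists>N. \<forall>m\<ge>N. \<forall>n\<ge>N. nrm (r m - r n) < e" if "e > 0" for e
        using cauchy[OF that] r by (simp add: s_eq minus_code_space hnorm_code cyc_diff)
    qed
    then obtain l where l: "l \<in> L" "(\<lambda>n. nrm (r n - l)) \<longlonglongrightarrow> 0" by blast
    have lc: "l \<in> cyc y" using cyc_closed[OF r l] .
    then show ?thesis
      using l r by (intro bexI[of _ "code y l"])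
        (auto simp: s_eq minus_code_space hnorm_code cyc_diff code_space_simps)
  qed
  then show ?thesis unfolding hilbert_space_def using ips by blast
qed

lemma unitary_rep_code_rep: "unitary_rep G (code_space y) (code_rep y)"
  unfolding unitary_rep_def
proof (intro conjI ballI)
  have rep: "\<And>g c. g \<in> carrier G \<Longrightarrow> c \<in> code y ` cyc y \<Longrightarrow> code_rep y g c \<in> code y ` cyc y"
    by (auto simp: code_rep_code cyc_rep)
  have inv: "code_rep y g (code_rep y (inv g) c) = c" "code_rep y (inv g) (code_rep y g c) = c"
    if "g \<in> carrier G" "c \<in> code y ` cyc y" for g c
    using that by (auto simp: code_rep_code cyc_rep cyc_L \<pi>_one simp flip: \<pi>_mult)
  fix g assume g: "g \<in> carrier G"
  show "unitary_op (code_space y) (code_rep y g)"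
    unfolding unitary_op_def
  proof (intro conjI ballI allI)
    show "bij_betw (code_rep y g) (carrier (code_space y)) (carrier (code_space y))"
      unfolding code_space_simps
      by (rule bij_betw_byWitness[where f' = "code_rep y (inv g)"]) (use inv rep g in auto)
  qed (use g in \<open>auto simp: code_space_simps code_rep_code cinner_code cyc_L cyc_add cyc_sc cyc_rep
      \<pi>_add \<pi>_sc \<pi>_ip \<pi>_in simp flip: code_add code_sc\<close>)
next
  fix g h v assume "g \<in> carrier G" "h \<in> carrier G" "v \<in> carrier (code_space y)"
  then show "code_rep y (g \<otimes> h) v = code_rep y g (code_rep y h v)"
    by (auto simp: code_space_simps code_rep_code cyc_rep cyc_L \<pi>_mult)
qed

end

text \<open>
  Subtracting from \<open>x\<close> its projection to the invariant vectors leaves a vector \<open>y\<close> whose cyclic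
  subrepresentation has no invariant vector. The coefficients \<open>\<langle>v, \<pi>(g) y\<rangle>\<close> determine a vector of this
  subrepresentation, so it can be realised on a subset of \<open>nat \<Rightarrow> complex\<close>.
\<close>

theorem kazhdan_near_invariant:
  assumes KP: "kazhdan_pair G F \<epsilon>" and x: "x \<in> L" and "0 < \<eta>"
    and near: "\<And>g. g \<in> F \<Longrightarrow> nrm (\<pi> g x - x) < \<epsilon> * \<eta>"
  shows "\<exists>w\<in>L. (\<forall>g\<in>carrier G. nrm (\<pi> g w - w) = 0) \<and> nrm (w - x) < \<eta>"
proof -
  have F: "F \<subseteq> carrier G" and \<epsilon>: "0 < \<epsilon>" using KP by (auto simp: kazhdan_pair_def)
  obtain w where w: "w \<in> Inv" and orth: "\<And>v. v \<in> Inv \<Longrightarrow> ip (x - w) v = 0"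
    using projection[OF subsp_Inv x] by blast
  have wL: "w \<in> L" and w_inv: "\<And>g. g \<in> carrier G \<Longrightarrow> nrm (\<pi> g w - w) = 0"
    using w by (auto simp: Inv_def)
  define y where "y = x - w"
  have y: "y \<in> L" using x wL L_diff by (simp add: y_def)
  have "nrm y < \<eta>"
  proof (rule ccontr)
    assume "\<not> nrm y < \<eta>"
    then have y_ge: "\<eta> \<le> nrm y" by simp
    have "code y y \<noteq> (\<lambda>_. 0)"
    proof
      assume "code y y = (\<lambda>_. 0)"
      then have "nrm y = 0" using y cyc_generator cyc_orth_null code_eq_zero_orth by blast
      then show False using y_ge \<open>0 < \<eta>\<close> by simp
    qed
    then have nz: "code y y \<in> carrier (code_space y) - {\<zero>\<^bsub>code_space y\<^esub>}"
      using cyc_generator[OF y] y by (auto simp: code_space_simps)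
    \<comment> \<open>\<open>y\<close> is displaced as little as \<open>x\<close>, since
      \<open>w\<close> is invariant, and the assumption \<open>\<eta> \<le> nrm y\<close> turns the
      absolute bound into the relative one required by the Kazhdan pair.\<close>
    have "hnorm (code_space y) (code_rep y g (code y y) \<ominus>\<^bsub>code_space y\<^esub> code y y)
        < \<epsilon> * hnorm (code_space y) (code y y)" if "g \<in> F" for g
    proof -
      have g: "g \<in> carrier G" using that F by auto
      have "\<pi> g y - y = (\<pi> g x - x) + (w - \<pi> g w)" using g x wL by (simp add: y_def \<pi>_diff)
      also have "nrm \<dots> \<le> nrm (\<pi> g x - x) + nrm (w - \<pi> g w)"
        using g x wL \<pi>_in L_diff by (intro nrm_triangle) auto
      also have "nrm (w - \<pi> g w) = 0" using w_inv[OF g] nrm_diff_commute g wL \<pi>_in by simp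
      finally have "nrm (\<pi> g y - y) < \<epsilon> * \<eta>" using near[OF that] by simp
      also have "\<dots> \<le> \<epsilon> * nrm y" using y_ge \<epsilon> by simp
      finally show ?thesis
        using g y cyc_generator[OF y] by (simp add: code_rep_code minus_code_space hnorm_code cyc_diff cyc_rep)
    qed
    then obtain c where c: "c \<in> carrier (code_space y) - {\<zero>\<^bsub>code_space y\<^esub>}"
      and c_inv: "\<And>g. g \<in> carrier G \<Longrightarrow> code_rep y g c = c"
      using KP nz hilbert_space_code_space[OF y] unitary_rep_code_rep[OF y]
      unfolding kazhdan_pair_def by blast
    obtain v where v: "v \<in> cyc y" "c = code y v" using c y by (auto simp: code_space_simps)
    have vL: "v \<in> L" using v cyc_L y by auto
    have null: "nrm (\<pi> g v - v) = 0" if g: "g \<in> carrier G" for g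
      using code_inj[OF y, of "\<pi> g v" v] c_inv[OF g] v g y by (simp add: code_rep_code cyc_rep)
    then have "v \<in> Inv" using vL by (auto simp: Inv_def)
    \<comment> \<open>By the choice of \<open>w\<close>, the invariant vector \<open>v\<close> is
      orthogonal to \<open>y\<close>, hence to the whole orbit of \<open>y\<close>. As it lies in
      the cyclic space it is null, against \<open>c\<close> being nonzero.\<close>
    then have yv: "ip v y = 0" using orth[of v] ip_sym[of y v] y vL by (simp add: y_def)
    have "ip v (\<pi> g y) = 0" if g: "g \<in> carrier G" for g
    proof -
      have "ip v (\<pi> g y) = ip (\<pi> (inv g) v) y"
        using \<pi>_adjoint[of "inv g" v y] g vL y by simp
      also have "\<dots> = ip v y"
        using g vL y null[of "inv g"] by (intro ip_cong_null) (auto simp: \<pi>_in)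
      finally show ?thesis using yv by simp
    qed
    then have "v \<in> orth (orbit y)" using vL by (auto simp: orth_def orbit_def)
    then have "nrm v = 0" using cyc_orth_null[OF y] v by blast
    then have "c = (\<lambda>_. 0)" using code_null[OF y vL] v by simp
    then show False using c y by (simp add: code_space_simps)
  qed
  moreover have "nrm (w - x) = nrm y" using nrm_diff_commute x wL by (simp add: y_def)
  ultimately show ?thesis using wL w_inv by (intro bexI[of _ w]) auto
qed

end

section \<open>The Koopman representation\<close>

text \<open>
  The functions vanish outside the space, so that the Koopman representation is a homomorphism
  everywhere and not only almost everywhere.
\<close>

definition L2 :: "'a measure \<Rightarrow> ('a \<Rightarrow> complex) set" where
  "L2 M = {\<xi> \<in> borel_measurable M. (\<forall>x. x \<notin> space M \<longrightarrow> \<xi> x = 0) \<and> integrable M (\<lambda>x. (cmod (\<xi> x))\<^sup>2)}"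

definition L2_ip :: "'a measure \<Rightarrow> ('a \<Rightarrow> complex) \<Rightarrow> ('a \<Rightarrow> complex) \<Rightarrow> complex" where
  "L2_ip M \<xi> \<eta> = (\<integral>x. \<xi> x * cnj (\<eta> x) \<partial>M)"

lemma L2_measurable [measurable_dest]: "\<xi> \<in> L2 M \<Longrightarrow> \<xi> \<in> borel_measurable M"
  and L2_integrable: "\<xi> \<in> L2 M \<Longrightarrow> integrable M (\<lambda>x. (cmod (\<xi> x))\<^sup>2)"
  by (auto simp: L2_def)

lemma norm_mult_cnj_le: "norm (a * cnj b) \<le> norm ((cmod a)\<^sup>2 + (cmod b)\<^sup>2)"
proof -
  have "2 * cmod a * cmod b \<le> (cmod a)\<^sup>2 + (cmod b)\<^sup>2" by (rule sum_squares_bound)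
  moreover have "0 \<le> cmod a * cmod b" by simp
  ultimately have "cmod a * cmod b \<le> (cmod a)\<^sup>2 + (cmod b)\<^sup>2" by linarith
  then show ?thesis by (simp add: norm_mult)
qed

lemma norm_add_sq_le: "(cmod (a + b))\<^sup>2 \<le> 2 * (cmod a)\<^sup>2 + 2 * (cmod b)\<^sup>2"
proof -
  have "(cmod (a + b))\<^sup>2 \<le> (cmod a + cmod b)\<^sup>2" by (intro power_mono norm_triangle_ineq) simp
  also have "\<dots> \<le> 2 * (cmod a)\<^sup>2 + 2 * (cmod b)\<^sup>2"
    using sum_squares_bound[of "cmod a" "cmod b"] by (simp add: power2_sum)
  finally show ?thesis .
qed

lemma borel_measurable_cnj [measurable]: "cnj \<in> borel_measurable borel"
  by (intro borel_measurable_continuous_onI continuous_intros)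

lemma L2_mult_integrable:
  assumes "\<xi> \<in> L2 M" "\<eta> \<in> L2 M" shows "integrable M (\<lambda>x. \<xi> x * cnj (\<eta> x))"
proof (rule Bochner_Integration.integrable_bound)
  show "integrable M (\<lambda>x. (cmod (\<xi> x))\<^sup>2 + (cmod (\<eta> x))\<^sup>2)"
    using assms by (simp add: L2_integrable)
  have [measurable]: "\<xi> \<in> borel_measurable M" "\<eta> \<in> borel_measurable M"
    using assms by (auto simp: L2_measurable)
  show "(\<lambda>x. \<xi> x * cnj (\<eta> x)) \<in> borel_measurable M" by measurable
  show "AE x in M. norm (\<xi> x * cnj (\<eta> x)) \<le> norm ((cmod (\<xi> x))\<^sup>2 + (cmod (\<eta> x))\<^sup>2)"
    by (intro AE_I2 norm_mult_cnj_le)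
qed

lemma L2_add: assumes "\<xi> \<in> L2 M" "\<eta> \<in> L2 M" shows "\<xi> + \<eta> \<in> L2 M"
proof -
  have "integrable M (\<lambda>x. (cmod (\<xi> x + \<eta> x))\<^sup>2)"
  proof (rule Bochner_Integration.integrable_bound)
    show "integrable M (\<lambda>x. 2 * (cmod (\<xi> x))\<^sup>2 + 2 * (cmod (\<eta> x))\<^sup>2)"
      using assms by (simp add: L2_integrable)
    show "(\<lambda>x. (cmod (\<xi> x + \<eta> x))\<^sup>2) \<in> borel_measurable M"
      using assms by (auto simp: L2_def)
    show "AE x in M. norm ((cmod (\<xi> x + \<eta> x))\<^sup>2) \<le> norm (2 * (cmod (\<xi> x))\<^sup>2 + 2 * (cmod (\<eta> x))\<^sup>2)"
      using norm_add_sq_le by auto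
  qed
  then show ?thesis using assms by (auto simp: L2_def plus_fun_def)
qed

lemma L2_scale: assumes "\<xi> \<in> L2 M" shows "(\<lambda>x. c * \<xi> x) \<in> L2 M"
  using assms by (auto simp: L2_def norm_mult power_mult_distrib)

lemma Re_L2_ip: 
  assumes "\<xi> \<in> L2 M" shows "Re (L2_ip M \<xi> \<xi>) = (\<integral>x. (cmod (\<xi> x))\<^sup>2 \<partial>M)"
proof -
  have "L2_ip M \<xi> \<xi> = (\<integral>x. complex_of_real ((cmod (\<xi> x))\<^sup>2) \<partial>M)"
    unfolding L2_ip_def complex_norm_square ..
  also have "\<dots> = complex_of_real (\<integral>x. (cmod (\<xi> x))\<^sup>2 \<partial>M)" by (rule integral_complex_of_real)
  finally show ?thesis by simp
qed

lemma L2_norm_sq: "\<xi> \<in> L2 M \<Longrightarrow> (ip_norm (L2_ip M) \<xi>)\<^sup>2 = (\<integral>x. (cmod (\<xi> x))\<^sup>2 \<partial>M)"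
  unfolding ip_norm_def by (simp add: Re_L2_ip)

lemma nn_integral_L2:
  assumes "\<xi> \<in> L2 M"
  shows "(\<integral>\<^sup>+x. ennreal ((cmod (\<xi> x))\<^sup>2) \<partial>M) = ennreal ((ip_norm (L2_ip M) \<xi>)\<^sup>2)"
  unfolding L2_norm_sq[OF assms] using assms by (intro nn_integral_eq_integral L2_integrable) auto

lemma semi_inner_L2: "semi_inner (\<lambda>c \<xi> x. c * \<xi> x) (L2 M) (L2_ip M)"
proof
  show "0 \<in> L2 M" by (simp add: L2_def zero_fun_def)
  show "\<xi> + \<eta> \<in> L2 M" if "\<xi> \<in> L2 M" "\<eta> \<in> L2 M" for \<xi> \<eta> using that by (rule L2_add)
  show "(\<lambda>x. c * \<xi> x) \<in> L2 M" if "\<xi> \<in> L2 M" for \<xi> c using that by (rule L2_scale)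
  show "L2_ip M (u + v) w = L2_ip M u w + L2_ip M v w"
    if "u \<in> L2 M" "v \<in> L2 M" "w \<in> L2 M" for u v w
    using L2_mult_integrable[OF that(1,3)] L2_mult_integrable[OF that(2,3)]
    by (simp add: L2_ip_def distrib_right)
  show "L2_ip M (\<lambda>x. c * u x) v = c * L2_ip M u v" for c u v
    by (simp add: L2_ip_def mult.assoc)
  show "L2_ip M v u = cnj (L2_ip M u v)" for u v
    by (simp add: L2_ip_def mult.commute flip: Bochner_Integration.integral_cnj)
  show "0 \<le> Re (L2_ip M v v)" if "v \<in> L2 M" for v using that by (simp add: Re_L2_ip)
qed (auto simp: fun_eq_iff algebra_simps)

text \<open>Riesz-Fischer: a fast subsequence converges almost everywhere, and Fatou's lemma along
  it bounds the distance of the terms to the limit.\<close>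

lemma L2_complete:
  fixes s :: "nat \<Rightarrow> 'a \<Rightarrow> complex"
  assumes s: "\<And>n. s n \<in> L2 M"
    and cauchy: "\<And>e. e > 0 \<Longrightarrow> \<exists>N. \<forall>m\<ge>N. \<forall>n\<ge>N. ip_norm (L2_ip M) (s m - s n) < e"
  shows "\<exists>l\<in>L2 M. (\<lambda>n. ip_norm (L2_ip M) (s n - l)) \<longlonglongrightarrow> 0"
proof -
  interpret semi_inner "\<lambda>c \<xi> x. c * \<xi> x" "L2 M" "L2_ip M" by (rule semi_inner_L2)
  have [measurable]: "s n \<in> borel_measurable M" for n using s by (rule L2_measurable)
  have "\<exists>N. \<forall>m\<ge>N. \<forall>n\<ge>N. nrm (s m - s n) < (1/4) ^ k" for k using cauchy by simp
  then obtain N where N: "\<And>k m n. m \<ge> N k \<Longrightarrow> n \<ge> N k \<Longrightarrow> nrm (s m - s n) < (1/4) ^ k" by metis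
  \<comment> \<open>The sum makes the indices nondecreasing and at least \<open>N k\<close>; the
    summand \<open>k\<close> makes them tend to infinity.\<close>
  define r where "r k = k + (\<Sum>j\<le>k. N j)" for k
  have r: "r k \<ge> N k" "r k \<ge> k" "r (Suc k) \<ge> r k" for k
    using member_le_sum[of k "{..k}" N] by (auto simp: r_def)
  define d where "d k x = s (r (Suc k)) x - s (r k) x" for k x
  have d_L2: "(\<lambda>x. d k x) \<in> L2 M" and d_norm: "nrm (\<lambda>x. d k x) < (1/4) ^ k" for k
  proof -
    have eq: "(\<lambda>x. d k x) = s (r (Suc k)) - s (r k)" by (simp add: d_def fun_eq_iff)
    show "(\<lambda>x. d k x) \<in> L2 M" unfolding eq by (intro L_diff s)
    show "nrm (\<lambda>x. d k x) < (1/4) ^ k"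
      unfolding eq using r(1)[of k] r(3)[of k] by (intro N) auto
  qed
  have [measurable]: "d k \<in> borel_measurable M" for k using d_L2[of k] by (rule L2_measurable)
  \<comment> \<open>The increments have norm below \<open>(1/4)^k\<close>, so their squares remain
    summable in integral after weighting by \<open>4^k\<close>. Almost everywhere the weighted
    squares then tend to zero, which puts the increments eventually below
    \<open>(1/2)^k\<close>.\<close>
  have "(\<integral>\<^sup>+x. (\<Sum>k. ennreal (4 ^ k * (cmod (d k x))\<^sup>2)) \<partial>M)
      = (\<Sum>k. \<integral>\<^sup>+x. ennreal (4 ^ k * (cmod (d k x))\<^sup>2) \<partial>M)"
    by (intro nn_integral_suminf) simp
  also have "\<dots> \<le> (\<Sum>k. ennreal ((1/4) ^ k))"
  proof (intro suminf_le summableI)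
    fix k
    have "(\<integral>\<^sup>+x. ennreal (4 ^ k * (cmod (d k x))\<^sup>2) \<partial>M)
        = ennreal (4 ^ k) * (\<integral>\<^sup>+x. ennreal ((cmod (d k x))\<^sup>2) \<partial>M)"
      by (subst nn_integral_cmult[symmetric]) (auto simp: ennreal_mult)
    also have "\<dots> = ennreal (4 ^ k) * ennreal ((nrm (d k))\<^sup>2)" using d_L2 by (simp add: nn_integral_L2)
    also have "\<dots> = ennreal (4 ^ k * (nrm (d k))\<^sup>2)" by (simp add: ennreal_mult)
    also have "\<dots> \<le> ennreal ((1/4) ^ k)"
    proof (rule ennreal_leI)
      have "(nrm (d k))\<^sup>2 \<le> ((1/4) ^ k)\<^sup>2"
        using d_norm[of k] nrm_nonneg[OF d_L2[of k]] by (intro power_mono) auto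
      then have "4 ^ k * (nrm (d k))\<^sup>2 \<le> 4 ^ k * ((1/4) ^ k)\<^sup>2" by simp
      also have "\<dots> = (4 * (1/4) * (1/4) :: real) ^ k" by (simp add: power_mult_distrib power2_eq_square power_divide)
      finally show "4 ^ k * (nrm (d k))\<^sup>2 \<le> (1/4) ^ k" by simp
    qed
    finally show "(\<integral>\<^sup>+x. ennreal (4 ^ k * (cmod (d k x))\<^sup>2) \<partial>M) \<le> ennreal ((1/4) ^ k)" .
  qed
  also have "\<dots> < \<infinity>"
    by (subst suminf_ennreal2) (auto intro: summable_geometric)
  finally have fin: "(\<integral>\<^sup>+x. (\<Sum>k. ennreal (4 ^ k * (cmod (d k x))\<^sup>2)) \<partial>M) \<noteq> \<infinity>" by simp
  have conv: "AE x in M. convergent (\<lambda>k. s (r k) x)"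
    using nn_integral_PInf_AE[OF _ fin]
  proof (rule AE_mp)
    show "AE x in M. (\<Sum>k. ennreal (4 ^ k * (cmod (d k x))\<^sup>2)) \<noteq> \<infinity> \<longrightarrow> convergent (\<lambda>k. s (r k) x)"
    proof (intro AE_I2 impI)
      fix x assume x: "(\<Sum>k. ennreal (4 ^ k * (cmod (d k x))\<^sup>2)) \<noteq> \<infinity>"
      have "summable (\<lambda>k. 4 ^ k * (cmod (d k x))\<^sup>2)"
        using x by (intro summable_suminf_not_top) auto
      then have "(\<lambda>k. 4 ^ k * (cmod (d k x))\<^sup>2) \<longlonglongrightarrow> 0" by (rule summable_LIMSEQ_zero)
      then have "eventually (\<lambda>k. 4 ^ k * (cmod (d k x))\<^sup>2 < 1) sequentially"
        by (rule order_tendstoD) simp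
      then have "eventually (\<lambda>k. norm (d k x) \<le> (1/2) ^ k) sequentially"
      proof eventually_elim
        case (elim k)
        have "(2 ^ k * cmod (d k x))\<^sup>2 = 4 ^ k * (cmod (d k x))\<^sup>2"
          by (simp add: power_mult_distrib power2_eq_square flip: power_mult_distrib[of 2 2 k])
        then have "(2 ^ k * cmod (d k x))\<^sup>2 < 1\<^sup>2" using elim by simp
        then have "2 ^ k * cmod (d k x) < 1" by (rule power_less_imp_less_base) simp
        then show ?case by (simp add: power_divide field_simps)
      qed
      then have "summable (\<lambda>k. d k x)"
        by (rule summable_comparison_test_ev) (auto intro: summable_geometric)
      then have "convergent (\<lambda>n. \<Sum>k<n. d k x)" by (simp add: summable_iff_convergent)
      then have "convergent (\<lambda>n. (\<Sum>k<n. d k x) + s (r 0) x)"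
        by (intro convergent_add convergent_const)
      moreover have "(\<Sum>k<n. d k x) = s (r n) x - s (r 0) x" for n
        by (induction n) (auto simp: d_def)
      ultimately show "convergent (\<lambda>k. s (r k) x)" by simp
    qed
  qed measurable
  define l where "l x = (if x \<in> space M then lim (\<lambda>k. s (r k) x) else 0)" for x
  have [measurable]: "l \<in> borel_measurable M"
  proof (rule measurable_cong[THEN iffD1])
    show "(\<lambda>x. lim (\<lambda>k. s (r k) x)) \<in> borel_measurable M"
      by (intro borel_measurable_lim_metric) simp
  qed (simp add: l_def)
  have lim: "AE x in M. (\<lambda>k. s (r k) x) \<longlonglongrightarrow> l x"
    using conv by (auto elim!: AE_mp intro!: AE_I2 simp: l_def convergent_LIMSEQ_iff)
  \<comment> \<open>Fatou along the subsequence. It yields first that \<open>s n - l\<close> is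
    square integrable, hence that \<open>l\<close> is, and then the convergence in norm.\<close>
  have bound: "(\<integral>\<^sup>+x. ennreal ((cmod (s n x - l x))\<^sup>2) \<partial>M) \<le> ennreal (e\<^sup>2)"
    if e: "\<And>m. m \<ge> n \<Longrightarrow> nrm (s n - s m) < e" for n e
  proof -
    have "(\<integral>\<^sup>+x. ennreal ((cmod (s n x - l x))\<^sup>2) \<partial>M)
        = (\<integral>\<^sup>+x. liminf (\<lambda>k. ennreal ((cmod (s n x - s (r k) x))\<^sup>2)) \<partial>M)"
    proof (rule nn_integral_cong_AE)
      show "AE x in M. ennreal ((cmod (s n x - l x))\<^sup>2) = liminf (\<lambda>k. ennreal ((cmod (s n x - s (r k) x))\<^sup>2))"
        using lim
      proof eventually_elim
        case (elim x)
        have "(\<lambda>k. ennreal ((cmod (s n x - s (r k) x))\<^sup>2)) \<longlonglongrightarrow> ennreal ((cmod (s n x - l x))\<^sup>2)"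
          by (intro tendsto_intros elim)
        then show ?case by (intro lim_imp_Liminf[symmetric]) auto
      qed
    qed
    also have "\<dots> \<le> liminf (\<lambda>k. \<integral>\<^sup>+x. ennreal ((cmod (s n x - s (r k) x))\<^sup>2) \<partial>M)"
      by (intro nn_integral_liminf) simp
    also have "\<dots> \<le> liminf (\<lambda>k. ennreal (e\<^sup>2))"
    proof (rule Liminf_mono)
      have "(\<integral>\<^sup>+x. ennreal ((cmod (s n x - s (r k) x))\<^sup>2) \<partial>M) \<le> ennreal (e\<^sup>2)" if "k \<ge> n" for k
      proof -
        have "s n - s (r k) \<in> L2 M" by (intro L_diff s)
        from nn_integral_L2[OF this]
        have "(\<integral>\<^sup>+x. ennreal ((cmod (s n x - s (r k) x))\<^sup>2) \<partial>M) = ennreal ((nrm (s n - s (r k)))\<^sup>2)" by simp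
        also have "\<dots> \<le> ennreal (e\<^sup>2)"
          using e[of "r k"] r(2)[of k] that nrm_nonneg[OF L_diff[OF s s, of n "r k"]]
          by (intro ennreal_leI power_mono) auto
        finally show ?thesis .
      qed
      then show "\<forall>\<^sub>F k in sequentially. (\<integral>\<^sup>+x. ennreal ((cmod (s n x - s (r k) x))\<^sup>2) \<partial>M) \<le> ennreal (e\<^sup>2)"
        using eventually_sequentially by blast
    qed
    also have "\<dots> = ennreal (e\<^sup>2)" by (simp add: Liminf_const)
    finally show ?thesis .
  qed
  have diff_L2: "s n - l \<in> L2 M" if e: "\<And>m. m \<ge> n \<Longrightarrow> nrm (s n - s m) < e" for n e
  proof -
    have "integrable M (\<lambda>x. (cmod (s n x - l x))\<^sup>2)"
      using le_less_trans[OF bound[OF e]] by (intro integrableI_bounded) auto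
    moreover have "s n x - l x = 0" if "x \<notin> space M" for x
      using s[of n] that by (simp add: l_def L2_def)
    ultimately show ?thesis by (auto simp: L2_def fun_diff_def)
  qed
  obtain n0 where n0: "\<And>m. m \<ge> n0 \<Longrightarrow> nrm (s n0 - s m) < 1" using cauchy[of 1] by auto
  have "l = s n0 - (s n0 - l)" by simp
  then have l: "l \<in> L2 M" using L_diff[OF s diff_L2[OF n0]] by metis
  have "(\<lambda>n. nrm (s n - l)) \<longlonglongrightarrow> 0"
  proof (rule LIMSEQ_I)
    fix e :: real assume e: "e > 0"
    obtain N where N: "\<And>m n. m \<ge> N \<Longrightarrow> n \<ge> N \<Longrightarrow> nrm (s m - s n) < e / 2"
      using cauchy[of "e / 2"] e by auto
    have "norm (nrm (s n - l) - 0) < e" if n: "n \<ge> N" for n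
    proof -
      have snl: "s n - l \<in> L2 M" by (intro L_diff s l)
      have "ennreal ((nrm (s n - l))\<^sup>2) \<le> ennreal ((e / 2)\<^sup>2)"
        using nn_integral_L2[OF snl] bound[of n "e/2"] N n by simp
      then have "(nrm (s n - l))\<^sup>2 \<le> (e / 2)\<^sup>2" by (simp add: ennreal_le_iff)
      then have "nrm (s n - l) \<le> e / 2" using e power2_le_imp_le[of "nrm (s n - l)" "e / 2"] by simp
      then show ?thesis using nrm_nonneg[OF snl] e by simp
    qed
    then show "\<exists>N. \<forall>n\<ge>N. norm (nrm (s n - l) - 0) < e" by blast
  qed
  then show ?thesis using l by blast
qed

lemma semi_hilbert_L2: "semi_hilbert (\<lambda>c \<xi> x. c * \<xi> x) (L2 M) (L2_ip M)"
  by (intro semi_hilbert.intro semi_inner_L2 semi_hilbert_axioms.intro L2_complete)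

text \<open>Unlike in \<open>mp_action\<close>, the identities hold at every point, so that the
  Koopman operators form a representation without exceptional sets. The Bernoulli shift is of this
  kind, as are the products and twisted actions built from it.\<close>

definition strict_action :: "('g, 'r) monoid_scheme \<Rightarrow> 'a measure \<Rightarrow> ('g \<Rightarrow> 'a \<Rightarrow> 'a) \<Rightarrow> bool" where
  "strict_action G M T \<longleftrightarrow>
     (\<forall>g\<in>carrier G. T g \<in> measurable M M \<and> distr M M (T g) = M) \<and>
     (\<forall>x\<in>space M. T \<one>\<^bsub>G\<^esub> x = x) \<and>
     (\<forall>g\<in>carrier G. \<forall>h\<in>carrier G. \<forall>x\<in>space M. T (g \<otimes>\<^bsub>G\<^esub> h) x = T g (T h x))"

definition koopman ::
  "('g, 'r) monoid_scheme \<Rightarrow> 'a measure \<Rightarrow> ('g \<Rightarrow> 'a \<Rightarrow> 'a) \<Rightarrow> 'g \<Rightarrow> ('a \<Rightarrow> complex) \<Rightarrow> 'a \<Rightarrow> complex" where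
  "koopman G M T g \<xi> x = (if x \<in> space M then \<xi> (T (inv\<^bsub>G\<^esub> g) x) else 0)"

lemma semi_rep_koopman:
  fixes G (structure) and M :: "'a measure"
  assumes "group G" "countable (carrier G)" and act: "strict_action G M T"
  shows "semi_rep (\<lambda>c \<xi> x. c * \<xi> x) (L2 M) (L2_ip M) G (koopman G M T)"
proof -
  interpret G: group G by fact
  have T[measurable]: "T g \<in> measurable M M" and dT: "distr M M (T g) = M" if "g \<in> carrier G" for g
    using act that by (auto simp: strict_action_def)
  have Tsp: "T g x \<in> space M" if "g \<in> carrier G" "x \<in> space M" for g x
    using measurable_space[OF T[OF that(1)] that(2)] .
  have integral_T: "(\<integral>x. f (T g x) \<partial>M) = (\<integral>x. f x \<partial>M)" if "g \<in> carrier G" "f \<in> borel_measurable M"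
    for g and f :: "'a \<Rightarrow> complex"
    using integral_distr[of "T g" M M f] that by (simp add: dT)
  show ?thesis
  proof (intro semi_rep.intro semi_hilbert_L2 semi_rep_axioms.intro assms)
    fix g assume g: "g \<in> carrier G"
    then have ig: "inv g \<in> carrier G" by simp
    show "koopman G M T g \<xi> \<in> L2 M" if \<xi>: "\<xi> \<in> L2 M" for \<xi>
    proof -
      have [measurable]: "\<xi> \<in> borel_measurable M" using \<xi> by (rule L2_measurable)
      have "integrable (distr M M (T (inv g))) (\<lambda>x. (cmod (\<xi> x))\<^sup>2)"
        using \<xi> ig by (simp add: dT L2_integrable)
      then have "integrable M (\<lambda>x. (cmod (\<xi> (T (inv g) x)))\<^sup>2)"
        using ig by (subst (asm) integrable_distr_eq) auto
      then have "integrable M (\<lambda>x. (cmod (koopman G M T g \<xi> x))\<^sup>2)"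
        by (rule Bochner_Integration.integrable_cong[THEN iffD1, rotated -1]) (auto simp: koopman_def)
      moreover have "koopman G M T g \<xi> \<in> borel_measurable M"
      proof (rule measurable_cong[THEN iffD1])
        show "(\<lambda>x. \<xi> (T (inv g) x)) \<in> borel_measurable M" using ig by measurable
      qed (simp add: koopman_def)
      ultimately show ?thesis by (simp add: L2_def koopman_def)
    qed
    show "koopman G M T g (\<xi> + \<eta>) = koopman G M T g \<xi> + koopman G M T g \<eta>" for \<xi> \<eta>
      by (auto simp: koopman_def fun_eq_iff)
    show "koopman G M T g (\<lambda>x. c * \<xi> x) = (\<lambda>x. c * koopman G M T g \<xi> x)" for c \<xi>
      by (auto simp: koopman_def fun_eq_iff)
    show "L2_ip M (koopman G M T g \<xi>) (koopman G M T g \<eta>) = L2_ip M \<xi> \<eta>"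
      if "\<xi> \<in> L2 M" "\<eta> \<in> L2 M" for \<xi> \<eta>
    proof -
      have [measurable]: "\<xi> \<in> borel_measurable M" "\<eta> \<in> borel_measurable M"
        using that by (auto simp: L2_measurable)
      have "L2_ip M (koopman G M T g \<xi>) (koopman G M T g \<eta>)
          = (\<integral>x. \<xi> (T (inv g) x) * cnj (\<eta> (T (inv g) x)) \<partial>M)"
        unfolding L2_ip_def by (intro Bochner_Integration.integral_cong) (auto simp: koopman_def)
      also have "\<dots> = L2_ip M \<xi> \<eta>"
        unfolding L2_ip_def by (rule integral_T[OF ig, of "\<lambda>x. \<xi> x * cnj (\<eta> x)"]) measurable
      finally show ?thesis .
    qed
    show "koopman G M T (g \<otimes> h) \<xi> = koopman G M T g (koopman G M T h \<xi>)" if h: "h \<in> carrier G" for h \<xi>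
    proof
      fix x
      show "koopman G M T (g \<otimes> h) \<xi> x = koopman G M T g (koopman G M T h \<xi>) x"
        using act g h Tsp[OF ig, of x] by (auto simp: koopman_def strict_action_def G.inv_mult_group)
    qed
  qed (use act in \<open>auto simp: strict_action_def koopman_def fun_eq_iff L2_def\<close>)
qed

text \<open>The indicator of \<open>A\<close> moves by the square root of the measure of a symmetric
  difference, whence the square in the hypothesis. The whole space may have infinite measure, as it
  does for a twisted action with an infinite group of values. Taking real parts keeps invariance and
  does not increase the distance to a real function.\<close>

theorem kazhdan_invariant_function:
  fixes G (structure) and M :: "'a measure"
  assumes "group G" "countable (carrier G)" and act: "strict_action G M T"
    and KP: "kazhdan_pair G F \<epsilon>" and A: "A \<in> sets M" "emeasure M A < \<infinity>" and "0 < \<eta>"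
    and near: "\<And>g. g \<in> F \<Longrightarrow> measure M {x \<in> space M. (T (inv g) x \<in> A) \<noteq> (x \<in> A)} < (\<epsilon> * \<eta>)\<^sup>2"
  shows "\<exists>\<xi> :: 'a \<Rightarrow> real. \<xi> \<in> borel_measurable M \<and> (\<forall>g\<in>carrier G. AE x in M. \<xi> (T g x) = \<xi> x) \<and>
     integrable M (\<lambda>x. (\<xi> x - indicator A x)\<^sup>2) \<and> (\<integral>x. (\<xi> x - indicator A x)\<^sup>2 \<partial>M) < \<eta>\<^sup>2"
proof -
  interpret semi_rep "\<lambda>c \<xi> x. c * \<xi> x" "L2 M" "L2_ip M" G "koopman G M T"
    by (rule semi_rep_koopman[OF assms(1-3)])
  have F: "F \<subseteq> carrier G" and \<epsilon>: "0 < \<epsilon>" using KP by (auto simp: kazhdan_pair_def)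
  have T[measurable]: "T g \<in> measurable M M" if "g \<in> carrier G" for g
    using act that by (auto simp: strict_action_def)
  have [measurable]: "A \<in> sets M" by fact
  define a :: "'a \<Rightarrow> complex" where "a = indicator A"
  have sq: "(cmod (indicator A x))\<^sup>2 = (indicator A x :: real)" for x by (simp add: indicator_def)
  have "integrable M (indicator A :: 'a \<Rightarrow> real)" using A by simp
  then have "integrable M (\<lambda>x. (cmod (a x))\<^sup>2)" unfolding a_def sq .
  moreover have "a \<in> borel_measurable M" unfolding a_def by measurable
  moreover have "\<forall>x. x \<notin> space M \<longrightarrow> a x = 0"
    using sets.sets_into_space[OF A(1)] by (auto simp: a_def indicator_def)
  ultimately have a: "a \<in> L2 M" by (simp add: L2_def)
  have "nrm (koopman G M T g a - a) < \<epsilon> * \<eta>" if "g \<in> F" for g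
  proof -
    have g: "g \<in> carrier G" "inv g \<in> carrier G" using F that by auto
    have m: "{x \<in> space M. (T (inv g) x \<in> A) \<noteq> (x \<in> A)} \<in> sets M" using g by measurable
    have "(nrm (koopman G M T g a - a))\<^sup>2 = (\<integral>x. (cmod ((koopman G M T g a - a) x))\<^sup>2 \<partial>M)"
      by (intro L2_norm_sq L_diff \<pi>_in g a)
    also have "\<dots> = (\<integral>x. indicator {x \<in> space M. (T (inv g) x \<in> A) \<noteq> (x \<in> A)} x \<partial>M)"
      by (intro Bochner_Integration.integral_cong) (auto simp: koopman_def a_def indicator_def)
    also have "\<dots> < (\<epsilon> * \<eta>)\<^sup>2" using near[OF that] m by (simp add: Int_absorb1)
    finally show ?thesis using \<epsilon> \<open>0 < \<eta>\<close> power_less_imp_less_base[of _ 2 "\<epsilon> * \<eta>"] by simp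
  qed
  from kazhdan_near_invariant[OF KP a \<open>0 < \<eta>\<close> this]
  obtain w where w: "w \<in> L2 M" and inv: "\<And>g. g \<in> carrier G \<Longrightarrow> nrm (koopman G M T g w - w) = 0"
    and close: "nrm (w - a) < \<eta>" by blast
  have [measurable]: "w \<in> borel_measurable M" using w by (rule L2_measurable)
  define \<xi> where "\<xi> x = Re (w x)" for x
  have [measurable]: "\<xi> \<in> borel_measurable M" unfolding \<xi>_def by measurable
  \<comment> \<open>\<open>koopman\<close> at \<open>inv g\<close> evaluates its argument at
    \<open>T g x\<close>.\<close>
  have \<xi>_inv: "AE x in M. \<xi> (T g x) = \<xi> x" if g: "g \<in> carrier G" for g
  proof -
    have L: "koopman G M T (inv g) w - w \<in> L2 M" using g w \<pi>_in L_diff by auto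
    have "(\<integral>x. (cmod ((koopman G M T (inv g) w - w) x))\<^sup>2 \<partial>M) = 0"
      using L2_norm_sq[OF L] inv[of "inv g"] g by simp
    then have "AE x in M. (cmod ((koopman G M T (inv g) w - w) x))\<^sup>2 = 0"
      using integral_nonneg_eq_0_iff_AE[OF L2_integrable[OF L]] by simp
    then show ?thesis
      by (rule AE_mp) (use g in \<open>auto simp: koopman_def \<xi>_def intro!: AE_I2\<close>)
  qed
  have wa: "w - a \<in> L2 M" by (intro L_diff w a)
  have le: "(\<xi> x - indicator A x)\<^sup>2 \<le> (cmod ((w - a) x))\<^sup>2" for x
  proof -
    have "\<bar>Re ((w - a) x)\<bar> \<le> cmod ((w - a) x)" by (rule abs_Re_le_cmod)
    moreover have "Re ((w - a) x) = \<xi> x - indicator A x" by (simp add: \<xi>_def a_def indicator_def)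
    ultimately show ?thesis by (metis abs_ge_zero power2_abs power_mono)
  qed
  have int: "integrable M (\<lambda>x. (\<xi> x - indicator A x)\<^sup>2)"
    by (rule Bochner_Integration.integrable_bound[OF L2_integrable[OF wa]]) (use le in auto)
  have lt: "(\<integral>x. (\<xi> x - indicator A x)\<^sup>2 \<partial>M) < \<eta>\<^sup>2"
  proof -
    have "(\<integral>x. (\<xi> x - indicator A x)\<^sup>2 \<partial>M) \<le> (nrm (w - a))\<^sup>2"
      unfolding L2_norm_sq[OF wa] by (intro integral_mono int L2_integrable[OF wa] le)
    also have "\<dots> < \<eta>\<^sup>2" using close nrm_nonneg[OF wa] by (intro power_strict_mono) auto
    finally show ?thesis .
  qed
  show ?thesis
  proof (intro exI[of _ \<xi>] conjI ballI)
    show "\<xi> \<in> borel_measurable M" by measurable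
  qed (fact \<xi>_inv int lt)+
qed

section \<open>Mixing\<close>

lemma AE_imp:
  assumes "AE x in M. P x" "\<And>x. x \<in> space M \<Longrightarrow> P x \<Longrightarrow> Q x" shows "AE x in M. Q x"
  using assms by (auto elim: AE_mp intro: AE_I2)

lemma (in prob_space) AE_witness:
  assumes "AE x in M. P x" obtains x where "x \<in> space M" "P x"
proof -
  have "\<exists>x\<in>space M. P x"
  proof (rule ccontr)
    assume none: "\<not> (\<exists>x\<in>space M. P x)"
    have "AE x in M. False" using assms by (rule AE_imp) (use none in blast)
    then show False using AE_False by simp
  qed
  then show ?thesis using that by blast
qed

text \<open>The filter of leaving every finite subset of \<open>K\<close>. Limits are taken inside a
  subset of the group so that mixing can be used along an infinite conjugacy class.\<close>

definition at_infinity_on :: "'k set \<Rightarrow> 'k filter" where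
  "at_infinity_on K = inf cofinite (principal K)"

lemma eventually_at_infinity_on:
  "eventually P (at_infinity_on K) \<longleftrightarrow> finite {k \<in> K. \<not> P k}"
  by (simp add: at_infinity_on_def eventually_inf_principal eventually_cofinite)

lemma at_infinity_on_nontrivial: "infinite K \<Longrightarrow> at_infinity_on K \<noteq> bot"
  by (simp add: trivial_limit_def eventually_at_infinity_on)

lemma eventually_at_infinity_on_mem: "eventually (\<lambda>k. k \<in> K) (at_infinity_on K)"
  by (simp add: eventually_at_infinity_on)

text \<open>The sets with the right limit include an intersection-stable generator and are closed
  under complements and disjoint countable unions. For unions the limit passes through the series by
  Tannery's theorem, because the bound \<open>\<nu> k A \<le> measure M A\<close> is uniform in
  \<open>k\<close>.\<close>

lemma tendsto_on_generated_sets: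
  fixes \<nu> :: "'k \<Rightarrow> 'a set \<Rightarrow> real"
  assumes "prob_space M" and "infinite K"
    and E: "Int_stable E" "E \<subseteq> Pow (space M)" "sets M = sigma_sets (space M) E"
    and nonneg: "\<And>k A. k \<in> K \<Longrightarrow> A \<in> sets M \<Longrightarrow> 0 \<le> \<nu> k A"
    and dom: "\<And>k A. k \<in> K \<Longrightarrow> A \<in> sets M \<Longrightarrow> \<nu> k A \<le> measure M A"
    and compl: "\<And>k A. k \<in> K \<Longrightarrow> A \<in> sets M \<Longrightarrow> \<nu> k (space M - A) = \<nu> k (space M) - \<nu> k A"
    and union: "\<And>k A. k \<in> K \<Longrightarrow> disjoint_family A \<Longrightarrow> range A \<subseteq> sets M \<Longrightarrow>
      (\<lambda>i::nat. \<nu> k (A i)) sums \<nu> k (\<Union>i. A i)"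
    and space: "((\<lambda>k. \<nu> k (space M)) \<longlongrightarrow> c) (at_infinity_on K)"
    and basic: "\<And>A. A \<in> E \<Longrightarrow> ((\<lambda>k. \<nu> k A) \<longlongrightarrow> measure M A * c) (at_infinity_on K)"
    and A: "A \<in> sets M"
  shows "((\<lambda>k. \<nu> k A) \<longlongrightarrow> measure M A * c) (at_infinity_on K)"
proof -
  interpret prob_space M by fact
  let ?F = "at_infinity_on K"
  show ?thesis using E(1,2) A[unfolded E(3)]
  proof (induction rule: sigma_sets_induct_disjoint)
    case empty
    have "eventually (\<lambda>k. \<nu> k {} = 0) ?F"
      using eventually_at_infinity_on_mem
    proof eventually_elim
      case (elim k) then show ?case using nonneg[of k "{}"] dom[of k "{}"] by simp
    qed
    then show ?case by (simp add: tendsto_eventually)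
  next
    case (compl A)
    have A: "A \<in> sets M" using compl E(3) by simp
    have "((\<lambda>k. \<nu> k (space M) - \<nu> k A) \<longlongrightarrow> c - measure M A * c) ?F"
      by (intro tendsto_diff space compl)
    moreover have "eventually (\<lambda>k. \<nu> k (space M) - \<nu> k A = \<nu> k (space M - A)) ?F"
      using eventually_at_infinity_on_mem
      by eventually_elim (simp add: assms(8) A)
    ultimately show ?case
      by (simp add: prob_compl[OF A] left_diff_distrib Lim_transform_eventually)
  next
    case (union A)
    have A: "range A \<subseteq> sets M" "\<And>i. A i \<in> sets M" using union E(3) by auto
    have sums: "(\<lambda>i. measure M (A i)) sums measure M (\<Union>i. A i)"
      by (rule finite_measure_UNION[OF A(1) union(1)])
    have "((\<lambda>k. suminf (\<lambda>i. \<nu> k (A i))) \<longlongrightarrow> (\<Sum>i. measure M (A i) * c)) ?F"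
    proof (rule tannerys_theorem[THEN conjunct2, THEN conjunct2])
      show "((\<lambda>k. \<nu> k (A i)) \<longlongrightarrow> measure M (A i) * c) ?F" for i by (rule union)
      show "\<forall>\<^sub>F (i, k) in sequentially \<times>\<^sub>F ?F. norm (\<nu> k (A i)) \<le> measure M (A i)"
        unfolding eventually_prod_filter
        by (intro exI[of _ "\<lambda>_. True"] exI[of _ "\<lambda>k. k \<in> K"])
          (auto simp: eventually_at_infinity_on_mem nonneg dom A)
      show "summable (\<lambda>i. measure M (A i))" using sums by (rule sums_summable)
    qed (use \<open>infinite K\<close> in \<open>rule at_infinity_on_nontrivial\<close>)
    moreover have "eventually (\<lambda>k. suminf (\<lambda>i. \<nu> k (A i)) = \<nu> k (\<Union>i. A i)) ?F"
      using eventually_at_infinity_on_mem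
      by eventually_elim (use assms(9)[OF _ union(1) A(1)] in \<open>simp add: sums_iff\<close>)
    moreover have "(\<Sum>i. measure M (A i) * c) = measure M (\<Union>i. A i) * c"
      using sums_mult2[OF sums, of c] by (simp add: sums_iff)
    ultimately show ?case by (simp add: Lim_transform_eventually)
  qed (rule basic)
qed

definition mp_family :: "'k set \<Rightarrow> 'a measure \<Rightarrow> ('k \<Rightarrow> 'a \<Rightarrow> 'a) \<Rightarrow> bool" where
  "mp_family K M T \<longleftrightarrow> (\<forall>k\<in>K. T k \<in> measurable M M \<and> distr M M (T k) = M)"

definition mixing :: "'k set \<Rightarrow> 'a measure \<Rightarrow> ('k \<Rightarrow> 'a \<Rightarrow> 'a) \<Rightarrow> bool" where
  "mixing K M T \<longleftrightarrow> mp_family K M T \<and> (\<forall>A\<in>sets M. \<forall>B\<in>sets M.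
     ((\<lambda>k. measure M (A \<inter> (T k -` B \<inter> space M))) \<longlongrightarrow> measure M A * measure M B) (at_infinity_on K))"

lemma mp_familyD:
  assumes "mp_family K M T" "k \<in> K"
  shows "T k \<in> measurable M M" "distr M M (T k) = M"
    "B \<in> sets M \<Longrightarrow> T k -` B \<inter> space M \<in> sets M"
    "B \<in> sets M \<Longrightarrow> measure M (T k -` B \<inter> space M) = measure M B"
    "x \<in> space M \<Longrightarrow> T k x \<in> space M"
proof -
  show T: "T k \<in> measurable M M" "distr M M (T k) = M" using assms by (auto simp: mp_family_def)
  show "B \<in> sets M \<Longrightarrow> T k -` B \<inter> space M \<in> sets M" using T(1) by (rule measurable_sets)
  show "B \<in> sets M \<Longrightarrow> measure M (T k -` B \<inter> space M) = measure M B"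
    using measure_distr[OF T(1), of B] T(2) by simp
  show "x \<in> space M \<Longrightarrow> T k x \<in> space M" using T(1) by (rule measurable_space)
qed

lemma mp_family_AE:
  assumes "mp_family K M T" "k \<in> K" "AE x in M. P x"
  shows "AE x in M. P (T k x)"
proof (rule AE_distrD[of "T k" M M])
  show "T k \<in> measurable M M" by (rule mp_familyD(1)[OF assms(1,2)])
  show "AE x in distr M M (T k). P x" unfolding mp_familyD(2)[OF assms(1,2)] by fact
qed

text \<open>Two passes of \<open>tendsto_on_generated_sets\<close>: the second set becomes arbitrary
  while the first is basic, then the first while the second is arbitrary. The domination comes from
  measure preservation in the first pass and from inclusion in the second.\<close>

lemma mixingI_generator:
  fixes M :: "'a measure"
  assumes "prob_space M" and "infinite K" and T: "mp_family K M T"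
    and E: "Int_stable E" "E \<subseteq> Pow (space M)" "sets M = sigma_sets (space M) E"
    and basic: "\<And>A B. A \<in> E \<Longrightarrow> B \<in> E \<Longrightarrow>
      ((\<lambda>k. measure M (A \<inter> (T k -` B \<inter> space M))) \<longlongrightarrow> measure M A * measure M B) (at_infinity_on K)"
  shows "mixing K M T"
proof -
  interpret prob_space M by fact
  note TD = mp_familyD[OF T]
  have ES: "A \<in> sets M" if "A \<in> E" for A using that E(3) by auto
  have union_pre: "(\<lambda>i::nat. measure M (A \<inter> (T k -` C i \<inter> space M)))
      sums measure M (A \<inter> (T k -` (\<Union>i. C i) \<inter> space M))"
    if "k \<in> K" "A \<in> sets M" "disjoint_family C" "range C \<subseteq> sets M" for k A C
  proof -
    have "(\<lambda>i. measure M (A \<inter> (T k -` C i \<inter> space M))) sums measure M (\<Union>i. A \<inter> (T k -` C i \<inter> space M))"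
      using that TD(3)[OF that(1)]
      by (intro finite_measure_UNION) (auto simp: disjoint_family_on_def image_subset_iff)
    moreover have "(\<Union>i. A \<inter> (T k -` C i \<inter> space M)) = A \<inter> (T k -` (\<Union>i. C i) \<inter> space M)" by auto
    ultimately show ?thesis by simp
  qed
  have step1: "((\<lambda>k. measure M (A \<inter> (T k -` B \<inter> space M))) \<longlongrightarrow> measure M A * measure M B) (at_infinity_on K)"
    if A: "A \<in> E" and B: "B \<in> sets M" for A B
  proof -
    have AS: "A \<in> sets M" "A \<subseteq> space M" using A ES sets.sets_into_space by blast+
    have "((\<lambda>k. measure M (A \<inter> (T k -` B \<inter> space M))) \<longlongrightarrow> measure M B * measure M A) (at_infinity_on K)"
    proof (rule tendsto_on_generated_sets[OF assms(1,2) E _ _ _ _ _ _ B])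
      fix k C assume k: "k \<in> K" and C: "C \<in> sets M"
      show "measure M (A \<inter> (T k -` C \<inter> space M)) \<le> measure M C"
        using finite_measure_mono[OF Int_lower2 TD(3)[OF k C], of A] TD(4)[OF k C] by simp
      have "A \<inter> (T k -` (space M - C) \<inter> space M) = A - (A \<inter> (T k -` C \<inter> space M))"
        using TD(5)[OF k] AS by auto
      moreover have "A \<inter> (T k -` space M \<inter> space M) = A" using TD(5)[OF k] AS by auto
      ultimately show "measure M (A \<inter> (T k -` (space M - C) \<inter> space M))
          = measure M (A \<inter> (T k -` space M \<inter> space M)) - measure M (A \<inter> (T k -` C \<inter> space M))"
        using AS TD(3)[OF k C] by (simp add: finite_measure_Diff)
    next
      have "eventually (\<lambda>k. measure M (A \<inter> (T k -` space M \<inter> space M)) = measure M A) (at_infinity_on K)"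
        using eventually_at_infinity_on_mem
      proof eventually_elim
        case (elim k)
        have "A \<inter> (T k -` space M \<inter> space M) = A" using TD(5)[OF elim] AS by auto
        then show ?case by simp
      qed
      then show "((\<lambda>k. measure M (A \<inter> (T k -` space M \<inter> space M))) \<longlongrightarrow> measure M A) (at_infinity_on K)"
        by (rule tendsto_eventually)
    next
      fix B assume "B \<in> E"
      then show "((\<lambda>k. measure M (A \<inter> (T k -` B \<inter> space M))) \<longlongrightarrow> measure M B * measure M A) (at_infinity_on K)"
        using basic[OF A, of B] by (subst mult.commute)
    qed (use union_pre AS in auto)
    then show ?thesis by (simp add: mult.commute)
  qed
  have "((\<lambda>k. measure M (A \<inter> (T k -` B \<inter> space M))) \<longlongrightarrow> measure M A * measure M B) (at_infinity_on K)"
    if A: "A \<in> sets M" and B: "B \<in> sets M" for A B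
  proof (rule tendsto_on_generated_sets[OF assms(1,2) E _ _ _ _ _ _ A])
    fix k C assume k: "k \<in> K" and C: "C \<in> sets M"
    show "measure M (C \<inter> (T k -` B \<inter> space M)) \<le> measure M C"
      using C TD(3)[OF k B] by (intro finite_measure_mono) auto
    have "(space M - C) \<inter> (T k -` B \<inter> space M) = (T k -` B \<inter> space M) - (C \<inter> (T k -` B \<inter> space M))"
      by auto
    moreover have "measure M ((T k -` B \<inter> space M) - (C \<inter> (T k -` B \<inter> space M)))
        = measure M (T k -` B \<inter> space M) - measure M (C \<inter> (T k -` B \<inter> space M))"
      by (rule finite_measure_Diff) (use C TD(3)[OF k B] in \<open>auto intro: sets.Int\<close>)
    moreover have "space M \<inter> (T k -` B \<inter> space M) = T k -` B \<inter> space M" by auto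
    ultimately show "measure M ((space M - C) \<inter> (T k -` B \<inter> space M))
        = measure M (space M \<inter> (T k -` B \<inter> space M)) - measure M (C \<inter> (T k -` B \<inter> space M))"
      by simp
  next
    fix k and C :: "nat \<Rightarrow> 'a set" assume k: "k \<in> K" and C: "disjoint_family C" "range C \<subseteq> sets M"
    have "(\<lambda>i::nat. measure M (C i \<inter> (T k -` B \<inter> space M))) sums measure M (\<Union>i. C i \<inter> (T k -` B \<inter> space M))"
      using C TD(3)[OF k B]
      by (intro finite_measure_UNION) (auto simp: disjoint_family_on_def image_subset_iff)
    moreover have "(\<Union>i. C i \<inter> (T k -` B \<inter> space M)) = (\<Union>i. C i) \<inter> (T k -` B \<inter> space M)" by auto
    ultimately show "(\<lambda>i. measure M (C i \<inter> (T k -` B \<inter> space M))) sums measure M ((\<Union>i. C i) \<inter> (T k -` B \<inter> space M))"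
      by simp
  next
    have "eventually (\<lambda>k. measure M (space M \<inter> (T k -` B \<inter> space M)) = measure M B) (at_infinity_on K)"
      using eventually_at_infinity_on_mem
    proof eventually_elim
      case (elim k)
      have "space M \<inter> (T k -` B \<inter> space M) = T k -` B \<inter> space M" by auto
      then show ?case using TD(4)[OF elim B] by simp
    qed
    then show "((\<lambda>k. measure M (space M \<inter> (T k -` B \<inter> space M))) \<longlongrightarrow> measure M B) (at_infinity_on K)"
      by (rule tendsto_eventually)
  qed (use step1 B in auto)
  then show ?thesis using T by (simp add: mixing_def)
qed

lemma mp_family_pair:
  assumes "prob_space M" "prob_space N" "mp_family K M T" "mp_family K N S"
  shows "mp_family K (M \<Otimes>\<^sub>M N) (\<lambda>k. map_prod (T k) (S k))"
  unfolding mp_family_def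
proof (intro ballI conjI)
  fix k assume k: "k \<in> K"
  note T = mp_familyD[OF assms(3) k] and S = mp_familyD[OF assms(4) k]
  have [measurable]: "T k \<in> measurable M M" "S k \<in> measurable N N" using T S by auto
  have eq: "map_prod (T k) (S k) = (\<lambda>(x, y). (T k x, S k y))" by auto
  show "map_prod (T k) (S k) \<in> measurable (M \<Otimes>\<^sub>M N) (M \<Otimes>\<^sub>M N)" unfolding eq by measurable
  have "distr (M \<Otimes>\<^sub>M N) (M \<Otimes>\<^sub>M N) (\<lambda>(x, y). (T k x, S k y)) = distr M M (T k) \<Otimes>\<^sub>M distr N N (S k)"
    using assms(2) S by (intro pair_measure_distr[symmetric]) (auto simp: prob_space_imp_sigma_finite)
  then show "distr (M \<Otimes>\<^sub>M N) (M \<Otimes>\<^sub>M N) (map_prod (T k) (S k)) = M \<Otimes>\<^sub>M N"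
    unfolding eq using T S by simp
qed

text \<open>On rectangles, correlations are products of correlations of the factors.\<close>

lemma mixing_pair:
  assumes "prob_space M" "prob_space N" "infinite K" and T: "mixing K M T" and S: "mixing K N S"
  shows "mixing K (M \<Otimes>\<^sub>M N) (\<lambda>k. map_prod (T k) (S k))"
proof (rule mixingI_generator)
  interpret M: prob_space M by fact
  interpret N: prob_space N by fact
  interpret MN: pair_prob_space M N ..
  show "prob_space (M \<Otimes>\<^sub>M N)" by (rule MN.P.prob_space_axioms)
  have mT: "mp_family K M T" and mS: "mp_family K N S" using T S by (auto simp: mixing_def)
  show "mp_family K (M \<Otimes>\<^sub>M N) (\<lambda>k. map_prod (T k) (S k))"
    by (rule mp_family_pair) fact+
  let ?E = "{a \<times> b | a b. a \<in> sets M \<and> b \<in> sets N}"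
  show "Int_stable ?E" by (rule Int_stable_pair_measure_generator)
  show "?E \<subseteq> Pow (space (M \<Otimes>\<^sub>M N))" using pair_measure_closed[of M N] by (simp add: space_pair_measure)
  show "sets (M \<Otimes>\<^sub>M N) = sigma_sets (space (M \<Otimes>\<^sub>M N)) ?E" by (simp add: sets_pair_measure space_pair_measure)
  fix A B assume "A \<in> ?E" "B \<in> ?E"
  then obtain a b c d where sets: "a \<in> sets M" "b \<in> sets N" "c \<in> sets M" "d \<in> sets N"
    and AB: "A = a \<times> b" "B = c \<times> d" by blast
  have times: "measure (M \<Otimes>\<^sub>M N) (u \<times> v) = measure M u * measure N v" if "u \<in> sets M" "v \<in> sets N" for u v
    using that by (simp add: measure_def N.emeasure_pair_measure_Times enn2real_mult)
  have "((\<lambda>k. measure M (a \<inter> (T k -` c \<inter> space M)) * measure N (b \<inter> (S k -` d \<inter> space N)))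
      \<longlongrightarrow> (measure M a * measure M c) * (measure N b * measure N d)) (at_infinity_on K)"
    using T S sets unfolding mixing_def by (intro tendsto_mult) auto
  moreover have "eventually (\<lambda>k. measure M (a \<inter> (T k -` c \<inter> space M)) * measure N (b \<inter> (S k -` d \<inter> space N))
      = measure (M \<Otimes>\<^sub>M N) (A \<inter> (map_prod (T k) (S k) -` B \<inter> space (M \<Otimes>\<^sub>M N)))) (at_infinity_on K)"
    using eventually_at_infinity_on_mem
  proof eventually_elim
    case (elim k)
    have "A \<inter> (map_prod (T k) (S k) -` B \<inter> space (M \<Otimes>\<^sub>M N))
        = (a \<inter> (T k -` c \<inter> space M)) \<times> (b \<inter> (S k -` d \<inter> space N))"
      by (auto simp: AB space_pair_measure)
    then show ?case
      using sets mp_familyD(3)[OF mT elim] mp_familyD(3)[OF mS elim] by (simp add: times)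
  qed
  ultimately show "((\<lambda>k. measure (M \<Otimes>\<^sub>M N) (A \<inter> (map_prod (T k) (S k) -` B \<inter> space (M \<Otimes>\<^sub>M N))))
      \<longlongrightarrow> measure (M \<Otimes>\<^sub>M N) A * measure (M \<Otimes>\<^sub>M N) B) (at_infinity_on K)"
    using sets by (simp add: AB times mult_ac Lim_transform_eventually)
qed (rule assms)

text \<open>Forward invariance makes \<open>A\<close> and its intersection with its preimage equal
  up to null sets, so mixing gives \<open>measure M A = measure M A * measure M A\<close>.\<close>

lemma mixing_ergodic:
  assumes "prob_space M" "infinite K" and T: "mixing K M T" and A: "A \<in> sets M"
    and inv: "\<And>k. k \<in> K \<Longrightarrow> AE x in M. x \<in> A \<longrightarrow> T k x \<in> A"
    and pos: "measure M A > 0"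
  shows "AE x in M. x \<in> A"
proof -
  interpret prob_space M by fact
  have mT: "mp_family K M T" using T by (simp add: mixing_def)
  have "((\<lambda>k. measure M (A \<inter> (T k -` A \<inter> space M))) \<longlongrightarrow> measure M A * measure M A) (at_infinity_on K)"
    using T A by (simp add: mixing_def)
  moreover have "eventually (\<lambda>k. measure M (A \<inter> (T k -` A \<inter> space M)) = measure M A) (at_infinity_on K)"
    using eventually_at_infinity_on_mem
  proof eventually_elim
    case (elim k)
    show ?case
    proof (rule measure_eq_AE)
      show "AE x in M. x \<in> A \<inter> (T k -` A \<inter> space M) \<longleftrightarrow> x \<in> A"
        using inv[OF elim] by (rule AE_mp) (auto intro!: AE_I2)
    qed (use A mp_familyD(3)[OF mT elim A] in auto)
  qed
  ultimately have "((\<lambda>k. measure M A) \<longlongrightarrow> measure M A * measure M A) (at_infinity_on K)"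
    by (rule Lim_transform_eventually)
  then have "measure M A = measure M A * measure M A"
    using at_infinity_on_nontrivial[OF assms(2)] by (simp add: tendsto_const_iff)
  then have "measure M A = 1" using pos by simp
  then show ?thesis using A by (simp add: prob_eq_1)
qed

section \<open>Mixing and freeness of Bernoulli shifts\<close>

lemma prod_emb_box:
  "J \<subseteq> I \<Longrightarrow> prod_emb I M J (Pi\<^sub>E J X) = {x \<in> space (PiM I M). \<forall>i\<in>J. x i \<in> X i}"
  unfolding prod_emb_def by (auto simp: space_PiM Pi_iff)

text \<open>Two cylinders constrain finitely many coordinates each. By \<open>proper\<close>,
  \<open>\<rho> k\<close> moves the coordinates of one off those of the other for all but finitely
  many \<open>k\<close>, and then the events are independent: the correlation eventually equals its
  limit. Left translations give the action itself, right translations serve in the proof of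
  freeness.\<close>

lemma mixing_shift:
  assumes N: "prob_space N" and "infinite K"
    and \<rho>: "\<And>k. k \<in> K \<Longrightarrow> inj_on (\<rho> k) I" "\<And>k. k \<in> K \<Longrightarrow> \<rho> k \<in> I \<rightarrow> I"
    and proper: "\<And>a b. a \<in> I \<Longrightarrow> b \<in> I \<Longrightarrow> finite {k \<in> K. \<rho> k a = b}"
  shows "mixing K (PiM I (\<lambda>_. N)) (\<lambda>k x. \<lambda>i\<in>I. x (\<rho> k i))"
proof (rule mixingI_generator)
  interpret N: prob_space N by fact
  interpret P: product_prob_space "\<lambda>_. N" I ..
  let ?P = "PiM I (\<lambda>_. N)"
  show "prob_space ?P" by (rule P.P.prob_space_axioms)
  show "infinite K" by fact
  show "mp_family K ?P (\<lambda>k x. \<lambda>i\<in>I. x (\<rho> k i))"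
    unfolding mp_family_def
  proof (intro ballI conjI)
    fix k assume k: "k \<in> K"
    show "(\<lambda>x. \<lambda>i\<in>I. x (\<rho> k i)) \<in> measurable ?P ?P"
      using \<rho>(2)[OF k] by (intro measurable_restrict measurable_component_singleton) auto
    show "distr ?P ?P (\<lambda>x. \<lambda>i\<in>I. x (\<rho> k i)) = ?P"
      using distr_PiM_reindex[OF _ \<rho>(1)[OF k] \<rho>(2)[OF k], of "\<lambda>_. N"] N by simp
  qed
  show "Int_stable (prod_algebra I (\<lambda>_. N))" by (rule Int_stable_prod_algebra)
  show "prod_algebra I (\<lambda>_. N) \<subseteq> Pow (space ?P)"
    using prod_algebra_sets_into_space[of I "\<lambda>_. N"] by (simp add: space_PiM)
  show "sets ?P = sigma_sets (space ?P) (prod_algebra I (\<lambda>_. N))" by (simp add: sets_PiM space_PiM)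
  fix A B assume "A \<in> prod_algebra I (\<lambda>_. N)" "B \<in> prod_algebra I (\<lambda>_. N)"
  then obtain J X J' X' where J: "finite J" "J \<subseteq> I" "\<And>i. i \<in> J \<Longrightarrow> X i \<in> sets N"
      and J': "finite J'" "J' \<subseteq> I" "\<And>i. i \<in> J' \<Longrightarrow> X' i \<in> sets N"
      and A0: "A = prod_emb I (\<lambda>_. N) J (Pi\<^sub>E J X)" and B0: "B = prod_emb I (\<lambda>_. N) J' (Pi\<^sub>E J' X')"
    by (metis prod_algebraE)
  have A: "A = {x\<in>space ?P. \<forall>i\<in>J. x i \<in> X i}" and B: "B = {x\<in>space ?P. \<forall>i\<in>J'. x i \<in> X' i}"
    unfolding A0 B0 using J(2) J'(2) by (auto simp: prod_emb_box)
  have box: "measure ?P {x\<in>space ?P. \<forall>i\<in>L. x i \<in> Y i} = (\<Prod>i\<in>L. measure N (Y i))"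
    if "finite L" "L \<subseteq> I" "\<And>i. i \<in> L \<Longrightarrow> Y i \<in> sets N" for L Y
    using P.measure_PiM_emb[of L Y] that by (simp add: prod_emb_box)
  have "finite (\<Union>a\<in>J'. \<Union>b\<in>J. {k \<in> K. \<rho> k a = b})" using J J' proper by (auto simp: subset_iff)
  then have "eventually (\<lambda>k. \<rho> k ` J' \<inter> J = {}) (at_infinity_on K)"
    unfolding eventually_at_infinity_on by (rule finite_subset[rotated]) auto
  then have "eventually (\<lambda>k. measure ?P (A \<inter> ((\<lambda>x. \<lambda>i\<in>I. x (\<rho> k i)) -` B \<inter> space ?P))
      = measure ?P A * measure ?P B) (at_infinity_on K)"
    using eventually_at_infinity_on_mem
  proof eventually_elim
    case (elim k)
    have inj: "inj_on (\<rho> k) J'" using \<rho>(1)[OF elim(2)] J'(2) by (rule inj_on_subset)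
    \<comment> \<open>One family of constraints on the disjoint union of \<open>J\<close> and the
      image of \<open>J'\<close>, so that the intersection of the two events is again a
      cylinder.\<close>
    define Y where "Y i = (if i \<in> J then X i else X' (the_inv_into J' (\<rho> k) i))" for i
    have Y1: "Y i = X i" if "i \<in> J" for i using that by (simp add: Y_def)
    have Y2: "Y (\<rho> k i) = X' i" if "i \<in> J'" for i
      using that elim(1) by (auto simp: Y_def the_inv_into_f_f[OF inj])
    have "A \<inter> ((\<lambda>x. \<lambda>i\<in>I. x (\<rho> k i)) -` B \<inter> space ?P) = {x\<in>space ?P. \<forall>i\<in>J \<union> \<rho> k ` J'. x i \<in> Y i}"
    proof -
      have "(\<lambda>i\<in>I. x (\<rho> k i)) \<in> space ?P" if "x \<in> space ?P" for x
        using that \<rho>(2)[OF elim(2)] by (auto simp: space_PiM PiE_iff)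
      moreover have "(\<lambda>i\<in>I. x (\<rho> k i)) i \<in> X' i \<longleftrightarrow> x (\<rho> k i) \<in> Y (\<rho> k i)" if "i \<in> J'" for x i
        using that J'(2) by (auto simp: Y2)
      moreover have "(\<forall>i\<in>J. x i \<in> Y i) \<longleftrightarrow> (\<forall>i\<in>J. x i \<in> X i)" for x by (simp add: Y1)
      ultimately show ?thesis unfolding A B by (auto simp: ball_Un)
    qed
    also have "measure ?P \<dots> = (\<Prod>i\<in>J \<union> \<rho> k ` J'. measure N (Y i))"
      using J J' \<rho>(2)[OF elim(2)] by (intro box) (auto simp: Y1 Y2)
    also have "\<dots> = (\<Prod>i\<in>J. measure N (Y i)) * (\<Prod>i\<in>\<rho> k ` J'. measure N (Y i))"
      using J J' elim(1) by (intro prod.union_disjoint) auto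
    also have "(\<Prod>i\<in>\<rho> k ` J'. measure N (Y i)) = (\<Prod>i\<in>J'. measure N (X' i))"
      by (subst prod.reindex[OF inj]) (auto simp: Y2)
    also have "(\<Prod>i\<in>J. measure N (Y i)) = (\<Prod>i\<in>J. measure N (X i))" by (auto simp: Y1)
    also have "\<dots> = measure ?P A" unfolding A using J by (intro box[symmetric]) auto
    also have "(\<Prod>i\<in>J'. measure N (X' i)) = measure ?P B" unfolding B using J' by (intro box[symmetric]) auto
    finally show ?case .
  qed
  then show "((\<lambda>k. measure ?P (A \<inter> ((\<lambda>x. \<lambda>i\<in>I. x (\<rho> k i)) -` B \<inter> space ?P)))
      \<longlongrightarrow> measure ?P A * measure ?P B) (at_infinity_on K)"
    by (rule tendsto_eventually)
qed

lemma mixing_bernoulli_shift: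
  fixes G (structure)
  assumes "group G" "prob_space N" "K \<subseteq> carrier G" "infinite K"
  shows "mixing K (bernoulli_space G N) (bernoulli_shift G)"
proof -
  interpret group G by fact
  have "mixing K (PiM (carrier G) (\<lambda>_. N)) (\<lambda>k x. \<lambda>i\<in>carrier G. x (inv k \<otimes> i))"
  proof (rule mixing_shift[OF assms(2,4)])
    fix a b assume ab: "a \<in> carrier G" "b \<in> carrier G"
    have "{k \<in> K. inv k \<otimes> a = b} \<subseteq> {a \<otimes> inv b}"
    proof clarsimp
      fix k assume k: "k \<in> K" "b = inv k \<otimes> a"
      then have "k \<in> carrier G" using assms by auto
      then show "k = a \<otimes> inv (inv k \<otimes> a)" using ab by (simp add: inv_mult_group m_assoc[symmetric])
    qed
    then show "finite {k \<in> K. inv k \<otimes> a = b}" by (rule finite_subset) simp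
  qed (use assms in \<open>auto simp: inj_on_def subset_iff\<close>)
  then show ?thesis by (simp add: bernoulli_space_def bernoulli_shift_def[abs_def])
qed

text \<open>
  The action, by left translations, does not preserve the pairs \<open>{h, g\<inverse> h}\<close> of coordinates that
  agree on a fixed point of \<open>g\<close>. Right translations permute these pairs, and they are mixing as well.
\<close>

lemma bernoulli_shift_free:
  fixes G (structure)
  assumes "group G" "countable (carrier G)" "infinite (carrier G)" "prob_space N"
    and B: "B \<in> sets N" "0 < measure N B" "measure N B < 1"
    and g: "g \<in> carrier G" "g \<noteq> \<one>"
  shows "AE x in bernoulli_space G N. bernoulli_shift G g x \<noteq> x"
proof -
  interpret group G by fact
  interpret N: prob_space N by fact
  let ?P = "PiM (carrier G) (\<lambda>_. N)"
  interpret P: product_prob_space "\<lambda>_. N" "carrier G" ..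
  have mix: "mixing (carrier G) ?P (\<lambda>k x. \<lambda>i\<in>carrier G. x (i \<otimes> k))" (is "mixing _ _ ?T")
  proof (rule mixing_shift[OF assms(4,3)])
    fix a b assume ab: "a \<in> carrier G" "b \<in> carrier G"
    have "{k \<in> carrier G. a \<otimes> k = b} \<subseteq> {inv a \<otimes> b}" using ab by (auto simp: m_assoc[symmetric])
    then show "finite {k \<in> carrier G. a \<otimes> k = b}" by (rule finite_subset) simp
  qed (auto simp: inj_on_def)
  \<comment> \<open>Fixed points of \<open>g\<close> have equal coordinates at \<open>h\<close> and
    \<open>inv g \<otimes> h\<close>; \<open>A\<close> records this only through membership in
    \<open>B\<close>. \<open>C\<close> breaks it at \<open>h = \<one>\<close> and has positive
    measure. Right translation by \<open>k\<close> turns \<open>C\<close> into an event that breaks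
    it at \<open>h = k\<close>, so all correlations of \<open>A\<close> with translates of
    \<open>C\<close> vanish and \<open>A\<close> is null.\<close>
  define A where "A = {x \<in> space ?P. \<forall>h\<in>carrier G. x h \<in> B \<longleftrightarrow> x (inv g \<otimes> h) \<in> B}"
  define C where "C = {x \<in> space ?P. \<forall>i\<in>{\<one>, inv g}. x i \<in> (if i = \<one> then B else space N - B)}"
  have ne: "inv g \<noteq> \<one>" using g by (metis inv_inv inv_one)
  have A: "A \<in> sets ?P"
    unfolding A_def using g assms(2) B(1)
    by (intro sets.sets_Collect_countable_All' sets.sets_Collect) (auto intro!: sets_Collect_single' sets.sets_Collect)
  have C_emb: "C = prod_emb (carrier G) (\<lambda>_. N) {\<one>, inv g} (Pi\<^sub>E {\<one>, inv g} (\<lambda>i. if i = \<one> then B else space N - B))"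
    unfolding C_def using g by (intro prod_emb_box[symmetric]) auto
  have "measure ?P C = (\<Prod>i\<in>{\<one>, inv g}. measure N (if i = \<one> then B else space N - B))"
    unfolding C_emb using B g by (intro P.measure_PiM_emb) auto
  then have C: "measure ?P C = measure N B * (1 - measure N B)"
    using ne B by (simp add: N.prob_compl)
  have CS: "C \<in> sets ?P" unfolding C_emb using B g by (auto intro!: sets_PiM_I)
  have "eventually (\<lambda>k. measure ?P (A \<inter> (?T k -` C \<inter> space ?P)) = 0) (at_infinity_on (carrier G))"
    using eventually_at_infinity_on_mem
  proof eventually_elim
    case (elim k)
    have "A \<inter> (?T k -` C \<inter> space ?P) = {}"
      using g elim ne B(1) sets.sets_into_space[OF B(1)] by (auto simp: A_def C_def)
    then show ?case by simp
  qed
  then have lim0: "((\<lambda>k. measure ?P (A \<inter> (?T k -` C \<inter> space ?P))) \<longlongrightarrow> 0) (at_infinity_on (carrier G))"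
    by (rule tendsto_eventually)
  have "((\<lambda>k. measure ?P (A \<inter> (?T k -` C \<inter> space ?P))) \<longlongrightarrow> measure ?P A * measure ?P C) (at_infinity_on (carrier G))"
    using mix A CS unfolding mixing_def by blast
  then have "measure ?P A * measure ?P C = 0"
    by (rule tendsto_unique[OF at_infinity_on_nontrivial[OF assms(3)] _ lim0])
  then have "measure ?P A = 0" using C B by auto
  then have "A \<in> null_sets ?P" using A by (simp add: null_sets_def P.emeasure_eq_measure)
  moreover have "x \<in> A" if x: "x \<in> space ?P" "bernoulli_shift G g x = x" for x
  proof -
    have "x (inv g \<otimes> h) = x h" if "h \<in> carrier G" for h
      using fun_cong[OF x(2), of h] that by (simp add: bernoulli_shift_def)
    then show ?thesis using x(1) by (simp add: A_def)
  qed
  ultimately show ?thesis unfolding bernoulli_space_def by (auto intro: AE_I')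
qed

section \<open>Cocycles over mixing actions\<close>

lemma (in group) cancel_left:
  "x \<in> carrier G \<Longrightarrow> y \<in> carrier G \<Longrightarrow> x \<otimes> (inv x \<otimes> y) = y"
  "x \<in> carrier G \<Longrightarrow> y \<in> carrier G \<Longrightarrow> inv x \<otimes> (x \<otimes> y) = y"
  by (simp_all flip: m_assoc)

lemma measurable_count_space_op:
  assumes "f \<in> measurable M (count_space A)" "g \<in> measurable M (count_space B)"
    and "countable A" "\<And>a b. a \<in> A \<Longrightarrow> b \<in> B \<Longrightarrow> op a b \<in> C"
  shows "(\<lambda>x. op (f x) (g x)) \<in> measurable M (count_space C)"
proof (rule measurable_compose_countable'[where I = A and g = f])
  fix a assume "a \<in> A"
  then have "op a \<in> measurable (count_space B) (count_space C)" using assms(4) by auto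
  then show "(\<lambda>x. op a (g x)) \<in> measurable M (count_space C)"
    by (rule measurable_compose[OF assms(2)])
qed (use assms in auto)

lemma measurable_group_mult:
  assumes "group \<Gamma>" "countable (carrier \<Gamma>)"
    "f \<in> measurable M (count_space (carrier \<Gamma>))" "g \<in> measurable M (count_space (carrier \<Gamma>))"
  shows "(\<lambda>x. f x \<otimes>\<^bsub>\<Gamma>\<^esub> g x) \<in> measurable M (count_space (carrier \<Gamma>))"
  by (rule measurable_count_space_op[OF assms(3,4,2)]) (use assms(1) in \<open>simp add: monoid.m_closed group.is_monoid\<close>)

lemma measurable_group_inv:
  assumes "group \<Gamma>" "f \<in> measurable M (count_space (carrier \<Gamma>))"
  shows "(\<lambda>x. inv\<^bsub>\<Gamma>\<^esub> f x) \<in> measurable M (count_space (carrier \<Gamma>))"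
  using assms(1) by (intro measurable_compose[OF assms(2)]) (simp add: group.inv_closed)

definition strict_cocycle ::
  "('g, 'r) monoid_scheme \<Rightarrow> ('h, 's) monoid_scheme \<Rightarrow> 'a measure \<Rightarrow> ('g \<Rightarrow> 'a \<Rightarrow> 'a) \<Rightarrow> ('g \<Rightarrow> 'a \<Rightarrow> 'h) \<Rightarrow> bool" where
  "strict_cocycle G \<Gamma> M T w \<longleftrightarrow>
     (\<forall>g\<in>carrier G. w g \<in> measurable M (count_space (carrier \<Gamma>))) \<and>
     (\<forall>g\<in>carrier G. \<forall>h\<in>carrier G. \<forall>x\<in>space M. w (g \<otimes>\<^bsub>G\<^esub> h) x = w g (T h x) \<otimes>\<^bsub>\<Gamma>\<^esub> w h x)"

lemma strict_cocycle_closed: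
  assumes "strict_cocycle G \<Gamma> M T w" "g \<in> carrier G" "x \<in> space M"
  shows "w g x \<in> carrier \<Gamma>"
  using assms measurable_space[of "w g" M "count_space (carrier \<Gamma>)" x] by (auto simp: strict_cocycle_def)

lemma strict_cocycle_one:
  assumes "group G" "group \<Gamma>" "strict_action G M T" "strict_cocycle G \<Gamma> M T w" "x \<in> space M"
  shows "w \<one>\<^bsub>G\<^esub> x = \<one>\<^bsub>\<Gamma>\<^esub>"
proof -
  interpret G: group G by fact
  interpret \<Gamma>: group \<Gamma> by fact
  have "w \<one>\<^bsub>G\<^esub> x = w \<one>\<^bsub>G\<^esub> x \<otimes>\<^bsub>\<Gamma>\<^esub> w \<one>\<^bsub>G\<^esub> x"
    using assms(3-5) unfolding strict_cocycle_def strict_action_def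
    by (metis G.one_closed G.r_one)
  then show ?thesis using strict_cocycle_closed[OF assms(4) G.one_closed assms(5)]
    by (metis \<Gamma>.l_cancel_one')
qed

lemma strict_action_space:
  "strict_action G M T \<Longrightarrow> g \<in> carrier G \<Longrightarrow> x \<in> space M \<Longrightarrow> T g x \<in> space M"
  using measurable_space[of "T g" M M x] by (auto simp: strict_action_def)

section \<open>Actions twisted by a pair of cocycles\<close>

lemma distr_count_space_bij:
  assumes "bij_betw f A A" shows "emeasure (count_space A) {a \<in> A. f a \<in> S} = emeasure (count_space A) (A \<inter> S)"
proof -
  have "emeasure (distr (count_space A) (count_space A) f) (A \<inter> S) = emeasure (count_space A) (f -` (A \<inter> S) \<inter> A)"
    using assms by (subst emeasure_distr) (auto simp: bij_betw_def)
  moreover have "f -` (A \<inter> S) \<inter> A = {a \<in> A. f a \<in> S}" using assms by (auto simp: bij_betw_def)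
  ultimately show ?thesis by (simp add: distr_bij_count_space[OF assms])
qed

text \<open>The graph of \<open>f\<close> is invariant exactly when \<open>f (T g z)\<close> is
  \<open>f z\<close> multiplied by \<open>a g z\<close> on the left and by the inverse of
  \<open>b g z\<close> on the right. Transfer functions between \<open>a\<close> and
  \<open>b\<close> are thus the invariant sections of this action.\<close>

definition twisted_action ::
  "('h, 's) monoid_scheme \<Rightarrow> ('g \<Rightarrow> 'a \<Rightarrow> 'a) \<Rightarrow> ('g \<Rightarrow> 'a \<Rightarrow> 'h) \<Rightarrow> ('g \<Rightarrow> 'a \<Rightarrow> 'h) \<Rightarrow> 'g \<Rightarrow> 'a \<times> 'h \<Rightarrow> 'a \<times> 'h" where
  "twisted_action \<Gamma> T a b g = (\<lambda>(z, h). (T g z, a g z \<otimes>\<^bsub>\<Gamma>\<^esub> h \<otimes>\<^bsub>\<Gamma>\<^esub> inv\<^bsub>\<Gamma>\<^esub> b g z))"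

text \<open>Between fibres the action is a bijection of \<open>\<Gamma>\<close>, which preserves
  counting measure. Integrating over the base and using the invariance of \<open>M\<close> under
  \<open>T\<close> gives the rest.\<close>

lemma strict_action_twisted:
  fixes G :: "('g, 'r) monoid_scheme" and \<Gamma> :: "('h, 's) monoid_scheme" and M :: "'a measure"
  assumes "group G" "group \<Gamma>" "countable (carrier \<Gamma>)" "prob_space M"
    and act: "strict_action G M T" and a: "strict_cocycle G \<Gamma> M T a" and b: "strict_cocycle G \<Gamma> M T b"
  shows "strict_action G (M \<Otimes>\<^sub>M count_space (carrier \<Gamma>)) (twisted_action \<Gamma> T a b)"
  unfolding strict_action_def
proof (intro conjI ballI)
  interpret G: group G by fact
  interpret \<Gamma>: group \<Gamma> by fact
  interpret M: prob_space M by fact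
  let ?C = "count_space (carrier \<Gamma>)"
  let ?M = "M \<Otimes>\<^sub>M ?C"
  interpret C: sigma_finite_measure ?C by (rule sigma_finite_measure_count_space_countable) fact
  fix g assume g: "g \<in> carrier G"
  have T: "T g \<in> measurable M M" "distr M M (T g) = M" using act g by (auto simp: strict_action_def)
  have ab: "a g \<in> measurable M ?C" "b g \<in> measurable M ?C" using a b g by (auto simp: strict_cocycle_def)
  have cl: "a g z \<in> carrier \<Gamma>" "b g z \<in> carrier \<Gamma>" if "z \<in> space M" for z
    using strict_cocycle_closed[OF a g that] strict_cocycle_closed[OF b g that] .
  have meas: "twisted_action \<Gamma> T a b g \<in> measurable ?M ?M"
    unfolding twisted_action_def case_prod_beta
    by (intro measurable_Pair measurable_group_mult measurable_group_inv assms
        measurable_compose[OF measurable_fst] measurable_compose[OF measurable_fst T(1)] ab measurable_snd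
        measurable_compose[OF measurable_fst ab(1)] measurable_compose[OF measurable_fst ab(2)])
  then show "twisted_action \<Gamma> T a b g \<in> measurable ?M ?M" .
  show "distr ?M ?M (twisted_action \<Gamma> T a b g) = ?M"
  proof (rule measure_eqI)
    fix S assume S: "S \<in> sets (distr ?M ?M (twisted_action \<Gamma> T a b g))"
    then have S': "S \<in> sets ?M" by simp
    have "emeasure (distr ?M ?M (twisted_action \<Gamma> T a b g)) S
        = emeasure ?M (twisted_action \<Gamma> T a b g -` S \<inter> space ?M)"
      using meas S' by (rule emeasure_distr)
    also have "\<dots> = (\<integral>\<^sup>+z. emeasure ?C (Pair z -` (twisted_action \<Gamma> T a b g -` S \<inter> space ?M)) \<partial>M)"
      using measurable_sets[OF meas S'] by (rule C.emeasure_pair_measure_alt)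
    also have "\<dots> = (\<integral>\<^sup>+z. emeasure ?C (Pair (T g z) -` S) \<partial>M)"
    proof (rule nn_integral_cong)
      fix z assume z: "z \<in> space M"
      let ?f = "\<lambda>h. a g z \<otimes>\<^bsub>\<Gamma>\<^esub> h \<otimes>\<^bsub>\<Gamma>\<^esub> inv\<^bsub>\<Gamma>\<^esub> b g z"
      have "bij_betw ?f (carrier \<Gamma>) (carrier \<Gamma>)"
        by (rule bij_betw_byWitness[where f' = "\<lambda>h. inv\<^bsub>\<Gamma>\<^esub> a g z \<otimes>\<^bsub>\<Gamma>\<^esub> h \<otimes>\<^bsub>\<Gamma>\<^esub> b g z"])
          (use cl[OF z] in \<open>auto simp: \<Gamma>.m_assoc \<Gamma>.cancel_left\<close>)
      from distr_count_space_bij[OF this, of "Pair (T g z) -` S"]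
      have "emeasure ?C {h \<in> carrier \<Gamma>. ?f h \<in> Pair (T g z) -` S} = emeasure ?C (carrier \<Gamma> \<inter> Pair (T g z) -` S)" .
      moreover have "Pair z -` (twisted_action \<Gamma> T a b g -` S \<inter> space ?M) = {h \<in> carrier \<Gamma>. ?f h \<in> Pair (T g z) -` S}"
        using z by (auto simp: twisted_action_def space_pair_measure)
      moreover have "carrier \<Gamma> \<inter> Pair (T g z) -` S = Pair (T g z) -` S"
        using sets.sets_into_space[OF S'] by (auto simp: space_pair_measure)
      ultimately show "emeasure ?C (Pair z -` (twisted_action \<Gamma> T a b g -` S \<inter> space ?M)) = emeasure ?C (Pair (T g z) -` S)"
        by simp
    qed
    also have "\<dots> = (\<integral>\<^sup>+z. emeasure ?C (Pair z -` S) \<partial>distr M M (T g))"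
      by (rule nn_integral_distr[symmetric, OF T(1)]) (simp add: C.measurable_emeasure_Pair[OF S'])
    also have "\<dots> = emeasure ?M S" unfolding T(2) by (rule C.emeasure_pair_measure_alt[OF S', symmetric])
    finally show "emeasure (distr ?M ?M (twisted_action \<Gamma> T a b g)) S = emeasure ?M S" .
  qed simp
next
  interpret G: group G by fact
  interpret \<Gamma>: group \<Gamma> by fact
  fix x assume "x \<in> space (M \<Otimes>\<^sub>M count_space (carrier \<Gamma>))"
  then obtain z h where x: "x = (z, h)" "z \<in> space M" "h \<in> carrier \<Gamma>" by (auto simp: space_pair_measure)
  show "twisted_action \<Gamma> T a b \<one>\<^bsub>G\<^esub> x = x"
    using act x strict_cocycle_one[OF assms(1,2) act a] strict_cocycle_one[OF assms(1,2) act b]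
    by (simp add: twisted_action_def strict_action_def)
  fix g g' assume g: "g \<in> carrier G" "g' \<in> carrier G"
  have z: "T g' z \<in> space M" using strict_action_space[OF act g(2) x(2)] .
  note cl = strict_cocycle_closed[OF a g(1) z] strict_cocycle_closed[OF b g(1) z]
    strict_cocycle_closed[OF a g(2) x(2)] strict_cocycle_closed[OF b g(2) x(2)]
  have "a (g \<otimes>\<^bsub>G\<^esub> g') z = a g (T g' z) \<otimes>\<^bsub>\<Gamma>\<^esub> a g' z" "b (g \<otimes>\<^bsub>G\<^esub> g') z = b g (T g' z) \<otimes>\<^bsub>\<Gamma>\<^esub> b g' z"
    "T (g \<otimes>\<^bsub>G\<^esub> g') z = T g (T g' z)"
    using a b act g x(2) by (auto simp: strict_cocycle_def strict_action_def)
  then show "twisted_action \<Gamma> T a b (g \<otimes>\<^bsub>G\<^esub> g') x = twisted_action \<Gamma> T a b g (twisted_action \<Gamma> T a b g' x)"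
    using cl x by (simp add: twisted_action_def \<Gamma>.m_assoc \<Gamma>.inv_mult_group)
qed

text \<open>
  If \<open>\<xi>\<close> is invariant under the twisted action and close to the indicator of \<open>Z \<times> {\<one>}\<close>, then by
  ergodicity almost every fibre contains exactly one point where \<open>\<xi> > 1/2\<close>, which is the transfer
  function between the two cocycles.
\<close>

theorem cohomologous_if_close:
  fixes G :: "('g, 'r) monoid_scheme" and \<Gamma> :: "('h, 's) monoid_scheme" and Z :: "'a measure"
  assumes "group G" "countable (carrier G)" "infinite (carrier G)" and KP: "kazhdan_pair G F \<epsilon>"
    and "group \<Gamma>" "countable (carrier \<Gamma>)" "prob_space Z"
    and act: "strict_action G Z T" and mix: "mixing (carrier G) Z T"
    and a: "strict_cocycle G \<Gamma> Z T a" and b: "strict_cocycle G \<Gamma> Z T b"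
    and close: "\<And>g. g \<in> F \<Longrightarrow> measure Z {z \<in> space Z. a (inv\<^bsub>G\<^esub> g) z \<noteq> b (inv\<^bsub>G\<^esub> g) z} < \<epsilon>\<^sup>2 / 32"
  shows "\<exists>f \<in> measurable Z (count_space (carrier \<Gamma>)).
    \<forall>g\<in>carrier G. AE z in Z. f (T g z) = a g z \<otimes>\<^bsub>\<Gamma>\<^esub> f z \<otimes>\<^bsub>\<Gamma>\<^esub> inv\<^bsub>\<Gamma>\<^esub> b g z"
proof -
  interpret G: group G by fact
  interpret \<Gamma>: group \<Gamma> by fact
  interpret Z: prob_space Z by fact
  let ?C = "count_space (carrier \<Gamma>)"
  interpret C: sigma_finite_measure ?C by (rule sigma_finite_measure_count_space_countable) fact
  let ?M = "Z \<Otimes>\<^sub>M ?C"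
  interpret ZC: pair_sigma_finite Z ?C ..
  have F: "F \<subseteq> carrier G" and \<epsilon>: "0 < \<epsilon>" using KP by (auto simp: kazhdan_pair_def)
  define S where "S = space Z \<times> {\<one>\<^bsub>\<Gamma>\<^esub>}"
  have S: "S \<in> sets ?M" unfolding S_def by (intro pair_measureI) auto
  have S_fin: "emeasure ?M S < \<infinity>"
    unfolding S_def by (subst C.emeasure_pair_measure_Times) (auto simp: Z.emeasure_space_1)
  have twist: "strict_action G ?M (twisted_action \<Gamma> T a b)"
    by (rule strict_action_twisted) fact+
  \<comment> \<open>In each fibre at most two points separate \<open>S\<close> from its translate,
    and none where the cocycles agree. Hence the constant:
    \<open>2 * (\<epsilon>\<^sup>2 / 32)\<close> is the square of \<open>\<epsilon> * (1/4)\<close>,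
    so the invariant function lies within \<open>1/4\<close> of the indicator.\<close>
  have near: "measure ?M {x \<in> space ?M. (twisted_action \<Gamma> T a b (inv\<^bsub>G\<^esub> g) x \<in> S) \<noteq> (x \<in> S)} < (\<epsilon> * (1/4))\<^sup>2"
    if "g \<in> F" for g
  proof -
    have g: "inv\<^bsub>G\<^esub> g \<in> carrier G" using F that by auto
    have [measurable]: "a (inv\<^bsub>G\<^esub> g) \<in> measurable Z ?C" "b (inv\<^bsub>G\<^esub> g) \<in> measurable Z ?C"
      using a b g by (auto simp: strict_cocycle_def)
    let ?B = "{x \<in> space ?M. (twisted_action \<Gamma> T a b (inv\<^bsub>G\<^esub> g) x \<in> S) \<noteq> (x \<in> S)}"
    let ?D = "{z \<in> space Z. a (inv\<^bsub>G\<^esub> g) z \<noteq> b (inv\<^bsub>G\<^esub> g) z}"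
    have "?D = (\<Union>h\<in>carrier \<Gamma>. {z \<in> space Z. a (inv\<^bsub>G\<^esub> g) z = h} \<inter> {z \<in> space Z. b (inv\<^bsub>G\<^esub> g) z \<noteq> h})"
      using strict_cocycle_closed[OF a g] by auto
    also have "\<dots> \<in> sets Z"
      using \<open>countable (carrier \<Gamma>)\<close> by (intro sets.countable_UN'' sets.Int) measurable
    finally have D: "?D \<in> sets Z" .
    have B: "?B \<in> sets ?M"
    proof -
      have "twisted_action \<Gamma> T a b (inv\<^bsub>G\<^esub> g) \<in> measurable ?M ?M"
        using twist g by (auto simp: strict_action_def)
      note [measurable] = this S
      show ?thesis by measurable
    qed
    have "emeasure ?M ?B = (\<integral>\<^sup>+z. emeasure ?C (Pair z -` ?B) \<partial>Z)" by (rule C.emeasure_pair_measure_alt[OF B])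
    also have "\<dots> \<le> (\<integral>\<^sup>+z. 2 * indicator ?D z \<partial>Z)"
    proof (rule nn_integral_mono)
      fix z assume z: "z \<in> space Z"
      define p q where "p = a (inv\<^bsub>G\<^esub> g) z" and "q = b (inv\<^bsub>G\<^esub> g) z"
      have pq: "p \<in> carrier \<Gamma>" "q \<in> carrier \<Gamma>"
        using strict_cocycle_closed[OF a g z] strict_cocycle_closed[OF b g z] by (auto simp: p_def q_def)
      have Tz: "T (inv\<^bsub>G\<^esub> g) z \<in> space Z" using strict_action_space[OF act g z] .
      have iff: "p \<otimes>\<^bsub>\<Gamma>\<^esub> h \<otimes>\<^bsub>\<Gamma>\<^esub> inv\<^bsub>\<Gamma>\<^esub> q = \<one>\<^bsub>\<Gamma>\<^esub> \<longleftrightarrow> h = inv\<^bsub>\<Gamma>\<^esub> p \<otimes>\<^bsub>\<Gamma>\<^esub> q" if "h \<in> carrier \<Gamma>" for h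
      proof -
        have "p \<otimes>\<^bsub>\<Gamma>\<^esub> h \<otimes>\<^bsub>\<Gamma>\<^esub> inv\<^bsub>\<Gamma>\<^esub> q = \<one>\<^bsub>\<Gamma>\<^esub> \<longleftrightarrow> p \<otimes>\<^bsub>\<Gamma>\<^esub> h = q"
          using pq that by (metis \<Gamma>.inv_closed \<Gamma>.inv_inv \<Gamma>.inv_equality \<Gamma>.m_closed \<Gamma>.r_inv)
        also have "\<dots> \<longleftrightarrow> h = inv\<^bsub>\<Gamma>\<^esub> p \<otimes>\<^bsub>\<Gamma>\<^esub> q" using pq that by (metis \<Gamma>.inv_solve_left)
        finally show ?thesis .
      qed
      have slice: "Pair z -` ?B = {h \<in> carrier \<Gamma>. (h = inv\<^bsub>\<Gamma>\<^esub> p \<otimes>\<^bsub>\<Gamma>\<^esub> q) \<noteq> (h = \<one>\<^bsub>\<Gamma>\<^esub>)}"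
        using z Tz iff by (auto simp: space_pair_measure twisted_action_def S_def p_def q_def)
      show "emeasure ?C (Pair z -` ?B) \<le> 2 * indicator ?D z"
      proof (cases "z \<in> ?D")
        case True
        have "Pair z -` ?B \<subseteq> {inv\<^bsub>\<Gamma>\<^esub> p \<otimes>\<^bsub>\<Gamma>\<^esub> q, \<one>\<^bsub>\<Gamma>\<^esub>}" unfolding slice by auto
        then have "emeasure ?C (Pair z -` ?B) \<le> emeasure ?C {inv\<^bsub>\<Gamma>\<^esub> p \<otimes>\<^bsub>\<Gamma>\<^esub> q, \<one>\<^bsub>\<Gamma>\<^esub>}"
          using pq by (intro emeasure_mono) auto
        also have "\<dots> \<le> 2" using pq by (auto simp: card_insert_if)
        finally show ?thesis using True by simp
      next
        case False
        then have "p = q" using z by (simp add: p_def q_def)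
        then show ?thesis unfolding slice using pq by auto
      qed
    qed
    also have "\<dots> = 2 * emeasure Z ?D" using D by (simp add: nn_integral_cmult)
    also have "\<dots> = ennreal (2 * measure Z ?D)" by (simp add: Z.emeasure_eq_measure ennreal_mult)
    finally have "measure ?M ?B \<le> 2 * measure Z ?D" by (simp add: measure_def enn2real_leI)
    then show ?thesis using close[OF that] by (simp add: power_mult_distrib power2_eq_square)
  qed
  obtain \<xi> :: "'a \<times> 'h \<Rightarrow> real" where \<xi>[measurable]: "\<xi> \<in> borel_measurable ?M"
    and inv: "\<And>g. g \<in> carrier G \<Longrightarrow> AE x in ?M. \<xi> (twisted_action \<Gamma> T a b g x) = \<xi> x"
    and int: "integrable ?M (\<lambda>x. (\<xi> x - indicator S x)\<^sup>2)"
    and small: "(\<integral>x. (\<xi> x - indicator S x)\<^sup>2 \<partial>?M) < (1/4)\<^sup>2"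
    using kazhdan_invariant_function[OF assms(1,2) twist KP S S_fin _ near] by auto
  define Q where "Q z \<longleftrightarrow> (\<exists>!h. h \<in> carrier \<Gamma> \<and> \<xi> (z, h) > 1/2)" for z
  define f where "f z = (if Q z then THE h. h \<in> carrier \<Gamma> \<and> \<xi> (z, h) > 1/2 else \<one>\<^bsub>\<Gamma>\<^esub>)" for z
  have f: "f z \<in> carrier \<Gamma> \<and> \<xi> (z, f z) > 1/2" if "Q z" for z
    using theI'[of "\<lambda>h. h \<in> carrier \<Gamma> \<and> \<xi> (z, h) > 1/2"] that by (simp add: f_def Q_def)
  have f_unique: "h = f z" if "Q z" "h \<in> carrier \<Gamma>" "\<xi> (z, h) > 1/2" for z h
    using that f[OF that(1)] unfolding Q_def by blast
  have \<xi>_slice [measurable]: "(\<lambda>z. \<xi> (z, h)) \<in> borel_measurable Z" if "h \<in> carrier \<Gamma>" for h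
    using that by (intro measurable_compose[OF _ \<xi>] measurable_Pair) auto
  have sets_Q: "{z \<in> space Z. Q z} \<in> sets Z"
  proof -
    have "{z \<in> space Z. Q z} = {z \<in> space Z. \<exists>h\<in>carrier \<Gamma>. \<xi> (z, h) > 1/2 \<and> (\<forall>h'\<in>carrier \<Gamma>. \<xi> (z, h') > 1/2 \<longrightarrow> h' = h)}"
      unfolding Q_def by (intro Collect_cong) blast
    also have "\<dots> \<in> sets Z"
    proof (intro sets.sets_Collect_countable_Ex' sets.sets_Collect_conj sets.sets_Collect_countable_All' \<open>countable (carrier \<Gamma>)\<close>)
      fix h h' assume [measurable]: "h \<in> carrier \<Gamma>" "h' \<in> carrier \<Gamma>"
      show "{z \<in> space Z. \<xi> (z, h) > 1/2} \<in> sets Z" by measurable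
      show "{z \<in> space Z. \<xi> (z, h') > 1/2 \<longrightarrow> h' = h} \<in> sets Z" by measurable
    qed
    finally show ?thesis .
  qed
  have f_meas: "f \<in> measurable Z ?C"
    unfolding measurable_count_space_eq_countable[OF \<open>countable (carrier \<Gamma>)\<close>]
  proof (intro conjI ballI impI)
    show "f \<in> space Z \<rightarrow> carrier \<Gamma>" using f by (auto simp: f_def)
    fix h assume [measurable]: "h \<in> carrier \<Gamma>"
    have "f -` {h} \<inter> space Z = {z \<in> space Z. (Q z \<and> \<xi> (z, h) > 1/2) \<or> (\<not> Q z \<and> h = \<one>\<^bsub>\<Gamma>\<^esub>)}"
    proof -
      have "f z = h \<longleftrightarrow> (Q z \<and> \<xi> (z, h) > 1/2) \<or> (\<not> Q z \<and> h = \<one>\<^bsub>\<Gamma>\<^esub>)" for z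
        using f[of z] f_unique[of z h] \<open>h \<in> carrier \<Gamma>\<close> by (cases "Q z") (auto simp: f_def)
      then show ?thesis by auto
    qed
    also have "\<dots> \<in> sets Z"
    proof -
      have [measurable]: "Measurable.pred Z Q" using sets_Q by (simp add: pred_def)
      show ?thesis by measurable
    qed
    finally show "f -` {h} \<inter> space Z \<in> sets Z" .
  qed
  \<comment> \<open>The fibre over \<open>z\<close> is mapped bijectively to the fibre over
    \<open>T g z\<close> with the values of \<xi> preserved, so the uniqueness and the position of
    the large value are carried along.\<close>
  have equiv: "AE z in Z. Q z \<longrightarrow> Q (T g z) \<and> f (T g z) = a g z \<otimes>\<^bsub>\<Gamma>\<^esub> f z \<otimes>\<^bsub>\<Gamma>\<^esub> inv\<^bsub>\<Gamma>\<^esub> b g z"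
    if g: "g \<in> carrier G" for g
  proof -
    have "AE z in Z. AE h in ?C. \<xi> (twisted_action \<Gamma> T a b g (z, h)) = \<xi> (z, h)"
      using ZC.AE_pair[OF inv[OF g]] .
    then have "AE z in Z. \<forall>h\<in>carrier \<Gamma>. \<xi> (twisted_action \<Gamma> T a b g (z, h)) = \<xi> (z, h)"
      by (simp add: AE_count_space)
    then show ?thesis
    proof (rule AE_mp, intro AE_I2 impI)
      fix z assume z: "z \<in> space Z" "Q z"
        and "\<forall>h\<in>carrier \<Gamma>. \<xi> (twisted_action \<Gamma> T a b g (z, h)) = \<xi> (z, h)"
      then have eq: "\<xi> (T g z, a g z \<otimes>\<^bsub>\<Gamma>\<^esub> h \<otimes>\<^bsub>\<Gamma>\<^esub> inv\<^bsub>\<Gamma>\<^esub> b g z) = \<xi> (z, h)" if "h \<in> carrier \<Gamma>" for h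
        using that by (simp add: twisted_action_def)
      have cl: "a g z \<in> carrier \<Gamma>" "b g z \<in> carrier \<Gamma>"
        using strict_cocycle_closed[OF a g z(1)] strict_cocycle_closed[OF b g z(1)] .
      define k where "k = a g z \<otimes>\<^bsub>\<Gamma>\<^esub> f z \<otimes>\<^bsub>\<Gamma>\<^esub> inv\<^bsub>\<Gamma>\<^esub> b g z"
      have k: "k \<in> carrier \<Gamma>" "\<xi> (T g z, k) > 1/2" using cl f[OF z(2)] eq[of "f z"] by (auto simp: k_def)
      have "k' = k" if k': "k' \<in> carrier \<Gamma>" "\<xi> (T g z, k') > 1/2" for k'
      proof -
        define h where "h = inv\<^bsub>\<Gamma>\<^esub> a g z \<otimes>\<^bsub>\<Gamma>\<^esub> k' \<otimes>\<^bsub>\<Gamma>\<^esub> b g z"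
        have h: "h \<in> carrier \<Gamma>" using cl k' by (simp add: h_def)
        have "a g z \<otimes>\<^bsub>\<Gamma>\<^esub> h \<otimes>\<^bsub>\<Gamma>\<^esub> inv\<^bsub>\<Gamma>\<^esub> b g z = k'"
        proof -
          have "a g z \<otimes>\<^bsub>\<Gamma>\<^esub> h = k' \<otimes>\<^bsub>\<Gamma>\<^esub> b g z"
            using cl k' by (simp add: h_def \<Gamma>.m_assoc[symmetric])
          then show ?thesis using cl k' by (simp add: \<Gamma>.m_assoc)
        qed
        then have "\<xi> (z, h) > 1/2" using eq[OF h] k' by simp
        then have "h = f z" using f_unique z(2) h by blast
        then show ?thesis using \<open>_ = k'\<close> by (simp add: k_def)
      qed
      then have "Q (T g z)" unfolding Q_def using k by blast
      then show "Q (T g z) \<and> f (T g z) = a g z \<otimes>\<^bsub>\<Gamma>\<^esub> f z \<otimes>\<^bsub>\<Gamma>\<^esub> inv\<^bsub>\<Gamma>\<^esub> b g z"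
        using f_unique[OF _ k] by (simp add: k_def)
    qed
  qed
  \<comment> \<open>Outside \<open>Bad\<close>, \<xi> is within \<open>1/2\<close> of the indicator,
    so a fibre without bad points has its only value above \<open>1/2\<close> at the unit. By
    Markov's inequality \<open>Bad\<close> has measure at most \<open>4 * (1/16) = 1/4\<close>.
    Every fibre without \<open>Q\<close> contributes counting mass at least one to it, so
    \<open>Q\<close> holds with probability at least \<open>3/4\<close>.\<close>
  define Bad where "Bad = {x \<in> space ?M. (\<xi> x - indicator S x)\<^sup>2 \<ge> 1/4}"
  note [measurable] = S
  have Bad: "Bad \<in> sets ?M" unfolding Bad_def by measurable
  have "emeasure ?M Bad \<le> ennreal ((1 / (1/4)) * (\<integral>x. (\<xi> x - indicator S x)\<^sup>2 \<partial>?M))"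
    unfolding Bad_def by (rule integral_Markov_inequality[OF int]) auto
  also have "\<dots> \<le> ennreal (1/4)" using small by (intro ennreal_leI) (simp add: power2_eq_square)
  finally have Bad_small: "emeasure ?M Bad \<le> ennreal (1/4)" .
  have "emeasure Z (space Z - {z \<in> space Z. Q z}) = (\<integral>\<^sup>+z. indicator (space Z - {z \<in> space Z. Q z}) z \<partial>Z)"
    using sets_Q by simp
  also have "\<dots> \<le> (\<integral>\<^sup>+z. emeasure ?C (Pair z -` Bad) \<partial>Z)"
  proof (rule nn_integral_mono)
    fix z assume z: "z \<in> space Z"
    show "indicator (space Z - {z \<in> space Z. Q z}) z \<le> emeasure ?C (Pair z -` Bad)"
    proof (cases "Q z")
      case False
      have "\<exists>h\<in>carrier \<Gamma>. (z, h) \<in> Bad"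
      proof (rule ccontr)
        assume "\<not> (\<exists>h\<in>carrier \<Gamma>. (z, h) \<in> Bad)"
        then have "(\<xi> (z, h) - indicator S (z, h))\<^sup>2 < (1/2)\<^sup>2" if "h \<in> carrier \<Gamma>" for h
          using that z by (auto simp: Bad_def space_pair_measure power2_eq_square)
        then have lt: "\<bar>\<xi> (z, h) - indicator S (z, h)\<bar> < 1/2" if "h \<in> carrier \<Gamma>" for h
          using that power2_less_imp_less[of "\<bar>\<xi> (z, h) - indicator S (z, h)\<bar>" "1/2"] by simp
        have "\<bar>\<xi> (z, \<one>\<^bsub>\<Gamma>\<^esub>) - 1\<bar> < 1/2" using lt[of "\<one>\<^bsub>\<Gamma>\<^esub>"] z by (simp add: S_def)
        then have "\<xi> (z, \<one>\<^bsub>\<Gamma>\<^esub>) > 1/2" by linarith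
        moreover have "h = \<one>\<^bsub>\<Gamma>\<^esub>" if "h \<in> carrier \<Gamma>" "\<xi> (z, h) > 1/2" for h
        proof (rule ccontr)
          assume "h \<noteq> \<one>\<^bsub>\<Gamma>\<^esub>"
          then have "\<bar>\<xi> (z, h)\<bar> < 1/2" using lt[OF that(1)] by (simp add: S_def)
          then show False using that(2) by linarith
        qed
        ultimately have "Q z" unfolding Q_def by (intro ex1I[of _ "\<one>\<^bsub>\<Gamma>\<^esub>"]) auto
        then show False using False by simp
      qed
      then obtain h where h: "h \<in> carrier \<Gamma>" "h \<in> Pair z -` Bad" by auto
      have "1 = emeasure ?C {h}" using h by simp
      also have "\<dots> \<le> emeasure ?C (Pair z -` Bad)"
        using h sets_Pair1[OF Bad] by (intro emeasure_mono) auto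
      finally show ?thesis by (auto simp: indicator_def)
    qed simp
  qed
  also have "\<dots> = emeasure ?M Bad" by (rule C.emeasure_pair_measure_alt[OF Bad, symmetric])
  also note Bad_small
  finally have "measure Z (space Z - {z \<in> space Z. Q z}) \<le> 1/4"
    by (simp add: Z.emeasure_eq_measure)
  then have "measure Z {z \<in> space Z. Q z} > 0"
    using Z.prob_compl[OF sets_Q] by simp
  then have "AE z in Z. z \<in> {z \<in> space Z. Q z}"
  proof (rule mixing_ergodic[OF assms(7,3) mix sets_Q, rotated])
    fix g assume g: "g \<in> carrier G"
    show "AE z in Z. z \<in> {z \<in> space Z. Q z} \<longrightarrow> T g z \<in> {z \<in> space Z. Q z}"
      using equiv[OF g] by (rule AE_mp) (use strict_action_space[OF act g] in \<open>auto intro!: AE_I2\<close>)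
  qed
  then have Q: "AE z in Z. Q z" by simp
  have "AE z in Z. f (T g z) = a g z \<otimes>\<^bsub>\<Gamma>\<^esub> f z \<otimes>\<^bsub>\<Gamma>\<^esub> inv\<^bsub>\<Gamma>\<^esub> b g z" if "g \<in> carrier G" for g
    using equiv[OF that] Q by eventually_elim simp
  then show ?thesis using f_meas by blast
qed

section \<open>Removing a mixing variable from an equivariant function\<close>

lemma distr_pair_snd:
  assumes "prob_space M" "sigma_finite_measure N" shows "distr (M \<Otimes>\<^sub>M N) N snd = N"
proof (rule measure_eqI)
  interpret M: prob_space M by fact
  interpret N: sigma_finite_measure N by fact
  fix S assume "S \<in> sets (distr (M \<Otimes>\<^sub>M N) N snd)"
  then have S: "S \<in> sets N" by simp
  have "snd -` S \<inter> space (M \<Otimes>\<^sub>M N) = space M \<times> S"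
    using sets.sets_into_space[OF S] by (auto simp: space_pair_measure)
  then show "emeasure (distr (M \<Otimes>\<^sub>M N) N snd) S = emeasure N S"
    using S by (simp add: emeasure_distr N.emeasure_pair_measure_Times M.emeasure_space_1)
qed simp

text \<open>
  The set where \<open>F(a, b) = F(a, b')\<close> is invariant, and it has positive measure because \<open>F\<close> takes
  countably many values. By ergodicity it is everything.
\<close>

theorem independent_of_mixing_coordinate:
  fixes F :: "'a \<times> 'b \<Rightarrow> 'd"
  assumes "prob_space A" "prob_space B" "infinite K" "countable D"
    and T: "mixing K A T" and S: "mixing K B S"
    and F: "F \<in> measurable (A \<Otimes>\<^sub>M B) (count_space D)"
    and equiv: "\<And>k. k \<in> K \<Longrightarrow> AE z in A \<Otimes>\<^sub>M B. F (T k (fst z), S k (snd z)) = \<Phi> k (fst z) (F z)"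
  shows "\<exists>b0\<in>space B. AE z in A \<Otimes>\<^sub>M B. F z = F (fst z, b0)"
proof -
  interpret A: prob_space A by fact
  interpret B: prob_space B by fact
  interpret AB: pair_prob_space A B ..
  interpret BAB: pair_prob_space B "A \<Otimes>\<^sub>M B" ..
  \<comment> \<open>A point \<open>(b', (a, b))\<close> carries two independent second coordinates
    over the same \<open>a\<close>; \<open>snd\<close> and \<open>?p\<close> read off
    \<open>(a, b)\<close> and \<open>(a, b')\<close>.\<close>
  let ?W = "B \<Otimes>\<^sub>M (A \<Otimes>\<^sub>M B)"
  let ?p = "\<lambda>z :: 'b \<times> 'a \<times> 'b. (fst (snd z), fst z)"
  have pr1: "snd \<in> measurable ?W (A \<Otimes>\<^sub>M B)" and pr2: "?p \<in> measurable ?W (A \<Otimes>\<^sub>M B)" by measurable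
  have d1: "distr ?W (A \<Otimes>\<^sub>M B) snd = A \<Otimes>\<^sub>M B" by (intro distr_pair_snd assms AB.P.sigma_finite_measure_axioms)
  have d2: "distr ?W (A \<Otimes>\<^sub>M B) ?p = A \<Otimes>\<^sub>M B"
  proof -
    have e: "distr (A \<Otimes>\<^sub>M B) A fst = A" by (rule B.distr_pair_fst)
    have "distr B B (\<lambda>x. x) \<Otimes>\<^sub>M distr (A \<Otimes>\<^sub>M B) A fst = distr ?W (B \<Otimes>\<^sub>M A) (\<lambda>(x, y). (x, fst y))"
      by (intro pair_measure_distr) (auto simp: e A.sigma_finite_measure_axioms)
    then have BA: "distr ?W (B \<Otimes>\<^sub>M A) (\<lambda>(x, y). (x, fst y)) = B \<Otimes>\<^sub>M A" by (simp add: e distr_id2)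
    have "A \<Otimes>\<^sub>M B = distr (B \<Otimes>\<^sub>M A) (A \<Otimes>\<^sub>M B) (\<lambda>(x, y). (y, x))" by (rule AB.distr_pair_swap)
    also have "\<dots> = distr ?W (A \<Otimes>\<^sub>M B) ((\<lambda>(x, y). (y, x)) \<circ> (\<lambda>(x, y). (x, fst y)))"
    proof -
      have m: "(\<lambda>(x, y). (x, fst y)) \<in> measurable ?W (B \<Otimes>\<^sub>M A)" by measurable
      show ?thesis using distr_distr[OF measurable_pair_swap' m] unfolding BA .
    qed
    also have "(\<lambda>(x, y). (y, x)) \<circ> (\<lambda>(x, y). (x, fst y)) = ?p" by (auto simp: fun_eq_iff)
    finally show ?thesis by simp
  qed
  define E where "E = {z \<in> space ?W. F (snd z) = F (?p z)}"
  have FD: "F z \<in> D" if "z \<in> space (A \<Otimes>\<^sub>M B)" for z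
    using measurable_space[OF F that] by simp
  have F_sets: "{z \<in> space (A \<Otimes>\<^sub>M B). F z = d} \<in> sets (A \<Otimes>\<^sub>M B)" for d
  proof (cases "d \<in> D")
    case True
    have "{z \<in> space (A \<Otimes>\<^sub>M B). F z = d} = F -` {d} \<inter> space (A \<Otimes>\<^sub>M B)" by auto
    then show ?thesis using measurable_sets[OF F, of "{d}"] True by simp
  next
    case False
    then have "{z \<in> space (A \<Otimes>\<^sub>M B). F z = d} = {}" using FD by auto
    then show ?thesis by (simp only: sets.empty_sets)
  qed
  have pred1: "{z \<in> space ?W. F (snd z) = d} \<in> sets ?W" for d
  proof -
    have "{z \<in> space ?W. F (snd z) = d} = snd -` {z \<in> space (A \<Otimes>\<^sub>M B). F z = d} \<inter> space ?W"
      using measurable_space[OF pr1] by auto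
    then show ?thesis using measurable_sets[OF pr1 F_sets] by simp
  qed
  have pred2: "{z \<in> space ?W. F (?p z) = d} \<in> sets ?W" for d
  proof -
    have "{z \<in> space ?W. F (?p z) = d} = ?p -` {z \<in> space (A \<Otimes>\<^sub>M B). F z = d} \<inter> space ?W"
      using measurable_space[OF pr2] by auto
    then show ?thesis using measurable_sets[OF pr2 F_sets] by simp
  qed
  have E_sets: "E \<in> sets ?W"
  proof -
    have "E = {z \<in> space ?W. \<exists>d\<in>D. F (snd z) = d \<and> F (?p z) = d}"
      unfolding E_def using FD[OF measurable_space[OF pr1]] by auto
    also have "\<dots> \<in> sets ?W"
      by (intro sets.sets_Collect_countable_Ex' sets.sets_Collect_conj pred1 pred2 \<open>countable D\<close>)
    finally show ?thesis .
  qed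
  \<comment> \<open>Fix a value \<open>d\<close>, and let \<open>N\<close> collect the
    \<open>x\<close> over which \<open>d\<close> is almost never taken. If \<open>E\<close> were
    null, \<open>F (x, b) = d\<close> would put \<open>x\<close> into \<open>N\<close> for almost
    every pair, so \<open>d\<close> would almost never be taken at all. Countably many such
    \<open>d\<close> exhaust the values, a contradiction.\<close>
  have "\<not> (AE z in ?W. z \<notin> E)"
  proof
    assume notE: "AE z in ?W. z \<notin> E"
    have "AE z in A \<Otimes>\<^sub>M B. F z \<noteq> d" for d
    proof -
      define N where "N = {x \<in> space A. AE y in B. F (x, y) \<noteq> d}"
      have slice: "Pair x -` {z \<in> space (A \<Otimes>\<^sub>M B). F z = d} = {y \<in> space B. F (x, y) = d}"
        if "x \<in> space A" for x using that by (auto simp: space_pair_measure)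
      have "N = {x \<in> space A. emeasure B (Pair x -` {z \<in> space (A \<Otimes>\<^sub>M B). F z = d}) = 0}"
      proof -
        have "(AE y in B. F (x, y) \<noteq> d) \<longleftrightarrow> emeasure B {y \<in> space B. F (x, y) = d} = 0" if x: "x \<in> space A" for x
          using sets_Pair1[OF F_sets[of d], of x] unfolding slice[OF x] by (subst AE_iff_measurable) auto
        then show ?thesis unfolding N_def using slice by auto
      qed
      also have "\<dots> \<in> sets A"
        using B.measurable_emeasure_Pair[OF F_sets[of d]] by measurable
      finally have N: "N \<in> sets A" .
      have "AE b in B. AE z in A \<Otimes>\<^sub>M B. (b, z) \<notin> E" using BAB.AE_pair[OF notE] .
      then have "AE b in B. AE x in A. AE y in B. (b, x, y) \<notin> E"
        by (rule AE_mp) (rule AE_I2, rule impI, erule AB.AE_pair)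
      then have "AE b in B. AE x in A. F (x, b) = d \<longrightarrow> x \<in> N"
      proof (rule AE_imp)
        fix b assume b: "b \<in> space B" and "AE x in A. AE y in B. (b, x, y) \<notin> E"
        from this(2) show "AE x in A. F (x, b) = d \<longrightarrow> x \<in> N"
        proof (rule AE_imp, intro impI)
          fix x assume x: "x \<in> space A" "F (x, b) = d" and ae: "AE y in B. (b, x, y) \<notin> E"
          from ae have "AE y in B. F (x, y) \<noteq> d"
            by (rule AE_mp) (use b x in \<open>auto intro!: AE_I2 simp: E_def space_pair_measure\<close>)
          then show "x \<in> N" using x by (simp add: N_def)
        qed
      qed
      then have "AE x in A. AE b in B. F (x, b) = d \<longrightarrow> x \<in> N"
      proof (subst AB.AE_commute)
        have "{z \<in> space (A \<Otimes>\<^sub>M B). F (fst z, snd z) = d \<longrightarrow> fst z \<in> N}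
            = (space (A \<Otimes>\<^sub>M B) - {z \<in> space (A \<Otimes>\<^sub>M B). F z = d}) \<union> N \<times> space B"
          using sets.sets_into_space[OF N] by (auto simp: space_pair_measure)
        also have "\<dots> \<in> sets (A \<Otimes>\<^sub>M B)" using F_sets N by auto
        finally show "{z \<in> space (A \<Otimes>\<^sub>M B). F (fst z, snd z) = d \<longrightarrow> fst z \<in> N} \<in> sets (A \<Otimes>\<^sub>M B)" .
      qed
      then have "AE x in A. AE y in B. F (x, y) \<noteq> d"
      proof (rule AE_imp)
        fix x assume x: "x \<in> space A" and ae: "AE b in B. F (x, b) = d \<longrightarrow> x \<in> N"
        show "AE y in B. F (x, y) \<noteq> d"
        proof (cases "x \<in> N")
          case True then show ?thesis by (simp add: N_def)
        next
          case False then show ?thesis using ae by simp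
        qed
      qed
      moreover have "{z \<in> space (A \<Otimes>\<^sub>M B). F z \<noteq> d} \<in> sets (A \<Otimes>\<^sub>M B)"
        using sets.sets_Collect_neg[OF F_sets[of d]] .
      ultimately show ?thesis by (intro AB.AE_pair_measure) auto
    qed
    then have "AE z in A \<Otimes>\<^sub>M B. \<forall>d\<in>D. F z \<noteq> d" using \<open>countable D\<close> by (simp add: AE_ball_countable)
    then have "AE z in A \<Otimes>\<^sub>M B. False"
      by (rule AE_mp) (use FD in \<open>auto intro!: AE_I2\<close>)
    then show False using AB.P.AE_False by simp
  qed
  then have "emeasure ?W E \<noteq> 0"
    using E_sets AE_not_in[of E ?W] by (auto simp: null_sets_def)
  then have pos: "measure ?W E > 0"
    by (simp add: BAB.P.emeasure_eq_measure zero_less_measure_iff)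
  \<comment> \<open>\<open>\<Phi> k\<close> sees only \<open>a\<close> and the value of
    \<open>F\<close>, so equality of the two values persists under the diagonal action on the three
    factors, which is mixing.\<close>
  have mix: "mixing K ?W (\<lambda>k. map_prod (S k) (map_prod (T k) (S k)))"
    by (intro mixing_pair T S assms AB.P.prob_space_axioms)
  have "AE z in ?W. z \<in> E"
  proof (rule mixing_ergodic[OF BAB.P.prob_space_axioms \<open>infinite K\<close> mix E_sets _ pos])
    fix k assume k: "k \<in> K"
    have Tk: "T k x \<in> space A" if "x \<in> space A" for x using mp_familyD(5)[of K A T k x] T k that by (simp add: mixing_def)
    have Sk: "S k x \<in> space B" if "x \<in> space B" for x using mp_familyD(5)[of K B S k x] S k that by (simp add: mixing_def)
    have "AE z in ?W. F (T k (fst (snd z)), S k (snd (snd z))) = \<Phi> k (fst (snd z)) (F (snd z))"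
      using AE_distrD[OF pr1, unfolded d1, OF equiv[OF k]] .
    moreover have "AE z in ?W. F (T k (fst (snd z)), S k (fst z)) = \<Phi> k (fst (snd z)) (F (?p z))"
      using AE_distrD[OF pr2, unfolded d2, OF equiv[OF k]] by simp
    ultimately show "AE z in ?W. z \<in> E \<longrightarrow> map_prod (S k) (map_prod (T k) (S k)) z \<in> E"
    proof eventually_elim
      case (elim z)
      then show ?case by (auto simp: E_def space_pair_measure Tk Sk map_prod_def split_beta)
    qed
  qed
  then have "AE b in B. AE z in A \<Otimes>\<^sub>M B. (b, z) \<in> E" by (rule BAB.AE_pair)
  then obtain b where b: "b \<in> space B" "AE z in A \<Otimes>\<^sub>M B. (b, z) \<in> E"
    by (rule B.AE_witness)
  from b(2) have "AE z in A \<Otimes>\<^sub>M B. F z = F (fst z, b)"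
    by (rule AE_mp) (auto intro!: AE_I2 simp: E_def)
  then show ?thesis using b(1) by blast
qed

section \<open>Random resampling of coordinates\<close>

lemma strict_action_bernoulli:
  fixes G (structure)
  assumes "group G" "prob_space N"
  shows "strict_action G (bernoulli_space G N) (bernoulli_shift G)"
proof -
  interpret group G by fact
  have "mp_family (carrier G) (PiM (carrier G) (\<lambda>_. N)) (bernoulli_shift G)"
    unfolding mp_family_def
  proof (intro ballI conjI)
    fix k assume k: "k \<in> carrier G"
    show "bernoulli_shift G k \<in> measurable (PiM (carrier G) (\<lambda>_. N)) (PiM (carrier G) (\<lambda>_. N))"
      unfolding bernoulli_shift_def[abs_def] using k
      by (intro measurable_restrict measurable_component_singleton) auto
    have "inj_on (\<lambda>h. inv k \<otimes> h) (carrier G)" "(\<lambda>h. inv k \<otimes> h) \<in> carrier G \<rightarrow> carrier G"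
      using k by (auto simp: inj_on_def)
    from distr_PiM_reindex[OF _ this, of "\<lambda>_. N"]
    show "distr (PiM (carrier G) (\<lambda>_. N)) (PiM (carrier G) (\<lambda>_. N)) (bernoulli_shift G k) = PiM (carrier G) (\<lambda>_. N)"
      using assms(2) by (simp add: bernoulli_shift_def[abs_def])
  qed
  moreover have "bernoulli_shift G \<one> x = x" if "x \<in> space (PiM (carrier G) (\<lambda>_. N))" for x
    using that by (auto simp: bernoulli_shift_def space_PiM PiE_iff extensional_def fun_eq_iff)
  moreover have "bernoulli_shift G (g \<otimes> h) x = bernoulli_shift G g (bernoulli_shift G h x)"
    if "g \<in> carrier G" "h \<in> carrier G" for g h x
    using that by (auto simp: bernoulli_shift_def fun_eq_iff inv_mult_group m_assoc)
  ultimately show ?thesis unfolding strict_action_def bernoulli_space_def mp_family_def by blast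
qed

lemma prob_space_bernoulli: "prob_space N \<Longrightarrow> prob_space (bernoulli_space G N)"
  unfolding bernoulli_space_def by (intro prob_space_PiM)

lemma strict_action_mp_family: "strict_action G M T \<Longrightarrow> mp_family (carrier G) M T"
  by (simp add: strict_action_def mp_family_def)

lemma strict_action_pair:
  assumes "prob_space M" "prob_space N" "strict_action G M T" "strict_action G N S"
  shows "strict_action G (M \<Otimes>\<^sub>M N) (\<lambda>k. map_prod (T k) (S k))"
  using mp_family_pair[OF assms(1,2) strict_action_mp_family[OF assms(3)] strict_action_mp_family[OF assms(4)]]
    assms(3,4)
  unfolding strict_action_def mp_family_def by (auto simp: space_pair_measure)

text \<open>The third component labels the coordinates. At time \<open>k\<close> those with label
  below \<open>k\<close> have been taken from the second point, so times \<open>0\<close> and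
  \<open>n\<close> give the two points themselves. Shifting the labels along with the points makes
  the whole path equivariant.\<close>

definition resample :: "('g, 'r) monoid_scheme \<Rightarrow> nat \<Rightarrow> (('g \<Rightarrow> 'y) \<times> ('g \<Rightarrow> 'y)) \<times> ('g \<Rightarrow> nat) \<Rightarrow> 'g \<Rightarrow> 'y" where
  "resample G k z = (\<lambda>g\<in>carrier G. if snd z g < k then snd (fst z) g else fst (fst z) g)"

abbreviation uniform :: "nat \<Rightarrow> nat measure" where "uniform n \<equiv> uniform_count_measure {..<n}"

definition resample_space :: "('g, 'r) monoid_scheme \<Rightarrow> 'y measure \<Rightarrow> nat \<Rightarrow> ((('g \<Rightarrow> 'y) \<times> ('g \<Rightarrow> 'y)) \<times> ('g \<Rightarrow> nat)) measure" where
  "resample_space G N n =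
     (bernoulli_space G N \<Otimes>\<^sub>M bernoulli_space G N) \<Otimes>\<^sub>M bernoulli_space G (uniform n)"

definition resample_action :: "('g, 'r) monoid_scheme \<Rightarrow> 'g \<Rightarrow> (('g \<Rightarrow> 'y) \<times> ('g \<Rightarrow> 'y)) \<times> ('g \<Rightarrow> nat) \<Rightarrow> (('g \<Rightarrow> 'y) \<times> ('g \<Rightarrow> 'y)) \<times> ('g \<Rightarrow> nat)" where
  "resample_action G g = map_prod (map_prod (bernoulli_shift G g) (bernoulli_shift G g)) (bernoulli_shift G g)"

lemma prob_space_uniform: "n > 0 \<Longrightarrow> prob_space (uniform n)"
  by (rule prob_space_uniform_count_measure) auto

lemma resample_equivariant:
  fixes G (structure)
  assumes "group G" "g \<in> carrier G"
  shows "resample G k (resample_action G g z) = bernoulli_shift G g (resample G k z)"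
proof -
  interpret group G by fact
  show ?thesis using assms(2)
    by (auto simp: resample_def resample_action_def bernoulli_shift_def fun_eq_iff)
qed

lemma resample_0:
  assumes "z \<in> space (resample_space G N n)" shows "resample G 0 z = fst (fst z)"
  using assms by (auto simp: resample_def resample_space_def bernoulli_space_def space_pair_measure space_PiM
      PiE_iff extensional_def fun_eq_iff)

lemma resample_last:
  assumes "z \<in> space (resample_space G N n)" shows "resample G n z = snd (fst z)"
  using assms by (auto simp: resample_def resample_space_def bernoulli_space_def space_pair_measure space_PiM
      PiE_iff extensional_def fun_eq_iff space_uniform_count_measure)

context
  fixes G :: "('g, 'r) monoid_scheme" and N :: "'y measure"
  assumes N: "prob_space N"
begin

abbreviation "Bern \<equiv> bernoulli_space G N"

lemma measurable_resample: "resample G k \<in> measurable (resample_space G N n) Bern"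
  unfolding resample_def[abs_def] resample_space_def bernoulli_space_def
proof (rule measurable_restrict)
  fix g assume g: "g \<in> carrier G"
  let ?P = "PiM (carrier G) (\<lambda>_. N)" and ?U = "PiM (carrier G) (\<lambda>_. uniform n)"
  have x: "(\<lambda>z. fst (fst z) g) \<in> measurable ((?P \<Otimes>\<^sub>M ?P) \<Otimes>\<^sub>M ?U) N"
    by (rule measurable_compose[OF _ measurable_component_singleton[OF g]]) measurable
  have y: "(\<lambda>z. snd (fst z) g) \<in> measurable ((?P \<Otimes>\<^sub>M ?P) \<Otimes>\<^sub>M ?U) N"
    by (rule measurable_compose[OF _ measurable_component_singleton[OF g]]) measurable
  have u: "(\<lambda>z. snd z g) \<in> measurable ((?P \<Otimes>\<^sub>M ?P) \<Otimes>\<^sub>M ?U) (uniform n)"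
    by (rule measurable_compose[OF _ measurable_component_singleton[OF g]]) measurable
  have "{z \<in> space ((?P \<Otimes>\<^sub>M ?P) \<Otimes>\<^sub>M ?U). snd z g < k}
      = (\<lambda>z. snd z g) -` ({..<k} \<inter> {..<n}) \<inter> space ((?P \<Otimes>\<^sub>M ?P) \<Otimes>\<^sub>M ?U)"
    using measurable_space[OF u] by (auto simp: space_uniform_count_measure)
  also have "\<dots> \<in> sets ((?P \<Otimes>\<^sub>M ?P) \<Otimes>\<^sub>M ?U)"
    by (rule measurable_sets[OF u]) (auto simp: sets_uniform_count_measure)
  finally show "(\<lambda>z. if snd z g < k then snd (fst z) g else fst (fst z) g) \<in> measurable ((?P \<Otimes>\<^sub>M ?P) \<Otimes>\<^sub>M ?U) N"
    by (intro measurable_If x y)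
qed

text \<open>With the labels frozen, every coordinate is read from exactly one of two independent
  points of the same law, so a cylinder pulls back to a product of two cylinders, one for each
  point.\<close>

lemma distr_resample_fixed:
  assumes u: "u \<in> space (bernoulli_space G (uniform n))"
  shows "distr (Bern \<Otimes>\<^sub>M Bern) Bern (\<lambda>w. resample G k (w, u)) = Bern"
proof -
  interpret N: prob_space N by (rule N)
  interpret P: product_prob_space "\<lambda>_. N" "carrier G" ..
  let ?P = "PiM (carrier G) (\<lambda>_. N)"
  have m: "(\<lambda>w. resample G k (w, u)) \<in> measurable (?P \<Otimes>\<^sub>M ?P) ?P"
    by (rule measurable_compose[OF _ measurable_resample[unfolded resample_space_def bernoulli_space_def, of k n]])
      (use u in \<open>simp add: bernoulli_space_def\<close>)
  have "distr (?P \<Otimes>\<^sub>M ?P) ?P (\<lambda>w. resample G k (w, u)) = ?P"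
  proof (rule P.PiM_eq)
    fix J F assume J: "finite J" "J \<subseteq> carrier G" and F: "\<And>j. j \<in> J \<Longrightarrow> F j \<in> sets N"
    define J1 J2 where "J1 = {j \<in> J. \<not> u j < k}" and "J2 = {j \<in> J. u j < k}"
    have J12: "finite J1" "J1 \<subseteq> carrier G" "finite J2" "J2 \<subseteq> carrier G" "J1 \<inter> J2 = {}" "J = J1 \<union> J2"
      "\<And>j. j \<in> J1 \<Longrightarrow> F j \<in> sets N" "\<And>j. j \<in> J2 \<Longrightarrow> F j \<in> sets N"
      using J F by (auto simp: J1_def J2_def)
    define B1 B2 where "B1 = {x \<in> space ?P. \<forall>j\<in>J1. x j \<in> F j}" and "B2 = {x \<in> space ?P. \<forall>j\<in>J2. x j \<in> F j}"
    have emb: "B1 = prod_emb (carrier G) (\<lambda>_. N) J1 (Pi\<^sub>E J1 F)" "B2 = prod_emb (carrier G) (\<lambda>_. N) J2 (Pi\<^sub>E J2 F)"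
      using J12 by (simp_all add: B1_def B2_def prod_emb_box)
    have B: "B1 \<in> sets ?P" "B2 \<in> sets ?P" unfolding emb using J12 by (auto intro!: sets_PiM_I)
    have "emeasure (distr (?P \<Otimes>\<^sub>M ?P) ?P (\<lambda>w. resample G k (w, u))) (prod_emb (carrier G) (\<lambda>_. N) J (Pi\<^sub>E J F))
        = emeasure (?P \<Otimes>\<^sub>M ?P) ((\<lambda>w. resample G k (w, u)) -` prod_emb (carrier G) (\<lambda>_. N) J (Pi\<^sub>E J F) \<inter> space (?P \<Otimes>\<^sub>M ?P))"
      using J F by (intro emeasure_distr m sets_PiM_I) auto
    also have "(\<lambda>w. resample G k (w, u)) -` prod_emb (carrier G) (\<lambda>_. N) J (Pi\<^sub>E J F) \<inter> space (?P \<Otimes>\<^sub>M ?P) = B1 \<times> B2"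
    proof -
      have "w \<in> (\<lambda>w. resample G k (w, u)) -` {x \<in> space ?P. \<forall>j\<in>J. x j \<in> F j} \<longleftrightarrow> w \<in> B1 \<times> B2"
        if w: "w \<in> space (?P \<Otimes>\<^sub>M ?P)" for w
      proof -
        have "resample G k (w, u) j = (if u j < k then snd w j else fst w j)" if "j \<in> J" for j
          using that J by (auto simp: resample_def)
        then have "(\<forall>j\<in>J. resample G k (w, u) j \<in> F j) \<longleftrightarrow> (\<forall>j\<in>J1. fst w j \<in> F j) \<and> (\<forall>j\<in>J2. snd w j \<in> F j)"
          by (auto simp: J1_def J2_def)
        then show ?thesis
          using w measurable_space[OF m w] by (auto simp: B1_def B2_def space_pair_measure)
      qed
      moreover have "B1 \<times> B2 \<subseteq> space (?P \<Otimes>\<^sub>M ?P)" by (auto simp: B1_def B2_def space_pair_measure)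
      ultimately show ?thesis unfolding prod_emb_box[OF J(2)] by blast
    qed
    also have "emeasure (?P \<Otimes>\<^sub>M ?P) (B1 \<times> B2) = emeasure ?P B1 * emeasure ?P B2"
      by (rule P.P.emeasure_pair_measure_Times[OF B])
    also have "\<dots> = (\<Prod>j\<in>J1. emeasure N (F j)) * (\<Prod>j\<in>J2. emeasure N (F j))"
      unfolding B1_def B2_def using J12 by (simp add: P.emeasure_PiM_Collect)
    also have "\<dots> = (\<Prod>j\<in>J. emeasure N (F j))"
      unfolding J12(6) using J12 by (intro prod.union_disjoint[symmetric]) auto
    finally show "emeasure (distr (?P \<Otimes>\<^sub>M ?P) ?P (\<lambda>w. resample G k (w, u))) (prod_emb (carrier G) (\<lambda>_. N) J (Pi\<^sub>E J F))
      = (\<Prod>j\<in>J. emeasure N (F j))" .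
  qed simp
  then show ?thesis by (simp add: bernoulli_space_def)
qed

lemma distr_resample:
  assumes "n > 0" shows "distr (resample_space G N n) Bern (resample G k) = Bern"
proof (rule measure_eqI)
  interpret Bern: prob_space Bern by (rule prob_space_bernoulli[OF N])
  let ?U = "bernoulli_space G (uniform n)"
  interpret U: prob_space ?U by (rule prob_space_bernoulli[OF prob_space_uniform[OF assms]])
  interpret XX: pair_prob_space Bern Bern ..
  interpret XXU: pair_prob_space "Bern \<Otimes>\<^sub>M Bern" ?U ..
  fix S assume "S \<in> sets (distr (resample_space G N n) Bern (resample G k))"
  then have S: "S \<in> sets Bern" by simp
  note m = measurable_resample[of k n]
  let ?S = "resample G k -` S \<inter> space (resample_space G N n)"
  have "emeasure (distr (resample_space G N n) Bern (resample G k)) S = emeasure (resample_space G N n) ?S"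
    by (rule emeasure_distr[OF m S])
  also have "\<dots> = (\<integral>\<^sup>+u. emeasure (Bern \<Otimes>\<^sub>M Bern) ((\<lambda>w. (w, u)) -` ?S) \<partial>?U)"
    using measurable_sets[OF m S] unfolding resample_space_def by (rule XXU.emeasure_pair_measure_alt2)
  also have "\<dots> = (\<integral>\<^sup>+u. emeasure Bern S \<partial>?U)"
  proof (rule nn_integral_cong)
    fix u assume u: "u \<in> space ?U"
    have mu: "(\<lambda>w. resample G k (w, u)) \<in> measurable (Bern \<Otimes>\<^sub>M Bern) Bern"
      by (rule measurable_compose[OF _ m[unfolded resample_space_def]]) (use u in simp)
    have "(\<lambda>w. (w, u)) -` ?S = (\<lambda>w. resample G k (w, u)) -` S \<inter> space (Bern \<Otimes>\<^sub>M Bern)"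
      using u by (auto simp: resample_space_def space_pair_measure)
    then show "emeasure (Bern \<Otimes>\<^sub>M Bern) ((\<lambda>w. (w, u)) -` ?S) = emeasure Bern S"
      using emeasure_distr[OF mu S] distr_resample_fixed[OF u, of k] by simp
  qed
  also have "\<dots> = emeasure Bern S" by (simp add: U.emeasure_space_1)
  finally show "emeasure (distr (resample_space G N n) Bern (resample G k)) S = emeasure Bern S" .
qed simp

lemma prob_space_resample: "n > 0 \<Longrightarrow> prob_space (resample_space G N n)"
proof -
  assume n: "n > 0"
  interpret Bern: prob_space Bern by (rule prob_space_bernoulli[OF N])
  let ?U = "bernoulli_space G (uniform n)"
  interpret U: prob_space ?U by (rule prob_space_bernoulli[OF prob_space_uniform[OF n]])
  interpret XX: pair_prob_space Bern Bern ..
  interpret XXU: pair_prob_space "Bern \<Otimes>\<^sub>M Bern" ?U ..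
  show ?thesis unfolding resample_space_def by (rule XXU.P.prob_space_axioms)
qed

lemma resample_sets:
  assumes "A \<in> sets Bern"
  shows "{z \<in> space (resample_space G N n). resample G k z \<in> A} \<in> sets (resample_space G N n)"
proof -
  have "{z \<in> space (resample_space G N n). resample G k z \<in> A} = resample G k -` A \<inter> space (resample_space G N n)" by auto
  then show ?thesis using measurable_sets[OF measurable_resample assms] by simp
qed

lemma measure_resample:
  assumes "A \<in> sets Bern" "n > 0"
  shows "measure (resample_space G N n) {z \<in> space (resample_space G N n). resample G k z \<in> A} = measure Bern A"
proof -
  have "{z \<in> space (resample_space G N n). resample G k z \<in> A} = resample G k -` A \<inter> space (resample_space G N n)" by auto
  then show ?thesis
    using measure_distr[OF measurable_resample[of k n] assms(1)] distr_resample[OF assms(2)] by simp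
qed

section \<open>Smallness of one step of the path\<close>

definition jump :: "nat \<Rightarrow> nat \<Rightarrow> ('g \<Rightarrow> 'y) set \<Rightarrow> ((('g \<Rightarrow> 'y) \<times> ('g \<Rightarrow> 'y)) \<times> ('g \<Rightarrow> nat)) set" where
  "jump n k A = {z \<in> space (resample_space G N n). (resample G k z \<in> A) \<noteq> (resample G (Suc k) z \<in> A)}"

lemma jump_sets: "A \<in> sets Bern \<Longrightarrow> jump n k A \<in> sets (resample_space G N n)"
proof -
  assume A: "A \<in> sets Bern"
  have "jump n k A = ({z \<in> space (resample_space G N n). resample G k z \<in> A} - {z \<in> space (resample_space G N n). resample G (Suc k) z \<in> A})
      \<union> ({z \<in> space (resample_space G N n). resample G (Suc k) z \<in> A} - {z \<in> space (resample_space G N n). resample G k z \<in> A})"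
    by (auto simp: jump_def)
  then show ?thesis using resample_sets[OF A] by auto
qed

lemma measure_label:
  assumes "n > 0" "k < n" "g \<in> carrier G"
  shows "{z \<in> space (resample_space G N n). snd z g = k} \<in> sets (resample_space G N n)"
    "measure (resample_space G N n) {z \<in> space (resample_space G N n). snd z g = k} = 1 / n"
proof -
  let ?P = "PiM (carrier G) (\<lambda>_. uniform n)"
  interpret u: prob_space "uniform n" by (rule prob_space_uniform[OF assms(1)])
  interpret P: product_prob_space "\<lambda>_. uniform n" "carrier G" ..
  interpret Bern: prob_space Bern by (rule prob_space_bernoulli[OF N])
  interpret XX: pair_prob_space Bern Bern ..
  let ?B = "{x \<in> space ?P. x g \<in> {k}}"
  have k: "{k} \<in> sets (uniform n)" using assms by (simp add: sets_uniform_count_measure)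
  have B: "?B \<in> sets ?P" by (rule sets_Collect_single'[OF assms(3)]) (use k in \<open>auto simp: space_uniform_count_measure assms sets_uniform_count_measure\<close>)
  have "emeasure ?P ?B = emeasure (uniform n) {k}" by (rule P.emeasure_PiM_Collect_single[OF assms(3) k])
  also have "\<dots> = ennreal (1 / n)" using assms by (subst emeasure_uniform_count_measure) auto
  finally have eB: "measure ?P ?B = 1 / n" by (simp add: measure_def)
  have eq: "{z \<in> space (resample_space G N n). snd z g = k} = snd -` ?B \<inter> space (resample_space G N n)"
    by (auto simp: resample_space_def space_pair_measure bernoulli_space_def)
  have m: "snd \<in> measurable (resample_space G N n) ?P"
    unfolding resample_space_def bernoulli_space_def by measurable
  show "{z \<in> space (resample_space G N n). snd z g = k} \<in> sets (resample_space G N n)"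
    unfolding eq by (rule measurable_sets[OF m B])
  have "distr (resample_space G N n) ?P snd = ?P"
    unfolding resample_space_def bernoulli_space_def[of G "uniform n"]
    by (rule distr_pair_snd[OF XX.P.prob_space_axioms P.P.sigma_finite_measure_axioms])
  then show "measure (resample_space G N n) {z \<in> space (resample_space G N n). snd z g = k} = 1 / n"
    unfolding eq using measure_distr[OF m B] eB by simp
qed

lemma tail_small:
  assumes "range A \<subseteq> sets Bern" "e > 0"
  obtains m :: nat where "measure Bern ((\<Union>i. A i) - (\<Union>i<m. A i)) < e"
proof -
  interpret Bern: prob_space Bern by (rule prob_space_bernoulli[OF N])
  have A: "A i \<in> sets Bern" for i using assms by auto
  have "(\<lambda>m. measure Bern (\<Union>i<m. A i)) \<longlonglongrightarrow> measure Bern (\<Union>m. \<Union>i<m. A i)"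
    using A by (intro Bern.finite_Lim_measure_incseq) (auto simp: incseq_def intro: less_le_trans)
  moreover have "(\<Union>m. \<Union>i<m. A i) = (\<Union>i. A i)" by auto
  ultimately have "eventually (\<lambda>m. measure Bern (\<Union>i. A i) - e < measure Bern (\<Union>i<m. A i)) sequentially"
    using assms(2) by (intro order_tendstoD) auto
  then obtain m where m: "measure Bern (\<Union>i. A i) - e < measure Bern (\<Union>i<m. A i)"
    by (auto simp: eventually_sequentially)
  have "measure Bern ((\<Union>i. A i) - (\<Union>i<m. A i)) = measure Bern (\<Union>i. A i) - measure Bern (\<Union>i<m. A i)"
    using A by (intro Bern.finite_measure_Diff) auto
  then show ?thesis using m by (intro that[of m]) linarith
qed

lemma jump_sum_small:
  assumes "\<And>i::nat. \<And>e. e > 0 \<Longrightarrow> \<exists>n0>0. \<forall>n\<ge>n0. \<forall>k<n. measure (resample_space G N n) (jump n k (A i)) < e"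
    and "range A \<subseteq> sets Bern" and e: "e > 0"
  shows "\<exists>n0>0. \<forall>n\<ge>n0. \<forall>k<n. measure (resample_space G N n) (\<Union>i<m. jump n k (A i)) < e"
proof -
  have A: "A i \<in> sets Bern" for i using assms by auto
  have "\<exists>n0>0. \<forall>n\<ge>n0. \<forall>k<n. measure (resample_space G N n) (jump n k (A i)) < e / (m + 1)" for i
    using assms(1)[of "e / (m + 1)" i] e by simp
  then obtain n0 where n0: "\<And>i. n0 i > 0"
    "\<And>i n k. n \<ge> n0 i \<Longrightarrow> k < n \<Longrightarrow> measure (resample_space G N n) (jump n k (A i)) < e / (m + 1)" by metis
  have "measure (resample_space G N n) (\<Union>i<m. jump n k (A i)) < e" if n: "n \<ge> 1 + (\<Sum>i<m. n0 i)" and k: "k < n" for n k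
  proof -
    interpret Z: prob_space "resample_space G N n" using n by (intro prob_space_resample) auto
    have "measure (resample_space G N n) (\<Union>i<m. jump n k (A i)) \<le> (\<Sum>i<m. measure (resample_space G N n) (jump n k (A i)))"
      using A jump_sets by (intro Z.finite_measure_subadditive_finite) auto
    also have "\<dots> \<le> (\<Sum>i<m. e / (m + 1))"
    proof (rule sum_mono)
      fix i assume "i \<in> {..<m}"
      then have "n0 i \<le> (\<Sum>i<m. n0 i)" by (intro member_le_sum) auto
      then show "measure (resample_space G N n) (jump n k (A i)) \<le> e / (m + 1)"
        using n0(2)[of i n k] n k by simp
    qed
    also have "\<dots> < e" using e by (simp add: field_simps)
    finally show ?thesis .
  qed
  then show ?thesis by (intro exI[of _ "1 + (\<Sum>i<m. n0 i)"]) auto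
qed

text \<open>Induction on the generation of the \<sigma>-algebra. A one-coordinate cylinder changes
  only if its label is \<open>k\<close>, which has probability \<open>1 / n\<close>. A set and its
  complement jump together. A countable union is cut to finitely many terms, and the remainder is
  controlled at both times because \<open>resample G k\<close> preserves the law. The bound is
  uniform in \<open>k\<close> because all the steps of one path share the same
  \<open>n\<close>.\<close>

lemma jump_small:
  assumes "A \<in> sets Bern" "e > 0"
  shows "\<exists>n0>0. \<forall>n\<ge>n0. \<forall>k<n. measure (resample_space G N n) (jump n k A) < e"
proof -
  let ?E = "{{f \<in> (\<Pi>\<^sub>E i\<in>carrier G. space N). f i \<in> B} | i B. i \<in> carrier G \<and> B \<in> sets N}"
  have sX: "sets Bern = sigma_sets (\<Pi>\<^sub>E i\<in>carrier G. space N) ?E"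
    unfolding bernoulli_space_def sets_PiM_single ..
  have spX: "space Bern = (\<Pi>\<^sub>E i\<in>carrier G. space N)" by (simp add: bernoulli_space_def space_PiM)
  show ?thesis using assms unfolding sX
  proof (induction arbitrary: e rule: sigma_sets.induct)
    case (Basic A)
    then obtain i B where A: "A = {f \<in> space Bern. f i \<in> B}" "i \<in> carrier G" "B \<in> sets N" unfolding spX by blast
    obtain n0 where n0: "inverse (real (Suc n0)) < e" using reals_Archimedean[OF Basic(2)] by blast
    have "measure (resample_space G N n) (jump n k A) < e" if n: "n \<ge> Suc n0" and k: "k < n" for n k
    proof -
      interpret Z: prob_space "resample_space G N n" using n by (intro prob_space_resample) auto
      have r: "resample G k z \<in> space Bern" if "z \<in> space (resample_space G N n)" for k z
        using measurable_space[OF measurable_resample that] .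
      have ri: "resample G k z i = (if snd z i < k then snd (fst z) i else fst (fst z) i)" for k z
        using A(2) by (simp add: resample_def)
      have "jump n k A \<subseteq> {z \<in> space (resample_space G N n). snd z i = k}"
        by (auto simp: jump_def A(1) r ri less_Suc_eq split: if_splits)
      then have "measure (resample_space G N n) (jump n k A)
          \<le> measure (resample_space G N n) {z \<in> space (resample_space G N n). snd z i = k}"
        using n k by (intro Z.finite_measure_mono measure_label(1) A(2)) auto
      also have "\<dots> = 1 / n" using n k by (intro measure_label(2) A(2)) auto
      also have "\<dots> \<le> inverse (Suc n0)" using n by (simp add: field_simps)
      finally show ?thesis using n0 by simp
    qed
    then show ?case by blast
  next
    case Empty
    then show ?case by (auto simp: jump_def)
  next
    case (Compl A)
    have "jump n k ((\<Pi>\<^sub>E i\<in>carrier G. space N) - A) = jump n k A" for n k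
      using measurable_space[OF measurable_resample] unfolding jump_def spX[symmetric] by blast
    then show ?case using Compl by simp
  next
    case (Union A)
    have A: "range A \<subseteq> sets Bern" "\<And>i. A i \<in> sets Bern" using Union(1) unfolding sX by auto
    \<comment> \<open>\<open>e / 4\<close> for the remainder at each of the two times, and
      \<open>e / 2\<close> for the finite union.\<close>
    obtain m where m: "measure Bern ((\<Union>i. A i) - (\<Union>i<m. A i)) < e / 4"
      using tail_small[OF A(1), of "e / 4"] Union(3) by auto
    define R where "R = (\<Union>i. A i) - (\<Union>i<m. A i)"
    have R: "R \<in> sets Bern" using A by (auto simp: R_def)
    obtain n0 where n0: "n0 > 0" "\<And>n k. n \<ge> n0 \<Longrightarrow> k < n \<Longrightarrow> measure (resample_space G N n) (\<Union>i<m. jump n k (A i)) < e / 2"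
      using jump_sum_small[OF Union(2) A(1), of "e / 2" m] Union(3) by auto
    have "measure (resample_space G N n) (jump n k (\<Union>i. A i)) < e" if n: "n \<ge> n0" and k: "k < n" for n k
    proof -
      have n_pos: "n > 0" using n n0 by simp
      interpret Z: prob_space "resample_space G N n" by (rule prob_space_resample[OF n_pos])
      let ?r = "\<lambda>k. {z \<in> space (resample_space G N n). resample G k z \<in> R}"
      let ?J = "\<Union>i<m. jump n k (A i)"
      have J: "?J \<in> sets (resample_space G N n)" using A jump_sets by auto
      have "jump n k (\<Union>i. A i) \<subseteq> ?J \<union> (?r k \<union> ?r (Suc k))"
        by (auto simp: jump_def R_def)
      then have "measure (resample_space G N n) (jump n k (\<Union>i. A i)) \<le> measure (resample_space G N n) (?J \<union> (?r k \<union> ?r (Suc k)))"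
        using J resample_sets[OF R] by (intro Z.finite_measure_mono) auto
      also have "\<dots> \<le> measure (resample_space G N n) ?J + measure (resample_space G N n) (?r k \<union> ?r (Suc k))"
        using J resample_sets[OF R] by (intro measure_Un_le) auto
      also have "measure (resample_space G N n) (?r k \<union> ?r (Suc k)) \<le> measure (resample_space G N n) (?r k) + measure (resample_space G N n) (?r (Suc k))"
        using resample_sets[OF R] by (intro measure_Un_le) auto
      also have "\<dots> = measure Bern R + measure Bern R" using measure_resample[OF R n_pos] by simp
      finally show ?thesis using n0(2)[OF n k] m unfolding R_def[symmetric] by simp
    qed
    then show ?case using n0(1) by blast
  qed
qed

text \<open>A change of value is a jump of the level set that contains the earlier point. Finitely
  many level sets carry most of the mass, and the remainder has to be counted at time
  \<open>k\<close> only.\<close>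

lemma jump_small_countable:
  fixes f :: "('g \<Rightarrow> 'y) \<Rightarrow> 'd"
  assumes f: "f \<in> measurable Bern (count_space D)" and "countable D" and e: "e > 0"
  shows "\<exists>n0>0. \<forall>n\<ge>n0. \<forall>k<n.
    measure (resample_space G N n) {z \<in> space (resample_space G N n). f (resample G k z) \<noteq> f (resample G (Suc k) z)} < e"
proof -
  interpret Bern: prob_space Bern by (rule prob_space_bernoulli[OF N])
  obtain x where "x \<in> space Bern" using Bern.not_empty by blast
  then have D: "D \<noteq> {}" using measurable_space[OF f] by auto
  define A where "A i = f -` {from_nat_into D i} \<inter> space Bern" for i
  have A: "range A \<subseteq> sets Bern" "\<And>i. A i \<in> sets Bern"
    unfolding A_def using measurable_sets[OF f] from_nat_into[OF D] by auto
  have cover: "(\<Union>i. A i) = space Bern"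
  proof
    show "space Bern \<subseteq> (\<Union>i. A i)"
    proof
      fix x assume x: "x \<in> space Bern"
      then have "f x \<in> D" using measurable_space[OF f] by auto
      then obtain i where "f x = from_nat_into D i" using from_nat_into_surj[OF \<open>countable D\<close>] by metis
      then show "x \<in> (\<Union>i. A i)" using x by (auto simp: A_def)
    qed
  qed (auto simp: A_def)
  obtain m where m: "measure Bern ((\<Union>i. A i) - (\<Union>i<m. A i)) < e / 2"
    using tail_small[OF A(1), of "e / 2"] e by auto
  define R where "R = (\<Union>i. A i) - (\<Union>i<m. A i)"
  have R: "R \<in> sets Bern" using A by (auto simp: R_def)
  obtain n0 where n0: "n0 > 0" "\<And>n k. n \<ge> n0 \<Longrightarrow> k < n \<Longrightarrow> measure (resample_space G N n) (\<Union>i<m. jump n k (A i)) < e / 2"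
    using jump_sum_small[of A "e / 2" m] jump_small A e by (metis half_gt_zero)
  have "measure (resample_space G N n) {z \<in> space (resample_space G N n). f (resample G k z) \<noteq> f (resample G (Suc k) z)} < e"
    if n: "n \<ge> n0" and k: "k < n" for n k
  proof -
    have n_pos: "n > 0" using n n0 by simp
    interpret Z: prob_space "resample_space G N n" by (rule prob_space_resample[OF n_pos])
    let ?r = "{z \<in> space (resample_space G N n). resample G k z \<in> R}"
    let ?J = "\<Union>i<m. jump n k (A i)"
    have J: "?J \<in> sets (resample_space G N n)" using A jump_sets by auto
    have "{z \<in> space (resample_space G N n). f (resample G k z) \<noteq> f (resample G (Suc k) z)} \<subseteq> ?J \<union> ?r"
    proof
      fix z assume z: "z \<in> {z \<in> space (resample_space G N n). f (resample G k z) \<noteq> f (resample G (Suc k) z)}"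
      have r: "resample G k z \<in> space Bern" "resample G (Suc k) z \<in> space Bern"
        using z by (auto intro!: measurable_space[OF measurable_resample])
      show "z \<in> ?J \<union> ?r"
      proof (cases "resample G k z \<in> (\<Union>i<m. A i)")
        case True
        then obtain i where i: "i < m" "resample G k z \<in> A i" by auto
        then have "resample G (Suc k) z \<notin> A i" using z by (auto simp: A_def)
        then show ?thesis using i z by (auto simp: jump_def)
      next
        case False
        then show ?thesis using z r cover by (auto simp: R_def)
      qed
    qed
    then have "measure (resample_space G N n) {z \<in> space (resample_space G N n). f (resample G k z) \<noteq> f (resample G (Suc k) z)}
        \<le> measure (resample_space G N n) (?J \<union> ?r)"
      using J resample_sets[OF R] by (intro Z.finite_measure_mono) auto
    also have "\<dots> \<le> measure (resample_space G N n) ?J + measure (resample_space G N n) ?r"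
      using J resample_sets[OF R] by (intro measure_Un_le) auto
    finally show ?thesis using n0(2)[OF n k] m measure_resample[OF R n_pos] unfolding R_def[symmetric] by simp
  qed
  then show ?thesis using n0(1) by blast
qed

end

section \<open>Cocycle superrigidity\<close>

lemma mixing_resample:
  assumes "group G" "infinite (carrier G)" "prob_space N" "n > 0"
  shows "mixing (carrier G) (resample_space G N n) (resample_action G)"
proof -
  interpret X: prob_space "bernoulli_space G N" by (rule prob_space_bernoulli[OF assms(3)])
  interpret U: prob_space "bernoulli_space G (uniform n)"
    by (rule prob_space_bernoulli[OF prob_space_uniform[OF assms(4)]])
  interpret XX: pair_prob_space "bernoulli_space G N" "bernoulli_space G N" ..
  show ?thesis
    unfolding resample_space_def resample_action_def[abs_def]
    by (intro mixing_pair mixing_bernoulli_shift assms prob_space_uniform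
        X.prob_space_axioms U.prob_space_axioms XX.P.prob_space_axioms subset_refl)
qed

lemma strict_action_resample:
  assumes "group G" "prob_space N" "n > 0"
  shows "strict_action G (resample_space G N n) (resample_action G)"
proof -
  interpret X: prob_space "bernoulli_space G N" by (rule prob_space_bernoulli[OF assms(2)])
  interpret U: prob_space "bernoulli_space G (uniform n)"
    by (rule prob_space_bernoulli[OF prob_space_uniform[OF assms(3)]])
  interpret XX: pair_prob_space "bernoulli_space G N" "bernoulli_space G N" ..
  show ?thesis
    unfolding resample_space_def resample_action_def[abs_def]
    by (intro strict_action_pair strict_action_bernoulli assms prob_space_uniform
        X.prob_space_axioms U.prob_space_axioms XX.P.prob_space_axioms)
qed

text \<open>Products of consecutive transfer functions are transfer functions between the first and
  the last cocycle, as the intermediate cocycles cancel. One \<open>n\<close> serves all elements of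
  the Kazhdan set because that set is finite.\<close>

lemma cohomologous_endpoints:
  fixes G :: "('g, 'r) monoid_scheme" and \<Gamma> :: "('h, 's) monoid_scheme" and N :: "'y measure"
  assumes "group G" "countable (carrier G)" "infinite (carrier G)" "property_T G" "prob_space N"
    and "group \<Gamma>" "countable (carrier \<Gamma>)"
    and w: "strict_cocycle G \<Gamma> (bernoulli_space G N) (bernoulli_shift G) w"
  shows "\<exists>n>0. \<exists>f \<in> measurable (resample_space G N n) (count_space (carrier \<Gamma>)).
    \<forall>g\<in>carrier G. AE z in resample_space G N n. f (resample_action G g z)
      = w g (fst (fst z)) \<otimes>\<^bsub>\<Gamma>\<^esub> f z \<otimes>\<^bsub>\<Gamma>\<^esub> inv\<^bsub>\<Gamma>\<^esub> w g (snd (fst z))"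
proof -
  interpret G: group G by fact
  interpret \<Gamma>: group \<Gamma> by fact
  obtain F \<epsilon> where KP: "kazhdan_pair G F \<epsilon>" using assms(4) by (auto simp: property_T_iff)
  then have F: "finite F" "F \<subseteq> carrier G" and \<epsilon>: "0 < \<epsilon>" by (auto simp: kazhdan_pair_def)
  have w_meas: "w g \<in> measurable (bernoulli_space G N) (count_space (carrier \<Gamma>))" if "g \<in> carrier G" for g
    using w that by (auto simp: strict_cocycle_def)
  define D where "D n k g = measure (resample_space G N n)
      {z \<in> space (resample_space G N n). w (inv\<^bsub>G\<^esub> g) (resample G k z) \<noteq> w (inv\<^bsub>G\<^esub> g) (resample G (Suc k) z)}" for n k g
  have "\<exists>n0>0. \<forall>n\<ge>n0. \<forall>k<n. D n k g < \<epsilon>\<^sup>2 / 32" if "g \<in> F" for g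
    unfolding D_def using that F \<epsilon> by (intro jump_small_countable[OF assms(5) w_meas assms(7)]) auto
  then have "\<forall>g\<in>F. \<exists>n0. \<forall>n\<ge>n0. \<forall>k<n. D n k g < \<epsilon>\<^sup>2 / 32" by blast
  from bchoice[OF this] obtain n0 where "\<forall>g\<in>F. \<forall>n\<ge>n0 g. \<forall>k<n. D n k g < \<epsilon>\<^sup>2 / 32" by blast
  then have n0: "D n k g < \<epsilon>\<^sup>2 / 32" if "g \<in> F" "n \<ge> n0 g" "k < n" for g n k using that by blast
  define n where "n = 1 + (\<Sum>g\<in>F. n0 g)"
  have n_pos: "n > 0" by (simp add: n_def)
  have n: "n \<ge> n0 g" if "g \<in> F" for g
    using member_le_sum[of g F n0] that F by (simp add: n_def)
  let ?Z = "resample_space G N n"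
  have act: "strict_action G ?Z (resample_action G)" by (rule strict_action_resample) fact+
  define c where "c k g z = w g (resample G k z)" for k g z
  have c: "strict_cocycle G \<Gamma> ?Z (resample_action G) (c k)" for k
    unfolding strict_cocycle_def c_def
  proof (intro conjI ballI)
    note m = measurable_resample[OF assms(5), of G k n]
    show "(\<lambda>z. w g (resample G k z)) \<in> measurable ?Z (count_space (carrier \<Gamma>))" if "g \<in> carrier G" for g
      by (rule measurable_compose[OF m w_meas[OF that]])
    fix g h z assume gh: "g \<in> carrier G" "h \<in> carrier G" and z: "z \<in> space ?Z"
    show "w (g \<otimes>\<^bsub>G\<^esub> h) (resample G k z) = w g (resample G k (resample_action G h z)) \<otimes>\<^bsub>\<Gamma>\<^esub> w h (resample G k z)"
      using w gh measurable_space[OF m z] by (simp add: resample_equivariant[OF assms(1) gh(2)] strict_cocycle_def)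
  qed
  have step: "\<exists>f \<in> measurable ?Z (count_space (carrier \<Gamma>)). \<forall>g\<in>carrier G. AE z in ?Z.
      f (resample_action G g z) = c k g z \<otimes>\<^bsub>\<Gamma>\<^esub> f z \<otimes>\<^bsub>\<Gamma>\<^esub> inv\<^bsub>\<Gamma>\<^esub> c (Suc k) g z" if "k < n" for k
    using n0[OF _ n that]
    by (intro cohomologous_if_close[OF assms(1-3) KP assms(6,7) prob_space_resample[OF assms(5) n_pos] act _ c c]
        mixing_resample assms n_pos) (auto simp: c_def D_def)
  have "\<exists>f \<in> measurable ?Z (count_space (carrier \<Gamma>)). \<forall>g\<in>carrier G. AE z in ?Z.
      f (resample_action G g z) = c 0 g z \<otimes>\<^bsub>\<Gamma>\<^esub> f z \<otimes>\<^bsub>\<Gamma>\<^esub> inv\<^bsub>\<Gamma>\<^esub> c k g z" if "k \<le> n" for k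
    using that
  proof (induction k)
    case 0
    show ?case
      by (rule bexI[of _ "\<lambda>_. \<one>\<^bsub>\<Gamma>\<^esub>"]) (use strict_cocycle_closed[OF c] in \<open>auto intro!: AE_I2\<close>)
  next
    case (Suc k)
    then have k: "k \<le> n" "k < n" by auto
    from Suc.IH[OF k(1)] obtain f where f: "f \<in> measurable ?Z (count_space (carrier \<Gamma>))"
      and f_eq: "\<forall>g\<in>carrier G. AE z in ?Z. f (resample_action G g z) = c 0 g z \<otimes>\<^bsub>\<Gamma>\<^esub> f z \<otimes>\<^bsub>\<Gamma>\<^esub> inv\<^bsub>\<Gamma>\<^esub> c k g z"
      by (elim bexE)
    from step[OF k(2)] obtain f' where f': "f' \<in> measurable ?Z (count_space (carrier \<Gamma>))"
      and f'_eq: "\<forall>g\<in>carrier G. AE z in ?Z. f' (resample_action G g z) = c k g z \<otimes>\<^bsub>\<Gamma>\<^esub> f' z \<otimes>\<^bsub>\<Gamma>\<^esub> inv\<^bsub>\<Gamma>\<^esub> c (Suc k) g z"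
      by (elim bexE)
    show ?case
    proof (intro bexI[of _ "\<lambda>z. f z \<otimes>\<^bsub>\<Gamma>\<^esub> f' z"] ballI)
      show "(\<lambda>z. f z \<otimes>\<^bsub>\<Gamma>\<^esub> f' z) \<in> measurable ?Z (count_space (carrier \<Gamma>))"
        by (rule measurable_group_mult[OF assms(6,7) f f'])
      fix g assume g: "g \<in> carrier G"
      from bspec[OF f_eq g] bspec[OF f'_eq g] AE_space
      show "AE z in ?Z. f (resample_action G g z) \<otimes>\<^bsub>\<Gamma>\<^esub> f' (resample_action G g z)
          = c 0 g z \<otimes>\<^bsub>\<Gamma>\<^esub> (f z \<otimes>\<^bsub>\<Gamma>\<^esub> f' z) \<otimes>\<^bsub>\<Gamma>\<^esub> inv\<^bsub>\<Gamma>\<^esub> c (Suc k) g z"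
      proof eventually_elim
        case (elim z)
        have "f z \<in> carrier \<Gamma>" "f' z \<in> carrier \<Gamma>"
          using measurable_space[OF f elim(3)] measurable_space[OF f' elim(3)] by auto
        then show ?case
          using strict_cocycle_closed[OF c g elim(3)] by (simp add: elim(1,2) \<Gamma>.m_assoc \<Gamma>.cancel_left)
      qed
    qed
  qed
  from this[OF order_refl] obtain f where f: "f \<in> measurable ?Z (count_space (carrier \<Gamma>))"
    and f_eq: "\<forall>g\<in>carrier G. AE z in ?Z. f (resample_action G g z) = c 0 g z \<otimes>\<^bsub>\<Gamma>\<^esub> f z \<otimes>\<^bsub>\<Gamma>\<^esub> inv\<^bsub>\<Gamma>\<^esub> c n g z"
    by (elim bexE)
  have "AE z in ?Z. f (resample_action G g z) = w g (fst (fst z)) \<otimes>\<^bsub>\<Gamma>\<^esub> f z \<otimes>\<^bsub>\<Gamma>\<^esub> inv\<^bsub>\<Gamma>\<^esub> w g (snd (fst z))"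
    if g: "g \<in> carrier G" for g
    using bspec[OF f_eq g] by (rule AE_imp) (simp add: c_def resample_0 resample_last)
  then show ?thesis using f n_pos by (intro exI[of _ n] conjI bexI[of _ f] ballI)
qed

text \<open>
  A transfer function between \<open>w(g, x)\<close> and \<open>w(g, y)\<close> on \<open>X \<times> X\<close> splits as \<open>f(x, y) = a(x) \<phi>(y)\<close>, as
  \<open>f(x, y) f(x', y)\<inverse>\<close> cannot depend on \<open>y\<close>. Then \<open>a(gx)\<inverse> w(g, x) a(x) = \<phi>(gy) w(g, y) \<phi>(y)\<inverse>\<close> depends
  neither on \<open>x\<close> nor on \<open>y\<close>.
\<close>

theorem cocycle_superrigidity:
  fixes G :: "('g, 'r) monoid_scheme" and \<Gamma> :: "('h, 's) monoid_scheme" and N :: "'y measure"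
  assumes "group G" "countable (carrier G)" "infinite (carrier G)" "property_T G" "prob_space N"
    and "group \<Gamma>" "countable (carrier \<Gamma>)"
    and w: "strict_cocycle G \<Gamma> (bernoulli_space G N) (bernoulli_shift G) w"
  shows "\<exists>\<delta>\<in>hom G \<Gamma>. \<exists>a \<in> measurable (bernoulli_space G N) (count_space (carrier \<Gamma>)).
    \<forall>g\<in>carrier G. AE x in bernoulli_space G N.
      w g x = a (bernoulli_shift G g x) \<otimes>\<^bsub>\<Gamma>\<^esub> \<delta> g \<otimes>\<^bsub>\<Gamma>\<^esub> inv\<^bsub>\<Gamma>\<^esub> a x"
proof -
  interpret G: group G by fact
  interpret \<Gamma>: group \<Gamma> by fact
  let ?X = "bernoulli_space G N" and ?\<sigma> = "bernoulli_shift G" and ?C = "count_space (carrier \<Gamma>)"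
  interpret X: prob_space ?X by (rule prob_space_bernoulli[OF assms(5)])
  interpret XX: pair_prob_space ?X ?X ..
  interpret XXX: pair_prob_space "?X \<Otimes>\<^sub>M ?X" ?X ..
  obtain n f where n_pos: "n > 0" and f: "f \<in> measurable (resample_space G N n) ?C"
    and f_eq: "\<And>g. g \<in> carrier G \<Longrightarrow> AE z in resample_space G N n. f (resample_action G g z)
      = w g (fst (fst z)) \<otimes>\<^bsub>\<Gamma>\<^esub> f z \<otimes>\<^bsub>\<Gamma>\<^esub> inv\<^bsub>\<Gamma>\<^esub> w g (snd (fst z))"
    using cohomologous_endpoints[OF assms] by (elim exE conjE bexE) (rule that, assumption+, erule bspec)
  let ?U = "bernoulli_space G (uniform n)"
  interpret U: prob_space ?U by (rule prob_space_bernoulli[OF prob_space_uniform[OF n_pos]])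
  interpret XXU: pair_prob_space "?X \<Otimes>\<^sub>M ?X" ?U ..
  have mX: "mixing (carrier G) ?X ?\<sigma>" by (rule mixing_bernoulli_shift) (use assms in auto)
  have mXX: "mixing (carrier G) (?X \<Otimes>\<^sub>M ?X) (\<lambda>k. map_prod (?\<sigma> k) (?\<sigma> k))"
    by (rule mixing_pair[OF X.prob_space_axioms X.prob_space_axioms assms(3) mX mX])
  have mU: "mixing (carrier G) ?U ?\<sigma>"
    by (rule mixing_bernoulli_shift) (use assms n_pos prob_space_uniform in auto)
  have act: "strict_action G ?X ?\<sigma>" by (rule strict_action_bernoulli) fact+
  have wc: "w g x \<in> carrier \<Gamma>" if "g \<in> carrier G" "x \<in> space ?X" for g x
    using strict_cocycle_closed[OF w that] .
  have AE_shift: "AE x in ?X. P (?\<sigma> g x)" if "g \<in> carrier G" "AE x in ?X. P x" for g P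
    using mp_family_AE[OF strict_action_mp_family[OF act] that] .

  \<comment> \<open>The rule by which \<open>f\<close> transforms involves the two endpoints and not
    the labels, so the labels can be frozen at some \<open>u0\<close>.\<close>
  have "\<exists>u0\<in>space ?U. AE z in (?X \<Otimes>\<^sub>M ?X) \<Otimes>\<^sub>M ?U. f z = f (fst z, u0)"
  proof (rule independent_of_mixing_coordinate[OF XX.P.prob_space_axioms U.prob_space_axioms assms(3) assms(7) mXX mU])
    show "f \<in> measurable ((?X \<Otimes>\<^sub>M ?X) \<Otimes>\<^sub>M ?U) ?C" using f by (simp add: resample_space_def)
    fix g assume g: "g \<in> carrier G"
    have eq: "(map_prod (?\<sigma> g) (?\<sigma> g) (fst z), ?\<sigma> g (snd z)) = resample_action G g z" for z
      by (simp add: resample_action_def map_prod_def split_beta)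
    from f_eq[OF g, unfolded resample_space_def] show "AE z in (?X \<Otimes>\<^sub>M ?X) \<Otimes>\<^sub>M ?U. f (map_prod (?\<sigma> g) (?\<sigma> g) (fst z), ?\<sigma> g (snd z))
        = (\<lambda>g v d. w g (fst v) \<otimes>\<^bsub>\<Gamma>\<^esub> d \<otimes>\<^bsub>\<Gamma>\<^esub> inv\<^bsub>\<Gamma>\<^esub> w g (snd v)) g (fst z) (f z)"
      by (rule AE_imp) (simp only: eq)
  qed
  then obtain u0 where u0: "u0 \<in> space ?U" and f_u0: "AE z in (?X \<Otimes>\<^sub>M ?X) \<Otimes>\<^sub>M ?U. f z = f (fst z, u0)" by blast
  define f0 where "f0 v = f (v, u0)" for v
  have f0: "f0 \<in> measurable (?X \<Otimes>\<^sub>M ?X) ?C"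
    unfolding f0_def by (rule measurable_compose[OF _ f[unfolded resample_space_def]]) (use u0 in simp)
  have f0c: "f0 v \<in> carrier \<Gamma>" if "v \<in> space (?X \<Otimes>\<^sub>M ?X)" for v using measurable_space[OF f0 that] by simp
  have f0_eq: "AE v in ?X \<Otimes>\<^sub>M ?X. f0 (map_prod (?\<sigma> g) (?\<sigma> g) v)
      = w g (fst v) \<otimes>\<^bsub>\<Gamma>\<^esub> f0 v \<otimes>\<^bsub>\<Gamma>\<^esub> inv\<^bsub>\<Gamma>\<^esub> w g (snd v)" if g: "g \<in> carrier G" for g
  proof -
    have "AE z in (?X \<Otimes>\<^sub>M ?X) \<Otimes>\<^sub>M ?U. f (resample_action G g z) = f (fst (resample_action G g z), u0)"
      using mp_family_AE[OF strict_action_mp_family[OF strict_action_resample[OF assms(1,5) n_pos]] g,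
          unfolded resample_space_def, OF f_u0] .
    with f_u0 f_eq[OF g, unfolded resample_space_def]
    have "AE z in (?X \<Otimes>\<^sub>M ?X) \<Otimes>\<^sub>M ?U. f0 (map_prod (?\<sigma> g) (?\<sigma> g) (fst z))
      = w g (fst (fst z)) \<otimes>\<^bsub>\<Gamma>\<^esub> f0 (fst z) \<otimes>\<^bsub>\<Gamma>\<^esub> inv\<^bsub>\<Gamma>\<^esub> w g (snd (fst z))"
      by eventually_elim (simp add: f0_def resample_action_def map_prod_def split_beta)
    from XXU.AE_pair[OF this] show ?thesis by simp
  qed

  \<comment> \<open>In \<open>f0 (x, y)\<close> times the inverse of \<open>f0 (x', y)\<close> the
    cocycle at \<open>y\<close> cancels, so the product transforms through \<open>x\<close> and
    \<open>x'\<close> alone.\<close>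
  define F where "F z = f0 (fst (fst z), snd z) \<otimes>\<^bsub>\<Gamma>\<^esub> inv\<^bsub>\<Gamma>\<^esub> f0 (snd (fst z), snd z)" for z
  let ?p = "\<lambda>z. (fst (fst z), snd z)" and ?q = "\<lambda>z. (snd (fst z), snd z)"
  have p: "?p \<in> measurable ((?X \<Otimes>\<^sub>M ?X) \<Otimes>\<^sub>M ?X) (?X \<Otimes>\<^sub>M ?X)"
    and q: "?q \<in> measurable ((?X \<Otimes>\<^sub>M ?X) \<Otimes>\<^sub>M ?X) (?X \<Otimes>\<^sub>M ?X)" by measurable
  have dp: "distr ((?X \<Otimes>\<^sub>M ?X) \<Otimes>\<^sub>M ?X) (?X \<Otimes>\<^sub>M ?X) ?p = ?X \<Otimes>\<^sub>M ?X"
  proof -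
    have "distr (?X \<Otimes>\<^sub>M ?X) ?X fst \<Otimes>\<^sub>M distr ?X ?X (\<lambda>x. x)
        = distr ((?X \<Otimes>\<^sub>M ?X) \<Otimes>\<^sub>M ?X) (?X \<Otimes>\<^sub>M ?X) (\<lambda>(x, y). (fst x, y))"
      by (intro pair_measure_distr) (auto simp: X.sigma_finite_measure_axioms)
    then show ?thesis by (simp add: X.distr_pair_fst case_prod_beta')
  qed
  have dq: "distr ((?X \<Otimes>\<^sub>M ?X) \<Otimes>\<^sub>M ?X) (?X \<Otimes>\<^sub>M ?X) ?q = ?X \<Otimes>\<^sub>M ?X"
  proof -
    have "distr (?X \<Otimes>\<^sub>M ?X) ?X snd \<Otimes>\<^sub>M distr ?X ?X (\<lambda>x. x)
        = distr ((?X \<Otimes>\<^sub>M ?X) \<Otimes>\<^sub>M ?X) (?X \<Otimes>\<^sub>M ?X) (\<lambda>(x, y). (snd x, y))"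
      by (intro pair_measure_distr) (auto simp: X.sigma_finite_measure_axioms)
    then show ?thesis
      by (simp add: distr_pair_snd[OF X.prob_space_axioms X.sigma_finite_measure_axioms] case_prod_beta')
  qed
  have "\<exists>y0\<in>space ?X. AE z in (?X \<Otimes>\<^sub>M ?X) \<Otimes>\<^sub>M ?X. F z = F (fst z, y0)"
  proof (rule independent_of_mixing_coordinate[OF XX.P.prob_space_axioms X.prob_space_axioms assms(3) assms(7) mXX mX])
    show "F \<in> measurable ((?X \<Otimes>\<^sub>M ?X) \<Otimes>\<^sub>M ?X) ?C"
      unfolding F_def
      by (intro measurable_group_mult measurable_group_inv assms measurable_compose[OF p f0] measurable_compose[OF q f0])
    fix g assume g: "g \<in> carrier G"
    have "AE z in (?X \<Otimes>\<^sub>M ?X) \<Otimes>\<^sub>M ?X. f0 (map_prod (?\<sigma> g) (?\<sigma> g) (?p z))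
        = w g (fst (?p z)) \<otimes>\<^bsub>\<Gamma>\<^esub> f0 (?p z) \<otimes>\<^bsub>\<Gamma>\<^esub> inv\<^bsub>\<Gamma>\<^esub> w g (snd (?p z))"
      using AE_distrD[OF p, unfolded dp, OF f0_eq[OF g]] .
    moreover have "AE z in (?X \<Otimes>\<^sub>M ?X) \<Otimes>\<^sub>M ?X. f0 (map_prod (?\<sigma> g) (?\<sigma> g) (?q z))
        = w g (fst (?q z)) \<otimes>\<^bsub>\<Gamma>\<^esub> f0 (?q z) \<otimes>\<^bsub>\<Gamma>\<^esub> inv\<^bsub>\<Gamma>\<^esub> w g (snd (?q z))"
      using AE_distrD[OF q, unfolded dq, OF f0_eq[OF g]] .
    ultimately show "AE z in (?X \<Otimes>\<^sub>M ?X) \<Otimes>\<^sub>M ?X. F (map_prod (?\<sigma> g) (?\<sigma> g) (fst z), ?\<sigma> g (snd z))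
        = (\<lambda>g v d. w g (fst v) \<otimes>\<^bsub>\<Gamma>\<^esub> d \<otimes>\<^bsub>\<Gamma>\<^esub> inv\<^bsub>\<Gamma>\<^esub> w g (snd v)) g (fst z) (F z)"
      using AE_space
    proof eventually_elim
      case (elim z)
      have z: "fst (fst z) \<in> space ?X" "snd (fst z) \<in> space ?X" "snd z \<in> space ?X"
        using elim(3) by (auto simp: space_pair_measure)
      have c: "f0 (fst (fst z), snd z) \<in> carrier \<Gamma>" "f0 (snd (fst z), snd z) \<in> carrier \<Gamma>"
        using z by (auto intro!: f0c simp: space_pair_measure)
      show ?case
        using elim(1,2) c wc[OF g z(1)] wc[OF g z(2)] wc[OF g z(3)]
        by (simp add: F_def map_prod_def split_beta \<Gamma>.inv_mult_group \<Gamma>.m_assoc \<Gamma>.cancel_left)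
    qed
  qed
  then obtain y0 where y0: "y0 \<in> space ?X" and F_y0: "AE z in (?X \<Otimes>\<^sub>M ?X) \<Otimes>\<^sub>M ?X. F z = F (fst z, y0)" by blast
  define a where "a x = f0 (x, y0)" for x
  have a: "a \<in> measurable ?X ?C"
    unfolding a_def by (rule measurable_compose[OF _ f0]) (use y0 in simp)
  have ac: "a x \<in> carrier \<Gamma>" if "x \<in> space ?X" for x using measurable_space[OF a that] by simp
  \<comment> \<open>Fixing one generic \<open>x0\<close> turns the independence of \<open>y\<close>
    into a factorisation of \<open>f0\<close>; the constant \<open>a x0\<close> is absorbed into
    \<phi>.\<close>
  have "AE v in ?X \<Otimes>\<^sub>M ?X. AE y in ?X. F (v, y) = F (v, y0)" using XXX.AE_pair[OF F_y0] by simp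
  from XX.AE_pair[OF this] have "AE x in ?X. AE x' in ?X. AE y in ?X. F ((x, x'), y) = F ((x, x'), y0)" .
  then obtain x0 where x0: "x0 \<in> space ?X"
    and F_x0: "AE x' in ?X. AE y in ?X. F ((x0, x'), y) = F ((x0, x'), y0)"
    by (rule X.AE_witness)
  define \<phi> where "\<phi> y = inv\<^bsub>\<Gamma>\<^esub> a x0 \<otimes>\<^bsub>\<Gamma>\<^esub> f0 (x0, y)" for y
  have \<phi>c: "\<phi> y \<in> carrier \<Gamma>" if "y \<in> space ?X" for y
    using that x0 ac f0c[of "(x0, y)"] by (auto simp: \<phi>_def space_pair_measure)
  have split: "AE x in ?X. AE y in ?X. f0 (x, y) = a x \<otimes>\<^bsub>\<Gamma>\<^esub> \<phi> y"
    using F_x0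
  proof (rule AE_imp)
    fix x assume x: "x \<in> space ?X" and "AE y in ?X. F ((x0, x), y) = F ((x0, x), y0)"
    from this(2) show "AE y in ?X. f0 (x, y) = a x \<otimes>\<^bsub>\<Gamma>\<^esub> \<phi> y"
    proof (rule AE_imp)
      fix y assume y: "y \<in> space ?X" and eq: "F ((x0, x), y) = F ((x0, x), y0)"
      have c: "f0 (x, y) \<in> carrier \<Gamma>" "f0 (x0, y) \<in> carrier \<Gamma>" "a x \<in> carrier \<Gamma>" "a x0 \<in> carrier \<Gamma>"
        using x y x0 by (auto intro!: f0c ac simp: space_pair_measure)
      have "f0 (x0, y) \<otimes>\<^bsub>\<Gamma>\<^esub> inv\<^bsub>\<Gamma>\<^esub> f0 (x, y) = a x0 \<otimes>\<^bsub>\<Gamma>\<^esub> inv\<^bsub>\<Gamma>\<^esub> a x"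
        using eq by (simp add: F_def a_def)
      then have "f0 (x0, y) = a x0 \<otimes>\<^bsub>\<Gamma>\<^esub> inv\<^bsub>\<Gamma>\<^esub> a x \<otimes>\<^bsub>\<Gamma>\<^esub> f0 (x, y)"
        using c by (metis \<Gamma>.inv_solve_right' \<Gamma>.inv_closed \<Gamma>.m_closed)
      then show "f0 (x, y) = a x \<otimes>\<^bsub>\<Gamma>\<^esub> \<phi> y" using c by (simp add: \<phi>_def \<Gamma>.m_assoc \<Gamma>.cancel_left)
    qed
  qed
  define L where "L g x = inv\<^bsub>\<Gamma>\<^esub> a (?\<sigma> g x) \<otimes>\<^bsub>\<Gamma>\<^esub> w g x \<otimes>\<^bsub>\<Gamma>\<^esub> a x" for g x
  define R where "R g y = \<phi> (?\<sigma> g y) \<otimes>\<^bsub>\<Gamma>\<^esub> w g y \<otimes>\<^bsub>\<Gamma>\<^esub> inv\<^bsub>\<Gamma>\<^esub> \<phi> y" for g y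
  have Lc: "L g x \<in> carrier \<Gamma>" if "g \<in> carrier G" "x \<in> space ?X" for g x
    using that ac wc strict_action_space[OF act that] by (auto simp: L_def)
  have LR: "AE x in ?X. AE y in ?X. L g x = R g y" if g: "g \<in> carrier G" for g
  proof -
    have split_g: "AE x in ?X. AE y in ?X. f0 (?\<sigma> g x, ?\<sigma> g y) = a (?\<sigma> g x) \<otimes>\<^bsub>\<Gamma>\<^esub> \<phi> (?\<sigma> g y)"
      using AE_shift[OF g split] by (rule AE_imp) (rule AE_shift[OF g])
    have eq: "AE x in ?X. AE y in ?X. f0 (?\<sigma> g x, ?\<sigma> g y) = w g x \<otimes>\<^bsub>\<Gamma>\<^esub> f0 (x, y) \<otimes>\<^bsub>\<Gamma>\<^esub> inv\<^bsub>\<Gamma>\<^esub> w g y"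
      using XX.AE_pair[OF f0_eq[OF g]] by simp
    from split split_g eq AE_space show ?thesis
    proof eventually_elim
      case (elim x)
      from elim(1-3) AE_space show ?case
      proof eventually_elim
        case (elim y)
        have x: "x \<in> space ?X" by fact
        have y: "y \<in> space ?X" by fact
        have c: "a x \<in> carrier \<Gamma>" "a (?\<sigma> g x) \<in> carrier \<Gamma>" "\<phi> y \<in> carrier \<Gamma>" "\<phi> (?\<sigma> g y) \<in> carrier \<Gamma>"
          "w g x \<in> carrier \<Gamma>" "w g y \<in> carrier \<Gamma>"
          using x y g strict_action_space[OF act g] by (auto intro: ac \<phi>c wc)
        have "a (?\<sigma> g x) \<otimes>\<^bsub>\<Gamma>\<^esub> \<phi> (?\<sigma> g y) = w g x \<otimes>\<^bsub>\<Gamma>\<^esub> (a x \<otimes>\<^bsub>\<Gamma>\<^esub> \<phi> y) \<otimes>\<^bsub>\<Gamma>\<^esub> inv\<^bsub>\<Gamma>\<^esub> w g y"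
          using elim by simp
        then have "inv\<^bsub>\<Gamma>\<^esub> a (?\<sigma> g x) \<otimes>\<^bsub>\<Gamma>\<^esub> (a (?\<sigma> g x) \<otimes>\<^bsub>\<Gamma>\<^esub> \<phi> (?\<sigma> g y)) \<otimes>\<^bsub>\<Gamma>\<^esub> w g y \<otimes>\<^bsub>\<Gamma>\<^esub> inv\<^bsub>\<Gamma>\<^esub> \<phi> y
          = inv\<^bsub>\<Gamma>\<^esub> a (?\<sigma> g x) \<otimes>\<^bsub>\<Gamma>\<^esub> (w g x \<otimes>\<^bsub>\<Gamma>\<^esub> (a x \<otimes>\<^bsub>\<Gamma>\<^esub> \<phi> y) \<otimes>\<^bsub>\<Gamma>\<^esub> inv\<^bsub>\<Gamma>\<^esub> w g y) \<otimes>\<^bsub>\<Gamma>\<^esub> w g y \<otimes>\<^bsub>\<Gamma>\<^esub> inv\<^bsub>\<Gamma>\<^esub> \<phi> y"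
          by simp
        then show ?case using c by (simp add: L_def R_def \<Gamma>.m_assoc \<Gamma>.cancel_left)
      qed
    qed
  qed
  have "\<exists>d\<in>carrier \<Gamma>. AE x in ?X. L g x = d" if g: "g \<in> carrier G" for g
  proof -
    obtain x1 where x1: "x1 \<in> space ?X" and R: "AE y in ?X. L g x1 = R g y"
      using LR[OF g] by (rule X.AE_witness)
    have "AE x in ?X. L g x = L g x1"
      using LR[OF g]
    proof (rule AE_imp)
      fix x assume "AE y in ?X. L g x = R g y"
      with R have "AE y in ?X. L g x = L g x1" by eventually_elim simp
      then show "L g x = L g x1" by simp
    qed
    then show ?thesis using Lc[OF g x1] by blast
  qed
  then obtain \<delta> where \<delta>c: "\<And>g. g \<in> carrier G \<Longrightarrow> \<delta> g \<in> carrier \<Gamma>"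
    and \<delta>: "\<And>g. g \<in> carrier G \<Longrightarrow> AE x in ?X. L g x = \<delta> g" by metis
  have "\<delta> \<in> hom G \<Gamma>"
  proof (rule homI)
    fix g h assume g: "g \<in> carrier G" and h: "h \<in> carrier G"
    have gh: "g \<otimes>\<^bsub>G\<^esub> h \<in> carrier G" using g h by simp
    \<comment> \<open>Both sides are constants, so an equality holding almost everywhere on a
      probability space holds outright.\<close>
    have "AE x in ?X. \<delta> (g \<otimes>\<^bsub>G\<^esub> h) = \<delta> g \<otimes>\<^bsub>\<Gamma>\<^esub> \<delta> h"
      using \<delta>[OF gh] AE_shift[OF h \<delta>[OF g]] \<delta>[OF h] AE_space
    proof eventually_elim
      case (elim x)
      have x: "x \<in> space ?X" "?\<sigma> h x \<in> space ?X" "?\<sigma> g (?\<sigma> h x) \<in> space ?X"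
        using elim(4) strict_action_space[OF act] g h by auto
      have "w (g \<otimes>\<^bsub>G\<^esub> h) x = w g (?\<sigma> h x) \<otimes>\<^bsub>\<Gamma>\<^esub> w h x" "?\<sigma> (g \<otimes>\<^bsub>G\<^esub> h) x = ?\<sigma> g (?\<sigma> h x)"
        using w act g h x by (auto simp: strict_cocycle_def strict_action_def)
      then have "L (g \<otimes>\<^bsub>G\<^esub> h) x = L g (?\<sigma> h x) \<otimes>\<^bsub>\<Gamma>\<^esub> L h x"
        using ac[OF x(1)] ac[OF x(2)] ac[OF x(3)] wc[OF g x(2)] wc[OF h x(1)]
        by (simp add: L_def \<Gamma>.m_assoc \<Gamma>.cancel_left)
      then show ?case using elim by simp
    qed
    then show "\<delta> (g \<otimes>\<^bsub>G\<^esub> h) = \<delta> g \<otimes>\<^bsub>\<Gamma>\<^esub> \<delta> h" by simp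
  qed (rule \<delta>c)
  moreover have "AE x in ?X. w g x = a (?\<sigma> g x) \<otimes>\<^bsub>\<Gamma>\<^esub> \<delta> g \<otimes>\<^bsub>\<Gamma>\<^esub> inv\<^bsub>\<Gamma>\<^esub> a x" if g: "g \<in> carrier G" for g
    using \<delta>[OF g]
  proof (rule AE_imp)
    fix x assume x: "x \<in> space ?X" and eq: "L g x = \<delta> g"
    show "w g x = a (?\<sigma> g x) \<otimes>\<^bsub>\<Gamma>\<^esub> \<delta> g \<otimes>\<^bsub>\<Gamma>\<^esub> inv\<^bsub>\<Gamma>\<^esub> a x"
      using ac[OF x] ac[OF strict_action_space[OF act g x]] wc[OF g x]
      by (simp add: eq[symmetric] L_def \<Gamma>.m_assoc \<Gamma>.cancel_left)
  qed
  ultimately show ?thesis using a by (intro bexI[of _ \<delta>] bexI[of _ a] ballI)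
qed

section \<open>Standard probability spaces\<close>

text \<open>The form in which the standard Borel structure enters: it makes the set where two
  measurable maps agree measurable, and it passes to countable products by separating a single
  coordinate.\<close>

definition countably_separated :: "'a measure \<Rightarrow> bool" where
  "countably_separated M \<longleftrightarrow> (\<exists>\<U>. countable \<U> \<and> \<U> \<subseteq> sets M \<and>
     (\<forall>x\<in>space M. \<forall>y\<in>space M. x \<noteq> y \<longrightarrow> (\<exists>U\<in>\<U>. x \<in> U \<and> y \<notin> U)))"

lemma sets_Collect_preimage:
  assumes "f \<in> measurable M N" "U \<in> sets N" shows "{x \<in> space M. f x \<in> U} \<in> sets M"
proof -
  have "{x \<in> space M. f x \<in> U} = f -` U \<inter> space M" by auto
  then show ?thesis using measurable_sets[OF assms] by simp
qed

lemma countably_separatedE: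
  assumes "countably_separated M"
  obtains \<U> where "countable \<U>" "\<U> \<subseteq> sets M"
    "\<forall>x\<in>space M. \<forall>y\<in>space M. x \<noteq> y \<longrightarrow> (\<exists>U\<in>\<U>. x \<in> U \<and> y \<notin> U)"
  using assms unfolding countably_separated_def by (elim exE conjE)

lemma standard_borel_separated:
  assumes "standard_borel M" shows "countably_separated M"
proof -
  obtain T where T: "completely_metrizable_space T" "second_countable T" "topspace T = space M"
    and sets: "sets M = sigma_sets (space M) {U. openin T U}"
    using assms by (auto simp: standard_borel_def)
  from T(2) obtain \<B> where \<B>: "countable \<B>" "\<forall>V\<in>\<B>. openin T V"
    "\<forall>U x. openin T U \<and> x \<in> U \<longrightarrow> (\<exists>V\<in>\<B>. x \<in> V \<and> V \<subseteq> U)"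
    unfolding second_countable_def by (elim exE conjE)
  have haus: "Hausdorff_space T"
    using T(1) by (simp add: completely_metrizable_imp_metrizable_space metrizable_imp_Hausdorff_space)
  have "\<exists>U\<in>\<B>. x \<in> U \<and> y \<notin> U" if xy: "x \<in> space M" "y \<in> space M" "x \<noteq> y" for x y
  proof -
    obtain U V where "openin T U" "x \<in> U" "y \<in> V" "disjnt U V"
      using haus xy T(3) unfolding Hausdorff_space_def by metis
    then obtain W where "W \<in> \<B>" "x \<in> W" "W \<subseteq> U" using \<B>(3) by blast
    then show ?thesis using \<open>y \<in> V\<close> \<open>disjnt U V\<close> by (auto simp: disjnt_iff)
  qed
  moreover have "\<B> \<subseteq> sets M" unfolding sets using \<B>(2) by auto
  ultimately show ?thesis unfolding countably_separated_def using \<B>(1) by blast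
qed

lemma countably_separated_PiM:
  assumes "countable I" "countably_separated N"
  shows "countably_separated (PiM I (\<lambda>_. N))"
proof -
  obtain \<U> where \<U>: "countable \<U>" "\<U> \<subseteq> sets N"
    "\<forall>x\<in>space N. \<forall>y\<in>space N. x \<noteq> y \<longrightarrow> (\<exists>U\<in>\<U>. x \<in> U \<and> y \<notin> U)"
    using countably_separatedE[OF assms(2)] .
  define \<V> where "\<V> = (\<lambda>(i, U). {x \<in> space (PiM I (\<lambda>_. N)). x i \<in> U}) ` (I \<times> \<U>)"
  have "countable \<V>" unfolding \<V>_def using assms(1) \<U>(1) by blast
  moreover have "\<V> \<subseteq> sets (PiM I (\<lambda>_. N))"
  proof
    fix V assume "V \<in> \<V>"
    then obtain i U where "i \<in> I" "U \<in> \<U>" "V = {x \<in> space (PiM I (\<lambda>_. N)). x i \<in> U}"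
      by (auto simp: \<V>_def)
    moreover from this have m: "(\<lambda>x. x i) \<in> measurable (PiM I (\<lambda>_. N)) N" by simp
    ultimately show "V \<in> sets (PiM I (\<lambda>_. N))"
      using sets_Collect_preimage[OF m, of U] subsetD[OF \<U>(2), of U] by simp
  qed
  moreover have "\<exists>V\<in>\<V>. x \<in> V \<and> y \<notin> V"
    if xy: "x \<in> space (PiM I (\<lambda>_. N))" "y \<in> space (PiM I (\<lambda>_. N))" "x \<noteq> y" for x y
  proof -
    obtain i where i: "i \<in> I" "x i \<noteq> y i"
      using xy PiE_ext[of x I "\<lambda>_. space N" y] unfolding space_PiM by blast
    moreover have "x i \<in> space N" "y i \<in> space N"
      using xy(1,2) i(1) unfolding space_PiM by (auto dest: PiE_mem)
    ultimately obtain U where "U \<in> \<U>" "x i \<in> U" "y i \<notin> U" using \<U>(3) by blast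
    then show ?thesis using i xy by (intro bexI[of _ "{x \<in> space (PiM I (\<lambda>_. N)). x i \<in> U}"]) (auto simp: \<V>_def)
  qed
  ultimately show ?thesis unfolding countably_separated_def by blast
qed

text \<open>Countably many implications from \<open>f x \<in> U\<close> to
  \<open>g x \<in> U\<close> decide equality, because distinct values are separated by a set that
  contains the first of them.\<close>

lemma sets_Collect_eq_separated:
  assumes "countably_separated M" and f: "f \<in> measurable K M" and g: "g \<in> measurable K M"
  shows "{x \<in> space K. f x = g x} \<in> sets K"
proof -
  obtain \<U> where \<U>: "countable \<U>" "\<U> \<subseteq> sets M"
    "\<forall>x\<in>space M. \<forall>y\<in>space M. x \<noteq> y \<longrightarrow> (\<exists>U\<in>\<U>. x \<in> U \<and> y \<notin> U)"
    using countably_separatedE[OF assms(1)] .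
  have "{x \<in> space K. f x = g x} = {x \<in> space K. \<forall>U\<in>\<U>. f x \<in> U \<longrightarrow> g x \<in> U}"
  proof -
    have "f x = g x \<longleftrightarrow> (\<forall>U\<in>\<U>. f x \<in> U \<longrightarrow> g x \<in> U)" if "x \<in> space K" for x
      using \<U>(3) measurable_space[OF f that] measurable_space[OF g that] by metis
    then show ?thesis by blast
  qed
  also have "\<dots> \<in> sets K"
  proof (intro sets.sets_Collect_countable_All' sets.sets_Collect_imp \<U>(1))
    fix U assume U: "U \<in> \<U>"
    show "{x \<in> space K. f x \<in> U} \<in> sets K" "{x \<in> space K. g x \<in> U} \<in> sets K"
      using sets_Collect_preimage[OF f, of U] sets_Collect_preimage[OF g, of U] U \<U>(2) by auto
  qed
  finally show ?thesis .
qed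

text \<open>A measure with values 0 and 1 only would be concentrated on the points that lie in
  exactly those separating sets that have full measure, and there is at most one such point.\<close>

lemma not_single_point_splits:
  assumes "prob_space M" "countably_separated M" "not_single_point M"
  shows "\<exists>B\<in>sets M. 0 < measure M B \<and> measure M B < 1"
proof (rule ccontr)
  interpret prob_space M by fact
  assume none: "\<not> ?thesis"
  obtain \<U> where \<U>: "countable \<U>" "\<U> \<subseteq> sets M"
    "\<forall>x\<in>space M. \<forall>y\<in>space M. x \<noteq> y \<longrightarrow> (\<exists>U\<in>\<U>. x \<in> U \<and> y \<notin> U)"
    using countably_separatedE[OF assms(2)] .
  define P where "P = {x \<in> space M. \<forall>U\<in>\<U>. x \<in> U \<longleftrightarrow> measure M U = 1}"
  have "P \<in> sets M"
  proof -
    have "P = space M - (\<Union>U\<in>\<U>. if measure M U = 1 then space M - U else U)"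
      by (auto simp: P_def split: if_splits)
    also have "\<dots> \<in> sets M"
      using \<U>(1,2) by (intro sets.Diff sets.countable_UN'') auto
    finally show ?thesis .
  qed
  moreover have "AE x in M. x \<in> P"
  proof -
    have "AE x in M. x \<in> U \<longleftrightarrow> measure M U = 1" if U: "U \<in> \<U>" for U
    proof (cases "measure M U = 1")
      case True
      then show ?thesis using U \<U>(2) prob_eq_1[of U] by auto
    next
      case False
      moreover have "measure M U \<le> 1" by (rule prob_le_1)
      ultimately have "measure M U = 0"
        using none U \<U>(2) measure_nonneg[of M U] by (metis linorder_not_less order_antisym subsetD)
      then have "U \<in> null_sets M" using U \<U>(2) by (auto simp: null_sets_def emeasure_eq_measure)
      then show ?thesis using False AE_not_in by auto
    qed
    then have "AE x in M. \<forall>U\<in>\<U>. x \<in> U \<longleftrightarrow> measure M U = 1" using \<U>(1) by (simp add: AE_ball_countable)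
    then show ?thesis by (rule AE_imp) (simp add: P_def)
  qed
  ultimately have P1: "measure M P = 1" by (simp add: prob_eq_1)
  then have "P \<noteq> {}" by auto
  then obtain y where y: "y \<in> P" by blast
  have "P = {y}"
  proof -
    have "x = y" if "x \<in> P" for x
    proof (rule ccontr)
      assume "x \<noteq> y"
      moreover have "x \<in> space M" "y \<in> space M" using that y by (auto simp: P_def)
      ultimately obtain U where "U \<in> \<U>" "x \<in> U" "y \<notin> U" using \<U>(3) by blast
      then show False using that y by (auto simp: P_def)
    qed
    then show ?thesis using y by blast
  qed
  then show False using P1 y assms(3) by (auto simp: not_single_point_def P_def)
qed

text \<open>Fewer than \<open>Suc n\<close> of the sets can have measure above
  \<open>1 / Suc n\<close>, as the total mass is 1.\<close>

lemma countable_ae_disjoint: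
  assumes "prob_space M" and E: "\<And>i. i \<in> I \<Longrightarrow> E i \<in> sets M" "\<And>i. i \<in> I \<Longrightarrow> measure M (E i) > 0"
    and disj: "\<And>i j. i \<in> I \<Longrightarrow> j \<in> I \<Longrightarrow> i \<noteq> j \<Longrightarrow> AE x in M. x \<notin> E i \<or> x \<notin> E j"
  shows "countable I"
proof -
  interpret prob_space M by fact
  have fin: "finite {i \<in> I. measure M (E i) > 1 / Suc n}" for n
  proof (rule ccontr)
    assume "infinite {i \<in> I. measure M (E i) > 1 / Suc n}"
    then obtain J where J: "J \<subseteq> {i \<in> I. measure M (E i) > 1 / Suc n}" "finite J" "card J = Suc n"
      using infinite_arbitrarily_large by blast
    have "1 = (\<Sum>i\<in>J. 1 / Suc n)" using J by simp
    also have "\<dots> < (\<Sum>i\<in>J. measure M (E i))"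
    proof (rule sum_strict_mono)
      show "J \<noteq> {}" using J(3) by auto
    qed (use J in auto)
    also have "\<dots> = measure M (\<Union>i\<in>J. E i)"
    proof (rule measure_UNION_AE[symmetric])
      show "pairwise (\<lambda>i j. AE x in M. x \<notin> E i \<or> x \<notin> E j) J"
        using disj J(1) unfolding pairwise_def by blast
    qed (use J E(1) in \<open>auto simp: fmeasurable_eq_sets\<close>)
    also have "\<dots> \<le> 1" by (rule prob_le_1)
    finally show False by simp
  qed
  have "I \<subseteq> (\<Union>n. {i \<in> I. measure M (E i) > 1 / Suc n})"
  proof
    fix i assume i: "i \<in> I"
    obtain n where "inverse (real (Suc n)) < measure M (E i)" using reals_Archimedean[OF E(2)[OF i]] by blast
    then show "i \<in> (\<Union>n. {i \<in> I. measure M (E i) > 1 / Suc n})" using i by (auto simp: inverse_eq_divide)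
  qed
  moreover have "countable (\<Union>n. {i \<in> I. measure M (E i) > 1 / Suc n})" using fin by (auto intro: countable_finite)
  ultimately show ?thesis by (rule countable_subset)
qed

section \<open>Isomorphisms modulo null sets\<close>

lemma prob_isoI:
  assumes f: "f \<in> measurable M N" "distr M N f = N" and g: "g \<in> measurable N M"
    and gf: "AE x in M. g (f x) = x" and fg: "AE y in N. f (g y) = y"
  shows "prob_iso M N f"
proof -
  \<comment> \<open>The preimage of \<open>A\<close> under \<open>g\<close> pulls back under
    \<open>f\<close> to \<open>A\<close> up to a null set, so the inverse preserves the measure as
    well.\<close>
  have "distr N M g = M"
  proof (rule measure_eqI)
    fix A assume "A \<in> sets (distr N M g)"
    then have A: "A \<in> sets M" by simp
    have "emeasure (distr N M g) A = emeasure (distr M N f) (g -` A \<inter> space N)"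
      using A g by (simp add: emeasure_distr f(2))
    also have "\<dots> = emeasure M (f -` (g -` A \<inter> space N) \<inter> space M)"
      using A g by (intro emeasure_distr f(1) measurable_sets)
    also have "\<dots> = emeasure M A"
    proof (rule emeasure_eq_AE)
      show "AE x in M. x \<in> f -` (g -` A \<inter> space N) \<inter> space M \<longleftrightarrow> x \<in> A"
        using gf by (rule AE_imp) (use measurable_space[OF f(1)] in auto)
    qed (use A f(1) g in \<open>auto intro!: measurable_sets\<close>)
    finally show "emeasure (distr N M g) A = emeasure M A" .
  qed simp
  then show ?thesis unfolding prob_iso_def using assms by blast
qed

lemma prob_isoE:
  assumes "prob_iso M N f"
  obtains g where "prob_iso N M g" "AE x in M. g (f x) = x" "AE y in N. f (g y) = y"
  using assms unfolding prob_iso_def by blast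

lemma prob_isoD:
  assumes "prob_iso M N f"
  shows "f \<in> measurable M N" "distr M N f = N" "x \<in> space M \<Longrightarrow> f x \<in> space N"
    "(AE y in N. P y) \<Longrightarrow> AE x in M. P (f x)"
proof -
  show f: "f \<in> measurable M N" "distr M N f = N" using assms by (auto simp: prob_iso_def)
  show "x \<in> space M \<Longrightarrow> f x \<in> space N" using f(1) by (rule measurable_space)
  assume "AE y in N. P y"
  then show "AE x in M. P (f x)" using AE_distrD[OF f(1), of P] unfolding f(2) by blast
qed

lemma prob_iso_comp:
  assumes f: "prob_iso M N f" and g: "prob_iso N K g" shows "prob_iso M K (\<lambda>x. g (f x))"
proof -
  obtain f' where f': "prob_iso N M f'" "AE x in M. f' (f x) = x" "AE y in N. f (f' y) = y"
    using prob_isoE[OF f] .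
  obtain g' where g': "prob_iso K N g'" "AE x in N. g' (g x) = x" "AE y in K. g (g' y) = y"
    using prob_isoE[OF g] .
  note fm = prob_isoD(1,2)[OF f] and gm = prob_isoD(1,2)[OF g]
  show ?thesis
  proof (rule prob_isoI)
    show "(\<lambda>x. g (f x)) \<in> measurable M K" by (rule measurable_compose[OF fm(1) gm(1)])
    show "distr M K (\<lambda>x. g (f x)) = K" using distr_distr[OF gm(1) fm(1)] by (simp add: fm gm comp_def)
    show "(\<lambda>x. f' (g' x)) \<in> measurable K M"
      by (rule measurable_compose[OF prob_isoD(1)[OF g'(1)] prob_isoD(1)[OF f'(1)]])
    show "AE x in M. f' (g' (g (f x))) = x"
      using prob_isoD(4)[OF f g'(2)] f'(2) by eventually_elim simp
    show "AE y in K. g (f (f' (g' y))) = y"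
      using prob_isoD(4)[OF g'(1) f'(3)] g'(3) by eventually_elim simp
  qed
qed

text \<open>The homomorphism property holds only almost everywhere, so the action of the unit has to
  be recovered: it is idempotent and has a left inverse almost everywhere.\<close>

lemma mp_action_one:
  fixes G (structure)
  assumes "group G" "mp_action G M \<sigma>" shows "AE x in M. \<sigma> \<one> x = x"
proof -
  interpret group G by fact
  have iso: "prob_iso M M (\<sigma> \<one>)" and mult: "AE x in M. \<sigma> \<one> x = \<sigma> \<one> (\<sigma> \<one> x)"
    using assms(2) unfolding mp_action_def by (auto dest!: bspec[of _ _ "\<one>"])
  obtain k where "AE x in M. k (\<sigma> \<one> x) = x" using prob_isoE[OF iso] by blast
  with prob_isoD(4)[OF iso this] mult show ?thesis by eventually_elim metis
qed

lemma AE_normalized_restriction: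
  assumes "finite_measure M" "Y \<in> sets M" "measure M Y > 0"
  shows "(AE x in normalized_restriction M Y. P x) \<longleftrightarrow> (AE x in M. x \<in> Y \<longrightarrow> P x)"
proof -
  interpret finite_measure M by fact
  have "inverse (emeasure M Y) \<noteq> 0" by (simp add: emeasure_eq_measure)
  then have "null_sets (normalized_restriction M Y) = null_sets (restrict_space M Y)"
    by (auto simp: normalized_restriction_def null_sets_def)
  then have "(AE x in normalized_restriction M Y. P x) \<longleftrightarrow> (AE x in restrict_space M Y. P x)"
    by (simp add: eventually_ae_filter normalized_restriction_def space_scale_measure)
  also have "\<dots> \<longleftrightarrow> (AE x in M. x \<in> Y \<longrightarrow> P x)" using assms(2) by (intro AE_restrict_space_iff) auto
  finally show ?thesis .
qed

lemma sets_normalized_restriction: "sets (normalized_restriction M Y) = sets (restrict_space M Y)"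
  by (simp add: normalized_restriction_def)

text \<open>
  Such a map is piecewise a translation, so it preserves the measure. It is almost everywhere onto
  because the total mass is 1.
\<close>

lemma piecewise_translation_prob_iso:
  fixes G (structure) and M :: "'a measure"
  assumes "group G" "countable (carrier G)" "prob_space M" and act: "strict_action G M T"
    and sep: "countably_separated M"
    and \<alpha>: "\<alpha> \<in> measurable M M"
    and good: "good \<in> sets M" "AE x in M. x \<in> good" "inj_on \<alpha> good"
    and orb: "\<And>x. x \<in> good \<Longrightarrow> \<exists>g\<in>carrier G. \<alpha> x = T g x"
  shows "prob_iso M M \<alpha>"
proof -
  interpret group G by fact
  interpret prob_space M by fact
  have ne: "carrier G \<noteq> {}" by auto
  define e where "e = from_nat_into (carrier G)"
  have e: "e n \<in> carrier G" for n unfolding e_def by (rule from_nat_into[OF ne])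
  have e_surj: "\<exists>n. e n = g" if "g \<in> carrier G" for g
    using from_nat_into_surj[OF assms(2) that] by (auto simp: e_def)
  have T: "T g \<in> measurable M M" "distr M M (T g) = M" if "g \<in> carrier G" for g
    using act that by (auto simp: strict_action_def)
  have Tinv: "T (inv g) (T g x) = x" "T g (T (inv g) x) = x" if "g \<in> carrier G" "x \<in> space M" for g x
  proof -
    have mult: "T g (T h x) = T (g \<otimes> h) x" if "g \<in> carrier G" "h \<in> carrier G" for g h
      using act that \<open>x \<in> space M\<close> by (simp add: strict_action_def)
    have "T \<one> x = x" using act that by (simp add: strict_action_def)
    then show "T (inv g) (T g x) = x" "T g (T (inv g) x) = x" using that by (simp_all add: mult)
  qed
  have good_sp: "x \<in> space M" if "x \<in> good" for x using sets.sets_into_space[OF good(1)] that by auto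
  \<comment> \<open>Taking the least index makes the choice of the translation measurable, since the
    sets where \<alpha> agrees with a given translation are measurable.\<close>
  define \<tau> where "\<tau> x = (LEAST n. \<alpha> x = T (e n) x)" for x
  have \<tau>: "\<alpha> x = T (e (\<tau> x)) x" if x: "x \<in> good" for x
  proof -
    obtain n where "\<alpha> x = T (e n) x" using orb[OF x] e_surj by metis
    then show ?thesis unfolding \<tau>_def by (rule LeastI)
  qed
  have eq_sets: "Measurable.pred M (\<lambda>x. \<alpha> x = T (e n) x)" for n
    unfolding pred_def by (rule sets_Collect_eq_separated[OF sep \<alpha> T(1)[OF e]])
  have \<tau>_meas: "\<tau> \<in> measurable M (count_space UNIV)"
    unfolding \<tau>_def by (rule measurable_Least) (rule eq_sets)
  define E where "E n = {x \<in> good. \<tau> x = n}" for n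
  have E: "E n \<in> sets M" for n
  proof -
    have "E n = good \<inter> (\<tau> -` {n} \<inter> space M)" using good_sp by (auto simp: E_def)
    then show ?thesis using good(1) measurable_sets[OF \<tau>_meas, of "{n}"] by simp
  qed
  \<comment> \<open>The image of the piece \<open>E n\<close> under \<alpha>, written as a preimage
    under the inverse translation so that it is measurable. Injectivity of \<alpha> on
    \<open>good\<close> makes these images disjoint.\<close>
  define F where "F n = T (inv (e n)) -` E n \<inter> space M" for n
  have F: "F n \<in> sets M" for n unfolding F_def using E e T(1)[of "inv (e n)"] by (intro measurable_sets) auto
  have F_iff: "y \<in> F n \<longleftrightarrow> (\<exists>x\<in>E n. y = T (e n) x)" if "y \<in> space M" for y n
    using that Tinv[OF e] good_sp by (auto simp: F_def E_def intro!: bexI[of _ "T (inv (e n)) y"])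
  have F_disj: "disjoint_family F"
    unfolding disjoint_family_on_def
  proof (intro ballI impI)
    fix m n :: nat assume mn: "m \<noteq> n"
    show "F m \<inter> F n = {}"
    proof (rule ccontr)
      assume "F m \<inter> F n \<noteq> {}"
      then obtain y where y: "y \<in> space M" "y \<in> F m" "y \<in> F n" by (auto simp: F_def)
      then obtain x x' where x: "x \<in> E m" "y = T (e m) x" "x' \<in> E n" "y = T (e n) x'" using F_iff by blast
      then have "\<alpha> x = y" "\<alpha> x' = y" using \<tau> by (auto simp: E_def)
      then have "x = x'" using good(3) x by (auto simp: E_def inj_on_def)
      then show False using x mn by (auto simp: E_def)
    qed
  qed
  have pull: "measure M (T (inv g) -` S \<inter> space M) = measure M S" if "g \<in> carrier G" "S \<in> sets M" for g S
    using measure_distr[OF T(1)[of "inv g"] that(2)] T(2)[of "inv g"] that by simp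
  have E_disj: "disjoint_family E" by (auto simp: disjoint_family_on_def E_def)
  have sums_E: "(\<lambda>n. measure M (E n \<inter> (T (e n) -` S \<inter> space M))) sums measure M (\<alpha> -` S \<inter> space M)"
    if S: "S \<in> sets M" for S
  proof -
    have sets: "E n \<inter> (T (e n) -` S \<inter> space M) \<in> sets M" for n
      using E T(1)[OF e] S by (intro sets.Int measurable_sets) auto
    have "(\<lambda>n. measure M (E n \<inter> (T (e n) -` S \<inter> space M))) sums measure M (\<Union>n. E n \<inter> (T (e n) -` S \<inter> space M))"
      using sets E_disj by (intro finite_measure_UNION) (auto simp: disjoint_family_on_def)
    also have "measure M (\<Union>n. E n \<inter> (T (e n) -` S \<inter> space M)) = measure M (\<alpha> -` S \<inter> space M)"
    proof (rule measure_eq_AE)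
      show "AE x in M. x \<in> (\<Union>n. E n \<inter> (T (e n) -` S \<inter> space M)) \<longleftrightarrow> x \<in> \<alpha> -` S \<inter> space M"
        using good(2) by (rule AE_imp) (auto simp: E_def \<tau>)
    qed (use sets \<alpha> S in \<open>auto intro!: measurable_sets\<close>)
    finally show ?thesis .
  qed
  have EF: "measure M (E n \<inter> (T (e n) -` S \<inter> space M)) = measure M (F n \<inter> S)" if S: "S \<in> sets M" for n S
  proof -
    have sets: "E n \<inter> (T (e n) -` S \<inter> space M) \<in> sets M"
      using E T(1)[OF e] S by (intro sets.Int measurable_sets) auto
    have "T (inv (e n)) -` (E n \<inter> (T (e n) -` S \<inter> space M)) \<inter> space M = F n \<inter> S"
      using Tinv[OF e] strict_action_space[OF act] e sets.sets_into_space[OF S] by (auto simp: F_def)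
    then show ?thesis using pull[OF e sets, of n] by simp
  qed
  have sums_F: "(\<lambda>n. measure M (F n \<inter> S)) sums measure M ((\<Union>n. F n) \<inter> S)" if S: "S \<in> sets M" for S
  proof -
    have "(\<lambda>n. measure M (F n \<inter> S)) sums measure M (\<Union>n. F n \<inter> S)"
      using F S F_disj by (intro finite_measure_UNION) (auto simp: disjoint_family_on_def)
    then show ?thesis by simp
  qed
  \<comment> \<open>Summed over the pieces, \<alpha> carries the measure to its restriction to the
    union of the images. Evaluated on the whole space, this shows that the union has full
    measure.\<close>
  have key: "measure M (\<alpha> -` S \<inter> space M) = measure M ((\<Union>n. F n) \<inter> S)" if S: "S \<in> sets M" for S
    using sums_E[OF S] sums_F[OF S] unfolding EF[OF S] by (rule sums_unique2)
  have "\<alpha> -` space M \<inter> space M = space M" using measurable_space[OF \<alpha>] by auto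
  moreover have "(\<Union>n. F n) \<inter> space M = (\<Union>n. F n)" by (auto simp: F_def)
  ultimately have UF: "measure M (\<Union>n. F n) = 1" using key[of "space M"] prob_space by simp
  have UF_sets: "(\<Union>n. F n) \<in> sets M" using F by auto
  have UF_AE: "AE y in M. y \<in> (\<Union>n. F n)" using UF UF_sets by (simp add: prob_eq_1)
  have "measure M ((\<Union>n. F n) \<inter> S) = measure M S" if S: "S \<in> sets M" for S
    using UF_AE UF_sets S by (intro measure_eq_AE) auto
  then have meas: "measure M (\<alpha> -` S \<inter> space M) = measure M S" if "S \<in> sets M" for S
    using key that by simp
  have mp: "distr M M \<alpha> = M"
    by (rule measure_eqI) (auto simp: emeasure_distr[OF \<alpha>] emeasure_eq_measure meas)
  \<comment> \<open>The index of the image that contains \<open>y\<close>, which selects the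
    translation to undo.\<close>
  define \<kappa> where "\<kappa> y = (LEAST n. y \<in> F n)" for y
  have \<kappa>: "\<kappa> y = n" if "y \<in> F n" for y n
  proof -
    have "y \<in> F (\<kappa> y)" unfolding \<kappa>_def using that by (rule LeastI)
    then show ?thesis using that F_disj by (auto simp: disjoint_family_on_def)
  qed
  have \<kappa>_meas: "\<kappa> \<in> measurable M (count_space UNIV)"
    unfolding \<kappa>_def
  proof (rule measurable_Least)
    fix n
    note [measurable] = F[of n]
    show "(\<lambda>y. y \<in> F n) \<in> measurable M (count_space UNIV)" by measurable
  qed
  define \<beta> where "\<beta> y = T (inv (e (\<kappa> y))) y" for y
  have \<beta>_meas: "\<beta> \<in> measurable M M"
    unfolding \<beta>_def
    by (rule measurable_compose_countable[OF _ \<kappa>_meas, of "\<lambda>n. T (inv (e n))"]) (use T(1) e in simp)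
  show ?thesis
  proof (rule prob_isoI[OF \<alpha> mp \<beta>_meas])
    show "AE x in M. \<beta> (\<alpha> x) = x"
      using good(2)
    proof (rule AE_imp)
      fix x assume x: "x \<in> good"
      have "\<alpha> x \<in> space M" using good_sp[OF x] measurable_space[OF \<alpha>] by blast
      then have "\<alpha> x \<in> F (\<tau> x)" using \<tau>[OF x] x by (auto simp: F_iff E_def)
      then have "\<kappa> (\<alpha> x) = \<tau> x" by (rule \<kappa>)
      then show "\<beta> (\<alpha> x) = x" unfolding \<beta>_def using \<tau>[OF x] Tinv(1)[OF e good_sp[OF x], of "\<tau> x"] by simp
    qed
    show "AE y in M. \<alpha> (\<beta> y) = y"
      using UF_AE
    proof (rule AE_imp)
      fix y assume y: "y \<in> space M" "y \<in> (\<Union>n. F n)"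
      then obtain n where n: "y \<in> F n" by blast
      then obtain x where x: "x \<in> E n" "y = T (e n) x" using F_iff[OF y(1)] by blast
      have "\<beta> y = x" unfolding \<beta>_def \<kappa>[OF n] using x Tinv(1)[OF e, of x n] good_sp by (auto simp: E_def)
      then show "\<alpha> (\<beta> y) = y" using \<tau>[of x] x by (auto simp: E_def)
    qed
  qed
qed

section \<open>Orbit equivalence\<close>

lemma orbit_rel_iff: "(x, y) \<in> orbit_rel G M T \<longleftrightarrow> x \<in> space M \<and> (\<exists>g\<in>carrier G. y = T g x)"
  by (auto simp: orbit_rel_def)

lemma image_rel_aeE:
  assumes "image_rel_ae M \<Delta> R S"
  obtains A where "A \<in> sets M" "AE x in M. x \<in> A" "inj_on \<Delta> A"
    "\<forall>x\<in>A. \<forall>y\<in>A. (x, y) \<in> R \<longleftrightarrow> (\<Delta> x, \<Delta> y) \<in> S"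
proof -
  from assms obtain A where A: "A \<in> sets M" "AE x in M. x \<in> A" "inj_on \<Delta> A"
    and eq: "map_prod \<Delta> \<Delta> ` restrict_rel R A = restrict_rel S (\<Delta> ` A)"
    unfolding image_rel_ae_def by (elim bexE conjE)
  have "(x, y) \<in> R \<longleftrightarrow> (\<Delta> x, \<Delta> y) \<in> S" if x: "x \<in> A" and y: "y \<in> A" for x y
  proof
    assume "(x, y) \<in> R"
    then have "map_prod \<Delta> \<Delta> (x, y) \<in> map_prod \<Delta> \<Delta> ` restrict_rel R A"
      using x y by (intro imageI) (simp add: restrict_rel_def)
    then show "(\<Delta> x, \<Delta> y) \<in> S" unfolding eq by (simp add: restrict_rel_def)
  next
    assume "(\<Delta> x, \<Delta> y) \<in> S"
    then have "(\<Delta> x, \<Delta> y) \<in> map_prod \<Delta> \<Delta> ` restrict_rel R A"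
      unfolding eq using x y by (simp add: restrict_rel_def)
    then obtain x' y' where "(x', y') \<in> R" "x' \<in> A" "y' \<in> A" "\<Delta> x' = \<Delta> x" "\<Delta> y' = \<Delta> y"
      by (auto simp: restrict_rel_def)
    then show "(x, y) \<in> R" using inj_onD[OF A(3)] x y by metis
  qed
  then show ?thesis using that[OF A] by blast
qed

text \<open>For countable \<open>G\<close> the almost everywhere identities hold simultaneously off
  one null set. Keeping the points whose whole orbit satisfies them gives an invariant conull set on
  which the action is genuine and free.\<close>

lemma free_action_core:
  fixes G (structure)
  assumes "group G" "countable (carrier G)" and act: "mp_action G M \<sigma>" and free: "free_action G M \<sigma>"
    and P: "AE x in M. P x"
  obtains C where "C \<subseteq> space M" "AE x in M. x \<in> C" "\<forall>x\<in>C. P x" "\<forall>x\<in>C. \<sigma> \<one> x = x"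
    "\<forall>x\<in>C. \<forall>h\<in>carrier G. \<sigma> h x \<in> C"
    "\<forall>x\<in>C. \<forall>h\<in>carrier G. \<forall>k\<in>carrier G. \<sigma> (h \<otimes> k) x = \<sigma> h (\<sigma> k x)"
    "\<forall>x\<in>C. \<forall>h\<in>carrier G. \<forall>k\<in>carrier G. \<sigma> h x = \<sigma> k x \<longrightarrow> h = k"
proof -
  interpret group G by fact
  define Q where "Q x \<longleftrightarrow> x \<in> space M \<and> P x \<and> \<sigma> \<one> x = x
    \<and> (\<forall>h\<in>carrier G. \<forall>k\<in>carrier G. \<sigma> (h \<otimes> k) x = \<sigma> h (\<sigma> k x))
    \<and> (\<forall>h\<in>carrier G. h \<noteq> \<one> \<longrightarrow> \<sigma> h x \<noteq> x)" for x
  have "AE x in M. \<forall>h\<in>carrier G. \<forall>k\<in>carrier G. \<sigma> (h \<otimes> k) x = \<sigma> h (\<sigma> k x)"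
    using act assms(2) by (simp add: AE_ball_countable mp_action_def)
  moreover have "AE x in M. \<forall>h\<in>carrier G. h \<noteq> \<one> \<longrightarrow> \<sigma> h x \<noteq> x"
  proof -
    have "AE x in M. h \<noteq> \<one> \<longrightarrow> \<sigma> h x \<noteq> x" if "h \<in> carrier G" for h
      using free that by (cases "h = \<one>") (auto simp: free_action_def)
    then show ?thesis using assms(2) by (simp add: AE_ball_countable)
  qed
  ultimately have Q: "AE x in M. Q x"
    using P mp_action_one[OF assms(1) act] AE_space by eventually_elim (simp add: Q_def)
  define C where "C = {x. Q x \<and> (\<forall>h\<in>carrier G. Q (\<sigma> h x))}"
  have "AE x in M. Q (\<sigma> h x)" if "h \<in> carrier G" for h
    using act that prob_isoD(4)[OF _ Q, of M "\<sigma> h"] by (simp add: mp_action_def)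
  then have "AE x in M. \<forall>h\<in>carrier G. Q (\<sigma> h x)" using assms(2) by (simp add: AE_ball_countable)
  with Q have C_AE: "AE x in M. x \<in> C" by eventually_elim (simp add: C_def)
  have CQ: "Q x" if "x \<in> C" for x using that by (simp add: C_def)
  have mult: "\<sigma> (h \<otimes> k) x = \<sigma> h (\<sigma> k x)" if "x \<in> C" "h \<in> carrier G" "k \<in> carrier G" for x h k
    using CQ[OF that(1)] that(2,3) unfolding Q_def by blast
  have C_inv: "\<sigma> k x \<in> C" if x: "x \<in> C" and k: "k \<in> carrier G" for x k
  proof -
    have "Q (\<sigma> h (\<sigma> k x))" if h: "h \<in> carrier G" for h
    proof -
      have "Q (\<sigma> (h \<otimes> k) x)" using x h k by (simp add: C_def)
      then show ?thesis by (simp only: mult[OF x h k])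
    qed
    then show ?thesis using x k by (simp add: C_def)
  qed
  show ?thesis
  proof (rule that[of C])
    show "\<forall>x\<in>C. \<forall>h\<in>carrier G. \<forall>k\<in>carrier G. \<sigma> h x = \<sigma> k x \<longrightarrow> h = k"
    proof (intro ballI impI)
      fix x h k assume x: "x \<in> C" and hk: "h \<in> carrier G" "k \<in> carrier G" and eq: "\<sigma> h x = \<sigma> k x"
      have "\<sigma> (inv h \<otimes> k) x = \<sigma> (inv h) (\<sigma> k x)" using x hk by (intro mult) auto
      also have "\<dots> = \<sigma> (inv h \<otimes> h) x" unfolding eq[symmetric] using x hk by (intro mult[symmetric]) auto
      also have "\<dots> = x" using CQ[OF x] hk by (simp add: Q_def)
      finally have "inv h \<otimes> k = \<one>" using CQ[OF x] hk unfolding Q_def by blast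
      then show "h = k" using hk by (metis inv_closed inv_equality inv_inv)
    qed
    show "AE x in M. x \<in> C" by (rule C_AE)
    show "C \<subseteq> space M" "\<forall>x\<in>C. P x" "\<forall>x\<in>C. \<sigma> \<one> x = x" using CQ by (auto simp: Q_def)
  qed (use C_inv mult in auto)
qed

text \<open>Turns an isomorphism onto the normalised restriction into measurable maps between
  \<open>K\<close> and all of \<open>M\<close>, with statements relative to \<open>Y\<close>. The
  inverse is extended by an arbitrary constant off \<open>Y\<close>.\<close>

lemma normalized_restriction_isoE:
  assumes "prob_space M" "Y \<in> sets M" "measure M Y > 0" and iso: "prob_iso K (normalized_restriction M Y) \<Delta>"
    and K: "prob_space K"
  obtains k where "\<Delta> \<in> measurable K M" "\<forall>x\<in>space K. \<Delta> x \<in> Y" "k \<in> measurable M K"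
    "AE x in K. k (\<Delta> x) = x" "AE y in M. y \<in> Y \<longrightarrow> \<Delta> (k y) = y"
    "\<forall>P. (AE x in K. P x) \<longrightarrow> (AE y in M. y \<in> Y \<longrightarrow> P (k y))"
proof -
  interpret M: prob_space M by fact
  interpret K: prob_space K by fact
  let ?N = "normalized_restriction M Y"
  note AE_N = AE_normalized_restriction[OF M.finite_measure_axioms assms(2,3)]
  have "measurable K ?N = measurable K (restrict_space M Y)"
    by (rule measurable_cong_sets) (simp_all add: sets_normalized_restriction)
  then have \<Delta>: "\<Delta> \<in> measurable K M" "\<forall>x\<in>space K. \<Delta> x \<in> Y"
    using prob_isoD(1)[OF iso] by (auto simp: measurable_restrict_space2_iff)
  obtain k0 where k0: "prob_iso ?N K k0" "AE x in K. k0 (\<Delta> x) = x" "AE y in ?N. \<Delta> (k0 y) = y"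
    using prob_isoE[OF iso] .
  obtain b where b: "b \<in> space K" using K.not_empty by blast
  define k where "k y = (if y \<in> Y then k0 y else b)" for y
  have "measurable ?N K = measurable (restrict_space M Y) K"
    by (rule measurable_cong_sets) (simp_all add: sets_normalized_restriction)
  then have "k0 \<in> measurable (restrict_space M Y) K" using prob_isoD(1)[OF k0(1)] by simp
  then have "(\<lambda>y. if y \<in> Y then k0 y else b) \<in> measurable M K"
    using measurable_restrict_space_iff[of Y M b K k0] assms(2) b by auto
  then have k: "k \<in> measurable M K" by (simp add: k_def[abs_def])
  show ?thesis
  proof (rule that[OF \<Delta> k])
    show "AE x in K. k (\<Delta> x) = x" using k0(2) by (rule AE_imp) (simp add: k_def \<Delta>(2))
    show "AE y in M. y \<in> Y \<longrightarrow> \<Delta> (k y) = y" using iffD1[OF AE_N k0(3)] by (rule AE_imp) (simp add: k_def)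
    have "AE y in M. y \<in> Y \<longrightarrow> P (k y)" if "AE x in K. P x" for P
      using iffD1[OF AE_N prob_isoD(4)[OF k0(1) that]] by (rule AE_imp) (simp add: k_def)
    then show "\<forall>P. (AE x in K. P x) \<longrightarrow> (AE y in M. y \<in> Y \<longrightarrow> P (k y))" by blast
  qed
qed

theorem orbit_equivalence_core:
  fixes G :: "('g, 'r) monoid_scheme" and G\<^sub>0 :: "('h, 's) monoid_scheme" and N :: "'y measure" and X\<^sub>0 :: "'x measure"
  assumes G: "group G" "countable (carrier G)" "icc G" "property_T G"
    and N: "standard_prob_space N" "not_single_point N"
    and G0: "group G\<^sub>0" "countable (carrier G\<^sub>0)"
    and X0: "standard_prob_space X\<^sub>0" "mp_action G\<^sub>0 X\<^sub>0 \<sigma>\<^sub>0" "free_action G\<^sub>0 X\<^sub>0 \<sigma>\<^sub>0"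
    and Y: "Y \<in> sets (bernoulli_space G N)" "0 < measure (bernoulli_space G N) Y"
    and iso: "prob_iso X\<^sub>0 (normalized_restriction (bernoulli_space G N) Y) \<Delta>\<^sub>0"
    and rel: "image_rel_ae X\<^sub>0 \<Delta>\<^sub>0 (orbit_rel G\<^sub>0 X\<^sub>0 \<sigma>\<^sub>0)
      (restrict_rel (orbit_rel G (bernoulli_space G N) (bernoulli_shift G)) Y)"
  shows "(AE x in bernoulli_space G N. x \<in> Y) \<and>
    (\<exists>\<alpha> \<delta> \<Delta>. \<alpha> \<in> Inn_rel (bernoulli_space G N) (orbit_rel G (bernoulli_space G N) (bernoulli_shift G)) \<and>
       \<delta> \<in> iso G\<^sub>0 G \<and> prob_iso X\<^sub>0 (bernoulli_space G N) \<Delta> \<and>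
       (\<forall>h\<in>carrier G\<^sub>0. AE x in X\<^sub>0. bernoulli_shift G (\<delta> h) (\<Delta> x) = \<Delta> (\<sigma>\<^sub>0 h x)) \<and>
       (AE x in X\<^sub>0. \<Delta>\<^sub>0 x = \<alpha> (\<Delta> x)))"
proof -
  interpret G: group G by (rule G(1))
  interpret G0: group G\<^sub>0 by (rule G0(1))
  define X where "X = bernoulli_space G N"
  define \<sigma> :: "'g \<Rightarrow> ('g \<Rightarrow> 'y) \<Rightarrow> 'g \<Rightarrow> 'y" where "\<sigma> = bernoulli_shift G"
  interpret N: prob_space N using N(1) by (simp add: standard_prob_space_def)
  interpret X0: prob_space X\<^sub>0 using X0(1) by (simp add: standard_prob_space_def)
  interpret X: prob_space X unfolding X_def by (rule prob_space_bernoulli[OF N.prob_space_axioms])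
  have inf: "infinite (carrier G)" using G(3) by (simp add: icc_def)
  have sepN: "countably_separated N" and sep0: "countably_separated X\<^sub>0"
    using N(1) X0(1) by (auto simp: standard_prob_space_def intro: standard_borel_separated)
  have sepX: "countably_separated X"
    unfolding X_def bernoulli_space_def by (rule countably_separated_PiM[OF G(2) sepN])
  have act: "strict_action G X \<sigma>"
    unfolding X_def \<sigma>_def by (rule strict_action_bernoulli[OF G(1) N.prob_space_axioms])
  have mix: "mixing K X \<sigma>" if "K \<subseteq> carrier G" "infinite K" for K
    unfolding X_def \<sigma>_def by (rule mixing_bernoulli_shift[OF G(1) N.prob_space_axioms that])
  obtain B where B: "B \<in> sets N" "0 < measure N B" "measure N B < 1"
    using not_single_point_splits[OF N.prob_space_axioms sepN N(2)] by blast
  have freeX: "AE x in X. \<sigma> g x \<noteq> x" if "g \<in> carrier G" "g \<noteq> \<one>\<^bsub>G\<^esub>" for g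
    unfolding X_def \<sigma>_def by (rule bernoulli_shift_free[OF G(1,2) inf N.prob_space_axioms B that])
  have \<sigma>_meas: "\<sigma> g \<in> measurable X X" if "g \<in> carrier G" for g using act that by (simp add: strict_action_def)
  have \<sigma>_sp: "\<sigma> g x \<in> space X" if "g \<in> carrier G" "x \<in> space X" for g x
    by (rule strict_action_space[OF act that])
  have \<sigma>_mult: "\<sigma> g (\<sigma> h x) = \<sigma> (g \<otimes>\<^bsub>G\<^esub> h) x" if "g \<in> carrier G" "h \<in> carrier G" "x \<in> space X" for g h x
    using act that by (simp add: strict_action_def)
  have \<sigma>_one: "\<sigma> \<one>\<^bsub>G\<^esub> x = x" if "x \<in> space X" for x
    using act that by (simp add: strict_action_def)
  have \<sigma>_inv: "\<sigma> (inv\<^bsub>G\<^esub> g) (\<sigma> g x) = x" "\<sigma> g (\<sigma> (inv\<^bsub>G\<^esub> g) x) = x" if "g \<in> carrier G" "x \<in> space X" for g x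
    using that by (simp_all add: \<sigma>_mult \<sigma>_one)

  obtain k where \<Delta>0: "\<Delta>\<^sub>0 \<in> measurable X\<^sub>0 X" "\<forall>x\<in>space X\<^sub>0. \<Delta>\<^sub>0 x \<in> Y" and k: "k \<in> measurable X X\<^sub>0"
    "AE x in X\<^sub>0. k (\<Delta>\<^sub>0 x) = x" "AE y in X. y \<in> Y \<longrightarrow> \<Delta>\<^sub>0 (k y) = y"
    and k_AE: "\<forall>P. (AE x in X\<^sub>0. P x) \<longrightarrow> (AE y in X. y \<in> Y \<longrightarrow> P (k y))"
    using normalized_restriction_isoE[OF X.prob_space_axioms Y[folded X_def] iso[folded X_def] X0.prob_space_axioms] .
  obtain A where "A \<in> sets X\<^sub>0" and A: "AE x in X\<^sub>0. x \<in> A" "inj_on \<Delta>\<^sub>0 A"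
    and A_rel: "\<forall>x\<in>A. \<forall>y\<in>A.
      (x, y) \<in> orbit_rel G\<^sub>0 X\<^sub>0 \<sigma>\<^sub>0 \<longleftrightarrow> (\<Delta>\<^sub>0 x, \<Delta>\<^sub>0 y) \<in> restrict_rel (orbit_rel G X \<sigma>) Y"
    using image_rel_aeE[OF rel[folded X_def \<sigma>_def]] .
  \<comment> \<open>A genuine free action on an invariant conull set inside \<open>A\<close>, where
    \<open>\<Delta>\<^sub>0\<close> is injective and matches orbits at every point.\<close>
  obtain C where C: "C \<subseteq> space X\<^sub>0" "AE x in X\<^sub>0. x \<in> C" and CA: "\<forall>x\<in>C. x \<in> A" and C_one: "\<forall>x\<in>C. \<sigma>\<^sub>0 \<one>\<^bsub>G\<^sub>0\<^esub> x = x"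
    and C_inv: "\<forall>x\<in>C. \<forall>h\<in>carrier G\<^sub>0. \<sigma>\<^sub>0 h x \<in> C"
    and C_mult: "\<forall>x\<in>C. \<forall>h\<in>carrier G\<^sub>0. \<forall>k\<in>carrier G\<^sub>0. \<sigma>\<^sub>0 (h \<otimes>\<^bsub>G\<^sub>0\<^esub> k) x = \<sigma>\<^sub>0 h (\<sigma>\<^sub>0 k x)"
    and C_free: "\<forall>x\<in>C. \<forall>h\<in>carrier G\<^sub>0. \<forall>k\<in>carrier G\<^sub>0. \<sigma>\<^sub>0 h x = \<sigma>\<^sub>0 k x \<longrightarrow> h = k"
    using free_action_core[OF G0 X0(2,3) A(1)] .
  have \<Delta>0_inj: "x = y" if "x \<in> C" "y \<in> C" "\<Delta>\<^sub>0 x = \<Delta>\<^sub>0 y" for x y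
    using inj_onD[OF A(2) that(3)] CA that by blast
  have \<Delta>0_sp: "\<Delta>\<^sub>0 x \<in> space X" if "x \<in> C" for x using measurable_space[OF \<Delta>0(1)] C(1) that by blast
  have orb: "(\<exists>h\<in>carrier G\<^sub>0. y = \<sigma>\<^sub>0 h x) \<longleftrightarrow> (\<exists>g\<in>carrier G. \<Delta>\<^sub>0 y = \<sigma> g (\<Delta>\<^sub>0 x))" if "x \<in> C" "y \<in> C" for x y
    using bspec[OF bspec[OF A_rel, of x], of y] that CA C(1) \<Delta>0(2) \<Delta>0_sp by (auto simp: orbit_rel_iff restrict_rel_def)

  have "AE y in X. y \<in> Y \<longrightarrow> k y \<in> C \<and> \<Delta>\<^sub>0 (k y) = y"
    using mp[OF spec[OF k_AE] C(2)] k(3) by eventually_elim simp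
  then obtain N1 where N1: "N1 \<in> null_sets X" "{y \<in> space X. \<not> (y \<in> Y \<longrightarrow> k y \<in> C \<and> \<Delta>\<^sub>0 (k y) = y)} \<subseteq> N1"
    unfolding eventually_ae_filter by blast
  \<comment> \<open>\<open>Y\<close> without a measurable null set, so that at every remaining point
    \<open>k\<close> takes its value in \<open>C\<close> and \<open>\<Delta>\<^sub>0\<close> undoes
    \<open>k\<close>.\<close>
  define Y' where "Y' = Y - N1"
  have YX: "Y \<in> sets X" using Y(1) by (simp add: X_def)
  have Y': "Y' \<in> sets X" using YX N1 by (auto simp: Y'_def)
  have Y'_pos: "measure X Y' > 0"
    using Y(2) measure_Diff_null_set[OF YX N1(1)] by (simp add: Y'_def X_def)
  have Y'_sp: "y \<in> space X" if "y \<in> Y'" for y using sets.sets_into_space[OF Y'] that by blast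
  have kY': "k y \<in> C" "\<Delta>\<^sub>0 (k y) = y" if "y \<in> Y'" for y
    using N1(2) Y'_sp[OF that] that by (auto simp: Y'_def)

  define e where "e = from_nat_into (carrier G)"
  have e: "e n \<in> carrier G" for n unfolding e_def by (rule from_nat_into) blast
  have e_surj: "\<exists>n. e n = g" if "g \<in> carrier G" for g
    using from_nat_into_surj[OF G(2) that] by (auto simp: e_def)
  \<comment> \<open>The saturation of \<open>Y'\<close> under the group. It is exactly invariant,
    and ergodicity makes it conull.\<close>
  define X1 where "X1 = {x \<in> space X. \<exists>n. \<sigma> (e n) x \<in> Y'}"
  have X1: "X1 \<in> sets X"
    unfolding X1_def by (intro sets.sets_Collect_countable_Ex sets_Collect_preimage[OF \<sigma>_meas[OF e] Y'])
  have X1_sp: "x \<in> space X" if "x \<in> X1" for x using that by (simp add: X1_def)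
  have X1_inv: "\<sigma> g x \<in> X1" if x: "x \<in> X1" and g: "g \<in> carrier G" for x g
  proof -
    obtain n where n: "\<sigma> (e n) x \<in> Y'" using x by (auto simp: X1_def)
    obtain m where m: "e m = e n \<otimes>\<^bsub>G\<^esub> inv\<^bsub>G\<^esub> g" using e_surj[of "e n \<otimes>\<^bsub>G\<^esub> inv\<^bsub>G\<^esub> g"] e g by auto
    have "\<sigma> (e m) (\<sigma> g x) = \<sigma> (e n) x"
      using g e[of n] X1_sp[OF x] by (simp add: m \<sigma>_mult G.m_assoc)
    then show ?thesis using n \<sigma>_sp[OF g X1_sp[OF x]] by (auto simp: X1_def intro!: exI[of _ m])
  qed
  have X1_inv_iff: "\<sigma> g x \<in> X1 \<longleftrightarrow> x \<in> X1" if "x \<in> space X" "g \<in> carrier G" for x g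
    using X1_inv[of x g] X1_inv[of "\<sigma> g x" "inv\<^bsub>G\<^esub> g"] \<sigma>_inv(1)[OF that(2,1)] that by auto
  have X1_AE: "AE x in X. x \<in> X1"
  proof (rule mixing_ergodic[OF X.prob_space_axioms inf mix[OF order_refl inf] X1])
    show "AE x in X. x \<in> X1 \<longrightarrow> \<sigma> g x \<in> X1" if "g \<in> carrier G" for g using X1_inv that by (intro AE_I2) simp
    have "Y' \<subseteq> X1"
    proof
      fix y assume y: "y \<in> Y'"
      obtain n where "e n = \<one>\<^bsub>G\<^esub>" using e_surj by blast
      then show "y \<in> X1" using y Y'_sp[OF y] by (auto simp: X1_def \<sigma>_one intro!: exI[of _ n])
    qed
    then have "measure X Y' \<le> measure X X1" using X1 by (rule X.finite_measure_mono)
    then show "measure X X1 > 0" using Y'_pos by simp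
  qed
  \<comment> \<open>The retraction \<theta> picks the first translate, in the enumeration of
    \<open>G\<close>, that falls into \<open>Y'\<close>; this keeps it measurable.\<close>
  define idx where "idx x = (LEAST n. \<sigma> (e n) x \<in> Y')" for x
  define \<tau> where "\<tau> x = e (idx x)" for x
  define \<theta> where "\<theta> x = \<sigma> (\<tau> x) x" for x
  have \<tau>: "\<tau> x \<in> carrier G" for x using e by (simp add: \<tau>_def)
  have \<theta>: "\<theta> x \<in> Y'" if "x \<in> X1" for x
    using that LeastI_ex[of "\<lambda>n. \<sigma> (e n) x \<in> Y'"] by (auto simp: X1_def \<theta>_def \<tau>_def idx_def)
  have idx_meas: "idx \<in> measurable X (count_space UNIV)"
    unfolding idx_def
    by (rule measurable_Least) (simp add: pred_def sets_Collect_preimage[OF \<sigma>_meas[OF e] Y'])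
  have \<theta>_meas: "\<theta> \<in> measurable X X"
    unfolding \<theta>_def \<tau>_def
    by (rule measurable_compose_countable[OF _ idx_meas, of "\<lambda>n. \<sigma> (e n)"]) (use \<sigma>_meas e in simp)
  define \<Psi> where "\<Psi> x = k (\<theta> x)" for x
  have \<Psi>_meas: "\<Psi> \<in> measurable X X\<^sub>0" unfolding \<Psi>_def by (rule measurable_compose[OF \<theta>_meas k(1)])
  have \<Psi>: "\<Psi> x \<in> C" "\<Delta>\<^sub>0 (\<Psi> x) = \<theta> x" if "x \<in> X1" for x
    using kY'[OF \<theta>[OF that]] by (auto simp: \<Psi>_def)

  \<comment> \<open>The element of \<open>G\<^sub>0\<close> is unique by freeness on
    \<open>C\<close>. The unit as value off the invariant set \<open>X1\<close> keeps the cocycle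
    identity true at every point, as \<open>strict_cocycle\<close> demands.\<close>
  define w where "w g x = (if x \<in> X1 then THE h. h \<in> carrier G\<^sub>0 \<and> \<Psi> (\<sigma> g x) = \<sigma>\<^sub>0 h (\<Psi> x) else \<one>\<^bsub>G\<^sub>0\<^esub>)" for g x
  have w_ex: "\<exists>h\<in>carrier G\<^sub>0. \<Psi> (\<sigma> g x) = \<sigma>\<^sub>0 h (\<Psi> x)" if x: "x \<in> X1" and g: "g \<in> carrier G" for g x
  proof -
    have "\<theta> (\<sigma> g x) = \<sigma> (\<tau> (\<sigma> g x) \<otimes>\<^bsub>G\<^esub> g \<otimes>\<^bsub>G\<^esub> inv\<^bsub>G\<^esub> \<tau> x) (\<theta> x)"
      unfolding \<theta>_def using g X1_sp[OF x] \<tau>[of x] \<tau>[of "\<sigma> g x"]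
      by (simp add: \<sigma>_mult \<sigma>_sp G.m_assoc)
    then have "\<exists>g'\<in>carrier G. \<Delta>\<^sub>0 (\<Psi> (\<sigma> g x)) = \<sigma> g' (\<Delta>\<^sub>0 (\<Psi> x))"
      using g \<tau> by (intro bexI[of _ "\<tau> (\<sigma> g x) \<otimes>\<^bsub>G\<^esub> g \<otimes>\<^bsub>G\<^esub> inv\<^bsub>G\<^esub> \<tau> x"])
        (auto simp: \<Psi>(2)[OF x] \<Psi>(2)[OF X1_inv[OF x g]])
    then show ?thesis using orb[OF \<Psi>(1)[OF x] \<Psi>(1)[OF X1_inv[OF x g]]] by blast
  qed
  have w_unique: "w g x = h" if "x \<in> X1" "h \<in> carrier G\<^sub>0" "\<Psi> (\<sigma> g x) = \<sigma>\<^sub>0 h (\<Psi> x)" for g x h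
  proof -
    have "(THE h. h \<in> carrier G\<^sub>0 \<and> \<Psi> (\<sigma> g x) = \<sigma>\<^sub>0 h (\<Psi> x)) = h"
      using that C_free \<Psi>(1)[OF that(1)] by (intro the_equality) auto
    then show ?thesis using that(1) by (simp add: w_def)
  qed
  have w: "w g x \<in> carrier G\<^sub>0" "\<Psi> (\<sigma> g x) = \<sigma>\<^sub>0 (w g x) (\<Psi> x)" if "x \<in> X1" "g \<in> carrier G" for g x
    using w_ex[OF that] w_unique[OF that(1)] by auto
  have w_cocycle: "strict_cocycle G G\<^sub>0 X \<sigma> w"
    unfolding strict_cocycle_def
  proof (intro conjI ballI)
    fix g assume g: "g \<in> carrier G"
    show "w g \<in> measurable X (count_space (carrier G\<^sub>0))"
      unfolding measurable_count_space_eq_countable[OF G0(2)]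
    proof (intro conjI ballI)
      show "w g \<in> space X \<rightarrow> carrier G\<^sub>0" using w(1)[OF _ g] by (auto simp: w_def[of g])
      fix h assume h: "h \<in> carrier G\<^sub>0"
      have "w g -` {h} \<inter> space X = (X1 \<inter> {x \<in> space X. \<Psi> (\<sigma> g x) = \<sigma>\<^sub>0 h (\<Psi> x)}) \<union> (if h = \<one>\<^bsub>G\<^sub>0\<^esub> then space X - X1 else {})"
      proof -
        have "w g x = h \<longleftrightarrow> \<Psi> (\<sigma> g x) = \<sigma>\<^sub>0 h (\<Psi> x)" if "x \<in> X1" for x
          using w(2)[OF that g] w_unique[OF that h] by blast
        moreover have "w g x = \<one>\<^bsub>G\<^sub>0\<^esub>" if "x \<notin> X1" for x using that by (simp add: w_def)
        ultimately show ?thesis using X1_sp by (auto split: if_splits)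
      qed
      also have "\<dots> \<in> sets X"
      proof -
        have "prob_iso X\<^sub>0 X\<^sub>0 (\<sigma>\<^sub>0 h)" using X0(2) h by (simp add: mp_action_def)
        then have "{x \<in> space X. \<Psi> (\<sigma> g x) = \<sigma>\<^sub>0 h (\<Psi> x)} \<in> sets X"
          by (intro sets_Collect_eq_separated[OF sep0] measurable_compose[OF \<sigma>_meas[OF g] \<Psi>_meas]
              measurable_compose[OF \<Psi>_meas] prob_isoD(1))
        then show ?thesis using X1 by auto
      qed
      finally show "w g -` {h} \<inter> space X \<in> sets X" .
    qed
  next
    fix g h x assume g: "g \<in> carrier G" and h: "h \<in> carrier G" and x: "x \<in> space X"
    show "w (g \<otimes>\<^bsub>G\<^esub> h) x = w g (\<sigma> h x) \<otimes>\<^bsub>G\<^sub>0\<^esub> w h x"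
    proof (cases "x \<in> X1")
      case True
      note hx = X1_inv[OF True h]
      show ?thesis
      proof (rule w_unique[OF True])
        show "w g (\<sigma> h x) \<otimes>\<^bsub>G\<^sub>0\<^esub> w h x \<in> carrier G\<^sub>0" using w(1)[OF hx g] w(1)[OF True h] by simp
        have "\<Psi> (\<sigma> (g \<otimes>\<^bsub>G\<^esub> h) x) = \<Psi> (\<sigma> g (\<sigma> h x))" using \<sigma>_mult[OF g h x] by simp
        also have "\<dots> = \<sigma>\<^sub>0 (w g (\<sigma> h x)) (\<sigma>\<^sub>0 (w h x) (\<Psi> x))" using w(2)[OF hx g] w(2)[OF True h] by simp
        also have "\<dots> = \<sigma>\<^sub>0 (w g (\<sigma> h x) \<otimes>\<^bsub>G\<^sub>0\<^esub> w h x) (\<Psi> x)"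
          using C_mult \<Psi>(1)[OF True] w(1)[OF hx g] w(1)[OF True h] by simp
        finally show "\<Psi> (\<sigma> (g \<otimes>\<^bsub>G\<^esub> h) x) = \<sigma>\<^sub>0 (w g (\<sigma> h x) \<otimes>\<^bsub>G\<^sub>0\<^esub> w h x) (\<Psi> x)" .
      qed
    next
      case False
      then show ?thesis using X1_inv_iff[OF x h] by (simp add: w_def)
    qed
  qed

  obtain \<delta> u where \<delta>: "\<delta> \<in> hom G G\<^sub>0" and u: "u \<in> measurable X (count_space (carrier G\<^sub>0))"
    and w_untwist: "\<forall>g\<in>carrier G. AE x in X. w g x = u (\<sigma> g x) \<otimes>\<^bsub>G\<^sub>0\<^esub> \<delta> g \<otimes>\<^bsub>G\<^sub>0\<^esub> inv\<^bsub>G\<^sub>0\<^esub> u x"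
    using cocycle_superrigidity[OF G(1,2) inf G(4) N.prob_space_axioms G0 w_cocycle[unfolded X_def \<sigma>_def],
        folded X_def \<sigma>_def] by (elim bexE)
  interpret \<delta>: group_hom G G\<^sub>0 \<delta> by (intro group_hom.intro group_hom_axioms.intro G G0 \<delta>)
  have uc: "u x \<in> carrier G\<^sub>0" if "x \<in> space X" for x using measurable_space[OF u that] by simp
  \<comment> \<open>Correcting \<Psi> by \<open>u\<close> replaces the cocycle \<open>w\<close> by
    the homomorphism \<delta>, so \<Phi> intertwines the two actions along \<delta>.\<close>
  define \<Phi> where "\<Phi> x = \<sigma>\<^sub>0 (inv\<^bsub>G\<^sub>0\<^esub> u x) (\<Psi> x)" for x
  have \<Phi>C: "\<Phi> x \<in> C" if "x \<in> X1" for x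
    using C_inv \<Psi>(1)[OF that] uc[OF X1_sp[OF that]] by (simp add: \<Phi>_def)
  have \<Phi>_meas: "\<Phi> \<in> measurable X X\<^sub>0"
    unfolding \<Phi>_def
  proof (rule measurable_compose_countable'[OF _ u G0(2), of "\<lambda>h x. \<sigma>\<^sub>0 (inv\<^bsub>G\<^sub>0\<^esub> h) (\<Psi> x)"])
    fix h assume "h \<in> carrier G\<^sub>0"
    then have "prob_iso X\<^sub>0 X\<^sub>0 (\<sigma>\<^sub>0 (inv\<^bsub>G\<^sub>0\<^esub> h))" using X0(2) by (simp add: mp_action_def)
    then show "(\<lambda>x. \<sigma>\<^sub>0 (inv\<^bsub>G\<^sub>0\<^esub> h) (\<Psi> x)) \<in> measurable X X\<^sub>0"
      by (intro measurable_compose[OF \<Psi>_meas] prob_isoD(1))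
  qed
  have "AE x in X. \<forall>g\<in>carrier G. w g x = u (\<sigma> g x) \<otimes>\<^bsub>G\<^sub>0\<^esub> \<delta> g \<otimes>\<^bsub>G\<^sub>0\<^esub> inv\<^bsub>G\<^sub>0\<^esub> u x"
    using w_untwist G(2) by (simp add: AE_ball_countable)
  with X1_AE have "AE x in X. x \<in> X1 \<and> (\<forall>g\<in>carrier G. w g x = u (\<sigma> g x) \<otimes>\<^bsub>G\<^sub>0\<^esub> \<delta> g \<otimes>\<^bsub>G\<^sub>0\<^esub> inv\<^bsub>G\<^sub>0\<^esub> u x)"
    by eventually_elim simp
  then obtain N2 where N2: "N2 \<in> null_sets X" and N2_sub:
    "{x \<in> space X. \<not> (x \<in> X1 \<and> (\<forall>g\<in>carrier G. w g x = u (\<sigma> g x) \<otimes>\<^bsub>G\<^sub>0\<^esub> \<delta> g \<otimes>\<^bsub>G\<^sub>0\<^esub> inv\<^bsub>G\<^sub>0\<^esub> u x))} \<subseteq> N2"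
    unfolding eventually_ae_filter by blast
  define X2 where "X2 = space X - N2"
  have X2: "X2 \<in> sets X" using N2 by (auto simp: X2_def)
  have X2_AE: "AE x in X. x \<in> X2" using AE_not_in[OF N2] AE_space by eventually_elim (simp add: X2_def)
  have X21: "x \<in> X1" and X2_sp: "x \<in> space X" if "x \<in> X2" for x using that N2_sub by (auto simp: X2_def)
  have \<Phi>_equiv: "\<Phi> (\<sigma> g x) = \<sigma>\<^sub>0 (\<delta> g) (\<Phi> x)" if x: "x \<in> X2" and g: "g \<in> carrier G" for x g
  proof -
    have x1: "x \<in> X1" "\<sigma> g x \<in> X1" using X21[OF x] X1_inv g by auto
    have eq: "w g x = u (\<sigma> g x) \<otimes>\<^bsub>G\<^sub>0\<^esub> \<delta> g \<otimes>\<^bsub>G\<^sub>0\<^esub> inv\<^bsub>G\<^sub>0\<^esub> u x"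
      using x g N2_sub by (auto simp: X2_def)
    have c: "u x \<in> carrier G\<^sub>0" "u (\<sigma> g x) \<in> carrier G\<^sub>0" "\<delta> g \<in> carrier G\<^sub>0" "w g x \<in> carrier G\<^sub>0"
      using uc X1_sp x1 g w(1) by auto
    have "\<Phi> (\<sigma> g x) = \<sigma>\<^sub>0 (inv\<^bsub>G\<^sub>0\<^esub> u (\<sigma> g x)) (\<sigma>\<^sub>0 (w g x) (\<Psi> x))"
      using w(2)[OF x1(1) g] by (simp add: \<Phi>_def)
    also have "\<dots> = \<sigma>\<^sub>0 (inv\<^bsub>G\<^sub>0\<^esub> u (\<sigma> g x) \<otimes>\<^bsub>G\<^sub>0\<^esub> w g x) (\<Psi> x)"
      using C_mult \<Psi>(1)[OF x1(1)] c by simp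
    also have "inv\<^bsub>G\<^sub>0\<^esub> u (\<sigma> g x) \<otimes>\<^bsub>G\<^sub>0\<^esub> w g x = \<delta> g \<otimes>\<^bsub>G\<^sub>0\<^esub> inv\<^bsub>G\<^sub>0\<^esub> u x"
      using c by (simp add: eq G0.m_assoc G0.cancel_left)
    also have "\<sigma>\<^sub>0 (\<delta> g \<otimes>\<^bsub>G\<^sub>0\<^esub> inv\<^bsub>G\<^sub>0\<^esub> u x) (\<Psi> x) = \<sigma>\<^sub>0 (\<delta> g) (\<Phi> x)"
      unfolding \<Phi>_def using C_mult \<Psi>(1)[OF x1(1)] c by simp
    finally show ?thesis .
  qed

  define \<alpha> where "\<alpha> x = \<Delta>\<^sub>0 (\<Phi> x)" for x
  have \<alpha>_meas: "\<alpha> \<in> measurable X X" unfolding \<alpha>_def by (rule measurable_compose[OF \<Phi>_meas \<Delta>0(1)])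
  \<comment> \<open>\<theta> moves along orbits of \<open>G\<close>, the correction by
    \<open>u\<close> along orbits of \<open>G\<^sub>0\<close>, and \<open>\<Delta>\<^sub>0\<close>
    matches the two kinds of orbit.\<close>
  have \<alpha>_orb: "\<exists>g\<in>carrier G. \<alpha> x = \<sigma> g x" if x: "x \<in> X1" for x
  proof -
    have "\<exists>h\<in>carrier G\<^sub>0. \<Phi> x = \<sigma>\<^sub>0 h (\<Psi> x)" using uc[OF X1_sp[OF x]] by (auto simp: \<Phi>_def)
    then obtain g where g: "g \<in> carrier G" "\<alpha> x = \<sigma> g (\<theta> x)"
      using orb[OF \<Psi>(1)[OF x] \<Phi>C[OF x]] \<Psi>(2)[OF x] by (auto simp: \<alpha>_def)
    then have "\<alpha> x = \<sigma> (g \<otimes>\<^bsub>G\<^esub> \<tau> x) x" using \<tau> X1_sp[OF x] by (simp add: \<theta>_def \<sigma>_mult)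
    then show ?thesis using g \<tau> by (intro bexI[of _ "g \<otimes>\<^bsub>G\<^esub> \<tau> x"]) auto
  qed

  \<comment> \<open>The conjugacy class of \<open>g\<close> lies in the kernel and is infinite. Some
    set \<open>E h\<close>, where \<alpha> acts as \<open>h\<close>, has positive measure, so mixing
    along the class would make it meet its preimage under some \<open>k\<close> of the class in
    positive measure. There \<Phi>, hence \<alpha>, takes the same value at \<open>x\<close> and at
    its translate by \<open>k\<close>, which forces the two points to be equal, against
    freeness.\<close>
  have ker: "g = \<one>\<^bsub>G\<^esub>" if g: "g \<in> carrier G" "\<delta> g = \<one>\<^bsub>G\<^sub>0\<^esub>" for g
  proof (rule ccontr)
    assume g1: "g \<noteq> \<one>\<^bsub>G\<^esub>"
    define K where "K = conj_class G g"
    have K: "K \<subseteq> carrier G" using g by (auto simp: K_def conj_class_def)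
    have K_inf: "infinite K" using G(3) g g1 by (simp add: icc_def K_def)
    have K\<delta>: "\<delta> k = \<one>\<^bsub>G\<^sub>0\<^esub>" if "k \<in> K" for k
      using that g by (auto simp: K_def conj_class_def)
    have K1: "k \<noteq> \<one>\<^bsub>G\<^esub>" if k: "k \<in> K" for k
    proof
      assume "k = \<one>\<^bsub>G\<^esub>"
      then obtain a where a: "a \<in> carrier G" "a \<otimes>\<^bsub>G\<^esub> g \<otimes>\<^bsub>G\<^esub> inv\<^bsub>G\<^esub> a = \<one>\<^bsub>G\<^esub>"
        using k by (auto simp: K_def conj_class_def)
      then have "a \<otimes>\<^bsub>G\<^esub> g = a" using g by (metis G.inv_closed G.inv_equality G.inv_inv G.m_closed)
      then show False using a g g1 by simp
    qed
    define E where "E h = {x \<in> space X. \<alpha> x = \<sigma> h x}" for h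
    have E: "E h \<in> sets X" if "h \<in> carrier G" for h
      unfolding E_def by (rule sets_Collect_eq_separated[OF sepX \<alpha>_meas \<sigma>_meas[OF that]])
    have "\<exists>h\<in>carrier G. measure X (E h) \<noteq> 0"
    proof (rule ccontr)
      assume "\<not> ?thesis"
      then have "AE x in X. x \<notin> E h" if "h \<in> carrier G" for h
        using that E[OF that] by (intro AE_not_in) (auto simp: null_sets_def X.emeasure_eq_measure)
      then have "AE x in X. \<forall>h\<in>carrier G. x \<notin> E h" using G(2) by (simp add: AE_ball_countable)
      with X1_AE have "AE x in X. False"
        by eventually_elim (use \<alpha>_orb X1_sp in \<open>auto simp: E_def\<close>)
      then show False using X.AE_False by simp
    qed
    then obtain h where h: "h \<in> carrier G" "measure X (E h) \<noteq> 0" by blast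
    have "((\<lambda>k. measure X (E h \<inter> (\<sigma> k -` E h \<inter> space X))) \<longlongrightarrow> measure X (E h) * measure X (E h)) (at_infinity_on K)"
      using mix[OF K K_inf] E[OF h(1)] by (simp add: mixing_def)
    moreover have "eventually (\<lambda>k. measure X (E h \<inter> (\<sigma> k -` E h \<inter> space X)) = 0) (at_infinity_on K)"
      using eventually_at_infinity_on_mem
    proof eventually_elim
      case (elim k)
      have kG: "k \<in> carrier G" using K elim by blast
      have "AE x in X. x \<notin> E h \<inter> (\<sigma> k -` E h \<inter> space X)"
        using X2_AE freeX[OF kG K1[OF elim]]
      proof eventually_elim
        case (elim x)
        show ?case
        proof
          assume "x \<in> E h \<inter> (\<sigma> k -` E h \<inter> space X)"
          then have x: "x \<in> space X" "\<alpha> x = \<sigma> h x" "\<alpha> (\<sigma> k x) = \<sigma> h (\<sigma> k x)" by (auto simp: E_def)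
          have "\<Phi> (\<sigma> k x) = \<Phi> x"
            using \<Phi>_equiv[OF elim(1) kG] K\<delta>[OF \<open>k \<in> K\<close>] C_one \<Phi>C[OF X21[OF elim(1)]] by simp
          then have "\<sigma> h (\<sigma> k x) = \<sigma> h x" using x by (simp add: \<alpha>_def)
          then have "\<sigma> k x = x" using \<sigma>_inv(1)[OF h(1)] \<sigma>_sp[OF kG x(1)] x(1) by metis
          then show False using elim(2) by simp
        qed
      qed
      moreover have "E h \<inter> (\<sigma> k -` E h \<inter> space X) \<in> sets X"
        using E[OF h(1)] measurable_sets[OF \<sigma>_meas[OF kG] E[OF h(1)]] by blast
      ultimately have "measure X (E h \<inter> (\<sigma> k -` E h \<inter> space X)) = measure X {}"
        by (intro measure_eq_AE) auto
      then show ?case by simp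
    qed
    then have "((\<lambda>k. measure X (E h \<inter> (\<sigma> k -` E h \<inter> space X))) \<longlongrightarrow> 0) (at_infinity_on K)"
      by (rule tendsto_eventually)
    ultimately have "measure X (E h) * measure X (E h) = 0"
      by (rule tendsto_unique[OF at_infinity_on_nontrivial[OF K_inf]])
    then show False using h(2) by simp
  qed
  have \<delta>_inj: "inj_on \<delta> (carrier G)"
  proof (rule inj_onI)
    fix g g' assume gg': "g \<in> carrier G" "g' \<in> carrier G" "\<delta> g = \<delta> g'"
    then have "\<delta> (inv\<^bsub>G\<^esub> g \<otimes>\<^bsub>G\<^esub> g') = \<one>\<^bsub>G\<^sub>0\<^esub>"
      using \<delta>.hom_closed[of g'] by (simp add: \<delta>.hom_mult \<delta>.hom_inv)
    then have "inv\<^bsub>G\<^esub> g \<otimes>\<^bsub>G\<^esub> g' = \<one>\<^bsub>G\<^esub>" using gg' by (intro ker) auto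
    then show "g = g'" using gg' by (metis G.inv_closed G.inv_equality G.inv_inv)
  qed
  \<comment> \<open>Points with the same image lie in one orbit, with
    \<open>x' = \<sigma> c x\<close>. Equivariance makes \<open>\<delta> c\<close> fix
    \<open>\<Phi> x\<close>, so \<open>\<delta> c\<close> is the unit by freeness, and
    \<open>c\<close> by \<open>ker\<close>.\<close>
  have \<alpha>_inj: "inj_on \<alpha> X2"
  proof (rule inj_onI)
    fix x x' assume x: "x \<in> X2" and x': "x' \<in> X2" and eq: "\<alpha> x = \<alpha> x'"
    have \<Phi>_eq: "\<Phi> x = \<Phi> x'"
      using \<Delta>0_inj[OF \<Phi>C[OF X21[OF x]] \<Phi>C[OF X21[OF x']]] eq by (simp add: \<alpha>_def)
    obtain g g' where g: "g \<in> carrier G" "\<alpha> x = \<sigma> g x" and g': "g' \<in> carrier G" "\<alpha> x' = \<sigma> g' x'"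
      using \<alpha>_orb X21 x x' by metis
    define c where "c = inv\<^bsub>G\<^esub> g' \<otimes>\<^bsub>G\<^esub> g"
    have c: "c \<in> carrier G" using g g' by (simp add: c_def)
    have "\<sigma> c x = \<sigma> (inv\<^bsub>G\<^esub> g') (\<sigma> g x)" using g g' X2_sp[OF x] by (simp add: c_def \<sigma>_mult)
    also have "\<dots> = x'" using eq g g' \<sigma>_inv(1)[OF g'(1) X2_sp[OF x']] by simp
    finally have x'_eq: "\<sigma> c x = x'" .
    then have "\<sigma>\<^sub>0 (\<delta> c) (\<Phi> x) = \<sigma>\<^sub>0 \<one>\<^bsub>G\<^sub>0\<^esub> (\<Phi> x)"
      using \<Phi>_equiv[OF x c] \<Phi>_eq C_one \<Phi>C[OF X21[OF x]] by simp
    then have "\<delta> c = \<one>\<^bsub>G\<^sub>0\<^esub>" using C_free \<Phi>C[OF X21[OF x]] c by simp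
    then have "c = \<one>\<^bsub>G\<^esub>" using c ker by blast
    then show "x = x'" using x'_eq \<sigma>_one[OF X2_sp[OF x]] by simp
  qed
  have \<alpha>_iso: "prob_iso X X \<alpha>"
    by (rule piecewise_translation_prob_iso[OF G(1,2) X.prob_space_axioms act sepX \<alpha>_meas X2 X2_AE \<alpha>_inj])
      (use \<alpha>_orb X21 in blast)

  have "\<alpha> -` Y \<inter> space X = space X"
    using \<Delta>0(2) measurable_space[OF \<Phi>_meas] by (auto simp: \<alpha>_def)
  \<comment> \<open>\<alpha> preserves the measure and takes all its values in
    \<open>Y\<close>.\<close>
  then have Y1: "measure X Y = 1"
    using measure_distr[OF \<alpha>_meas YX] prob_isoD(2)[OF \<alpha>_iso] X.prob_space by simp
  then have Y_AE: "AE x in X. x \<in> Y" using X.prob_eq_1[OF YX] by simp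
  \<comment> \<open>With \<open>Y\<close> of measure 1 the normalising factor is 1, and the
    restriction to \<open>Y\<close> loses only a null set.\<close>
  have \<Delta>0_iso: "prob_iso X\<^sub>0 X \<Delta>\<^sub>0"
  proof (rule prob_isoI)
    show "\<Delta>\<^sub>0 \<in> measurable X\<^sub>0 X" by (rule \<Delta>0(1))
    show "k \<in> measurable X X\<^sub>0" by (rule k(1))
    show "AE x in X\<^sub>0. k (\<Delta>\<^sub>0 x) = x" by (rule k(2))
    show "AE y in X. \<Delta>\<^sub>0 (k y) = y" using k(3) Y_AE by eventually_elim simp
    show "distr X\<^sub>0 X \<Delta>\<^sub>0 = X"
    proof (rule measure_eqI)
      fix S assume "S \<in> sets (distr X\<^sub>0 X \<Delta>\<^sub>0)"
      then have S: "S \<in> sets X" by simp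
      have SY: "S \<inter> Y \<in> sets (normalized_restriction X Y)"
        unfolding sets_normalized_restriction using S YX by (subst sets_restrict_space_iff) auto
      have "emeasure (distr X\<^sub>0 X \<Delta>\<^sub>0) S = emeasure X\<^sub>0 (\<Delta>\<^sub>0 -` (S \<inter> Y) \<inter> space X\<^sub>0)"
        unfolding emeasure_distr[OF \<Delta>0(1) S] using \<Delta>0(2) by (intro arg_cong[where f = "emeasure X\<^sub>0"]) auto
      also have "\<dots> = emeasure (distr X\<^sub>0 (normalized_restriction X Y) \<Delta>\<^sub>0) (S \<inter> Y)"
        by (rule emeasure_distr[symmetric, OF prob_isoD(1)[OF iso[folded X_def]] SY])
      also have "\<dots> = emeasure (normalized_restriction X Y) (S \<inter> Y)" using prob_isoD(2)[OF iso[folded X_def]] by simp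
      also have "\<dots> = emeasure X (S \<inter> Y)"
        using YX by (simp add: normalized_restriction_def X.emeasure_eq_measure[of Y] Y1 emeasure_restrict_space)
      also have "\<dots> = emeasure X S"
        using Y_AE S YX by (intro emeasure_eq_AE) auto
      finally show "emeasure (distr X\<^sub>0 X \<Delta>\<^sub>0) S = emeasure X S" .
    qed simp
  qed

  obtain \<beta> where \<beta>: "prob_iso X X \<beta>" "AE x in X. \<beta> (\<alpha> x) = x" "AE y in X. \<alpha> (\<beta> y) = y"
    using prob_isoE[OF \<alpha>_iso] .
  \<comment> \<open>The required factorisation forces the inverse of \<alpha> composed with
    \<open>\<Delta>\<^sub>0\<close>.\<close>
  define \<Delta> where "\<Delta> x = \<beta> (\<Delta>\<^sub>0 x)" for x
  have \<Delta>_iso: "prob_iso X\<^sub>0 X \<Delta>" unfolding \<Delta>_def by (rule prob_iso_comp[OF \<Delta>0_iso \<beta>(1)])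
  have \<alpha>\<Delta>: "AE x in X\<^sub>0. \<alpha> (\<Delta> x) = \<Delta>\<^sub>0 x" unfolding \<Delta>_def by (rule prob_isoD(4)[OF \<Delta>0_iso \<beta>(3)])
  have \<Delta>X2: "AE x in X\<^sub>0. \<Delta> x \<in> X2" by (rule prob_isoD(4)[OF \<Delta>_iso X2_AE])
  \<comment> \<open>\<open>\<Delta> x\<close> and \<open>\<Delta> (\<sigma>\<^sub>0 h x)\<close> lie
    in one orbit of \<open>G\<close>. Applying \<Phi>, which undoes \<Delta>, to the element
    \<open>g\<close> linking them yields \<open>\<delta> g = h\<close> by freeness. Hence \<delta>
    is onto and, being injective, it determines \<open>g\<close> independently of
    \<open>x\<close>.\<close>
  have conj: "AE x in X\<^sub>0. \<exists>g\<in>carrier G. \<delta> g = h \<and> \<sigma> g (\<Delta> x) = \<Delta> (\<sigma>\<^sub>0 h x)" if h: "h \<in> carrier G\<^sub>0" for h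
  proof -
    have \<sigma>h: "prob_iso X\<^sub>0 X\<^sub>0 (\<sigma>\<^sub>0 h)" using X0(2) h by (simp add: mp_action_def)
    from C(2) \<alpha>\<Delta> \<Delta>X2 prob_isoD(4)[OF \<sigma>h \<alpha>\<Delta>] prob_isoD(4)[OF \<sigma>h \<Delta>X2] show ?thesis
    proof eventually_elim
      case (elim x)
      define x' where "x' = \<sigma>\<^sub>0 h x"
      have x: "x \<in> C" "x' \<in> C" using elim(1) C_inv h by (auto simp: x'_def)
      have X2x: "\<Delta> x \<in> X2" "\<Delta> x' \<in> X2" using elim by (auto simp: x'_def)
      have sp: "\<Delta> x \<in> space X" "\<Delta> x' \<in> space X" using X2_sp X2x by auto
      have a: "\<alpha> (\<Delta> x) = \<Delta>\<^sub>0 x" "\<alpha> (\<Delta> x') = \<Delta>\<^sub>0 x'" using elim by (auto simp: x'_def)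
      have \<Phi>\<Delta>: "\<Phi> (\<Delta> x) = x" "\<Phi> (\<Delta> x') = x'"
        using \<Delta>0_inj \<Phi>C X21 X2x x a by (auto simp: \<alpha>_def)
      obtain g1 where g1: "g1 \<in> carrier G" "\<Delta>\<^sub>0 x' = \<sigma> g1 (\<Delta>\<^sub>0 x)"
        using orb[OF x] h by (auto simp: x'_def)
      obtain p where p: "p \<in> carrier G" "\<alpha> (\<Delta> x) = \<sigma> p (\<Delta> x)" using \<alpha>_orb[OF X21[OF X2x(1)]] by blast
      obtain q where q: "q \<in> carrier G" "\<alpha> (\<Delta> x') = \<sigma> q (\<Delta> x')" using \<alpha>_orb[OF X21[OF X2x(2)]] by blast
      define g where "g = inv\<^bsub>G\<^esub> q \<otimes>\<^bsub>G\<^esub> (g1 \<otimes>\<^bsub>G\<^esub> p)"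
      have g: "g \<in> carrier G" using g1 p q by (simp add: g_def)
      have "\<sigma> g (\<Delta> x) = \<sigma> (inv\<^bsub>G\<^esub> q) (\<sigma> g1 (\<sigma> p (\<Delta> x)))"
        using g1 p q sp by (simp add: g_def \<sigma>_mult \<sigma>_sp)
      also have "\<dots> = \<sigma> (inv\<^bsub>G\<^esub> q) (\<sigma> q (\<Delta> x'))" using p q a g1 by simp
      also have "\<dots> = \<Delta> x'" by (rule \<sigma>_inv(1)[OF q(1) sp(2)])
      finally have gx: "\<sigma> g (\<Delta> x) = \<Delta> x'" .
      have "\<sigma>\<^sub>0 (\<delta> g) x = \<sigma>\<^sub>0 h x" using \<Phi>_equiv[OF X2x(1) g] \<Phi>\<Delta> gx by (simp add: x'_def)
      then have "\<delta> g = h" using C_free x(1) g h by simp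
      then show ?case using g gx by (auto simp: x'_def)
    qed
  qed
  have \<delta>_surj: "\<exists>g\<in>carrier G. \<delta> g = h" if "h \<in> carrier G\<^sub>0" for h
    using X0.AE_witness[OF conj[OF that]] by blast
  have \<delta>_iso: "\<delta> \<in> iso G G\<^sub>0"
    unfolding iso_def bij_betw_def using \<delta> \<delta>_inj \<delta>_surj \<delta>.hom_closed by (auto simp: image_iff)
  define \<delta>' where "\<delta>' = inv_into (carrier G) \<delta>"
  have \<delta>'_iso: "\<delta>' \<in> iso G\<^sub>0 G" unfolding \<delta>'_def by (rule G.iso_set_sym[OF \<delta>_iso])
  have "AE x in X\<^sub>0. \<sigma> (\<delta>' h) (\<Delta> x) = \<Delta> (\<sigma>\<^sub>0 h x)" if h: "h \<in> carrier G\<^sub>0" for h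
    using conj[OF h] by (rule AE_imp) (auto simp: \<delta>'_def inv_into_f_f[OF \<delta>_inj])
  moreover have "\<alpha> \<in> Inn_rel X (orbit_rel G X \<sigma>)"
    unfolding Inn_rel_def
  proof (intro CollectI conjI \<alpha>_iso)
    show "AE x in X. (x, \<alpha> x) \<in> orbit_rel G X \<sigma>"
      using X1_AE by (rule AE_imp) (use \<alpha>_orb in \<open>simp add: orbit_rel_iff\<close>)
  qed
  moreover have "AE x in X\<^sub>0. \<Delta>\<^sub>0 x = \<alpha> (\<Delta> x)" using \<alpha>\<Delta> by (rule AE_imp) simp
  ultimately show ?thesis
    using Y_AE \<delta>'_iso \<Delta>_iso unfolding X_def[symmetric] \<sigma>_def[symmetric]
    by (intro conjI exI[of _ \<alpha>] exI[of _ \<delta>'] exI[of _ \<Delta>] ballI)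
qed

text \<open>
  The sets where \<open>\<Delta>\<^sub>0(gx) = k \<Delta>\<^sub>0(x)\<close>, for a fixed \<open>k \<in> G\<close> and varying \<open>g\<close>, are almost everywhere
  disjoint by freeness.
\<close>

lemma countable_if_orbit_equivalent:
  fixes G :: "('g, 'r) monoid_scheme" and G\<^sub>0 :: "('h, 's) monoid_scheme" and N :: "'y measure" and X\<^sub>0 :: "'x measure"
  assumes G: "group G" "countable (carrier G)" and N: "standard_prob_space N"
    and G0: "group G\<^sub>0"
    and X0: "standard_prob_space X\<^sub>0" "mp_action G\<^sub>0 X\<^sub>0 \<sigma>\<^sub>0" "free_action G\<^sub>0 X\<^sub>0 \<sigma>\<^sub>0"
    and Y: "Y \<in> sets (bernoulli_space G N)" "0 < measure (bernoulli_space G N) Y"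
    and iso: "prob_iso X\<^sub>0 (normalized_restriction (bernoulli_space G N) Y) \<Delta>\<^sub>0"
    and rel: "image_rel_ae X\<^sub>0 \<Delta>\<^sub>0 (orbit_rel G\<^sub>0 X\<^sub>0 \<sigma>\<^sub>0)
      (restrict_rel (orbit_rel G (bernoulli_space G N) (bernoulli_shift G)) Y)"
  shows "countable (carrier G\<^sub>0)"
proof -
  interpret G0: group G\<^sub>0 by (rule G0)
  define X where "X = bernoulli_space G N"
  define \<sigma> :: "'g \<Rightarrow> ('g \<Rightarrow> 'y) \<Rightarrow> 'g \<Rightarrow> 'y" where "\<sigma> = bernoulli_shift G"
  interpret N: prob_space N using N by (simp add: standard_prob_space_def)
  interpret X0: prob_space X\<^sub>0 using X0(1) by (simp add: standard_prob_space_def)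
  interpret X: prob_space X unfolding X_def by (rule prob_space_bernoulli[OF N.prob_space_axioms])
  have "countably_separated N"
    using N by (auto simp: standard_prob_space_def intro: standard_borel_separated)
  then have sepX: "countably_separated X"
    unfolding X_def bernoulli_space_def by (rule countably_separated_PiM[OF G(2)])
  have \<sigma>_meas: "\<sigma> k \<in> measurable X X" if "k \<in> carrier G" for k
    using strict_action_bernoulli[OF G(1) N.prob_space_axioms] that by (simp add: strict_action_def X_def \<sigma>_def)
  have \<Delta>0: "\<Delta>\<^sub>0 \<in> measurable X\<^sub>0 X"
    by (rule normalized_restriction_isoE[OF X.prob_space_axioms Y[folded X_def] iso[folded X_def] X0.prob_space_axioms])
  obtain A where "A \<in> sets X\<^sub>0" and A: "AE x in X\<^sub>0. x \<in> A" "inj_on \<Delta>\<^sub>0 A"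
    and A_rel: "\<forall>x\<in>A. \<forall>y\<in>A.
      (x, y) \<in> orbit_rel G\<^sub>0 X\<^sub>0 \<sigma>\<^sub>0 \<longleftrightarrow> (\<Delta>\<^sub>0 x, \<Delta>\<^sub>0 y) \<in> restrict_rel (orbit_rel G X \<sigma>) Y"
    using image_rel_aeE[OF rel[folded X_def \<sigma>_def]] .
  have \<sigma>0: "prob_iso X\<^sub>0 X\<^sub>0 (\<sigma>\<^sub>0 g)" if "g \<in> carrier G\<^sub>0" for g using X0(2) that by (simp add: mp_action_def)
  define E where "E k g = {x \<in> space X\<^sub>0. \<Delta>\<^sub>0 (\<sigma>\<^sub>0 g x) = \<sigma> k (\<Delta>\<^sub>0 x)}" for k g
  have E: "E k g \<in> sets X\<^sub>0" if "k \<in> carrier G" "g \<in> carrier G\<^sub>0" for k g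
    unfolding E_def
    by (intro sets_Collect_eq_separated[OF sepX] measurable_compose[OF prob_isoD(1)[OF \<sigma>0[OF that(2)]] \<Delta>0]
        measurable_compose[OF \<Delta>0 \<sigma>_meas[OF that(1)]])
  \<comment> \<open>Almost every \<open>x\<close> lies in \<open>E k g\<close> for some
    \<open>k\<close>, because \<open>\<Delta>\<^sub>0\<close> maps orbits into orbits of the
    countable group \<open>G\<close>; countably many null sets could not cover these points.\<close>
  have pos: "\<exists>k\<in>carrier G. measure X\<^sub>0 (E k g) > 0" if g: "g \<in> carrier G\<^sub>0" for g
  proof (rule ccontr)
    assume none: "\<not> ?thesis"
    have "AE x in X\<^sub>0. x \<notin> E k g" if "k \<in> carrier G" for k
    proof (rule AE_not_in)
      have "measure X\<^sub>0 (E k g) = 0" using none that measure_nonneg[of X\<^sub>0 "E k g"] by (metis order.order_iff_strict)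
      then show "E k g \<in> null_sets X\<^sub>0" using E[OF that g] by (simp add: null_sets_def X0.emeasure_eq_measure)
    qed
    then have "AE x in X\<^sub>0. \<forall>k\<in>carrier G. x \<notin> E k g" using G(2) by (simp add: AE_ball_countable)
    with A(1) prob_isoD(4)[OF \<sigma>0[OF g] A(1)] AE_space have "AE x in X\<^sub>0. False"
    proof eventually_elim
      case (elim x)
      have "(x, \<sigma>\<^sub>0 g x) \<in> orbit_rel G\<^sub>0 X\<^sub>0 \<sigma>\<^sub>0" using elim(3) g by (auto simp: orbit_rel_iff)
      then have "(\<Delta>\<^sub>0 x, \<Delta>\<^sub>0 (\<sigma>\<^sub>0 g x)) \<in> orbit_rel G X \<sigma>"
        using bspec[OF bspec[OF A_rel elim(1)] elim(2)] by (simp add: restrict_rel_def)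
      then show False using elim(3,4) by (auto simp: orbit_rel_iff E_def)
    qed
    then show False using X0.AE_False by simp
  qed
  have "countable {g \<in> carrier G\<^sub>0. measure X\<^sub>0 (E k g) > 0}" if k: "k \<in> carrier G" for k
  proof (rule countable_ae_disjoint[OF X0.prob_space_axioms, where E = "E k"])
    fix g g' assume "g \<in> {g \<in> carrier G\<^sub>0. measure X\<^sub>0 (E k g) > 0}" "g' \<in> {g \<in> carrier G\<^sub>0. measure X\<^sub>0 (E k g) > 0}"
      and ne: "g \<noteq> g'"
    then have g: "g \<in> carrier G\<^sub>0" and g': "g' \<in> carrier G\<^sub>0" by auto
    have ig: "inv\<^bsub>G\<^sub>0\<^esub> g \<in> carrier G\<^sub>0" using g by simp
    have "inv\<^bsub>G\<^sub>0\<^esub> g \<otimes>\<^bsub>G\<^sub>0\<^esub> g' \<noteq> \<one>\<^bsub>G\<^sub>0\<^esub>"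
      using g g' ne by (metis G0.inv_closed G0.inv_equality G0.inv_inv)
    then have f: "AE x in X\<^sub>0. \<sigma>\<^sub>0 (inv\<^bsub>G\<^sub>0\<^esub> g \<otimes>\<^bsub>G\<^sub>0\<^esub> g') x \<noteq> x"
      using X0(3) g g' by (simp add: free_action_def)
    have m: "AE x in X\<^sub>0. \<sigma>\<^sub>0 (inv\<^bsub>G\<^sub>0\<^esub> g \<otimes>\<^bsub>G\<^sub>0\<^esub> h) x = \<sigma>\<^sub>0 (inv\<^bsub>G\<^sub>0\<^esub> g) (\<sigma>\<^sub>0 h x)" if "h \<in> carrier G\<^sub>0" for h
      using X0(2) ig that by (simp add: mp_action_def)
    from f m[OF g] m[OF g'] mp_action_one[OF G0 X0(2)]
      prob_isoD(4)[OF \<sigma>0[OF g] A(1)] prob_isoD(4)[OF \<sigma>0[OF g'] A(1)]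
    show "AE x in X\<^sub>0. x \<notin> E k g \<or> x \<notin> E k g'"
    proof eventually_elim
      case (elim x)
      show ?case
      proof (rule ccontr)
        assume "\<not> ?thesis"
        then have "\<Delta>\<^sub>0 (\<sigma>\<^sub>0 g x) = \<Delta>\<^sub>0 (\<sigma>\<^sub>0 g' x)" by (simp add: E_def)
        then have "\<sigma>\<^sub>0 g x = \<sigma>\<^sub>0 g' x" using inj_onD[OF A(2)] elim by blast
        then show False using elim g by simp
      qed
    qed
  qed (use E k in auto)
  then have "countable (\<Union>k\<in>carrier G. {g \<in> carrier G\<^sub>0. measure X\<^sub>0 (E k g) > 0})" using G(2) by blast
  moreover have "carrier G\<^sub>0 \<subseteq> (\<Union>k\<in>carrier G. {g \<in> carrier G\<^sub>0. measure X\<^sub>0 (E k g) > 0})" using pos by auto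
  ultimately show ?thesis by (rule countable_subset[rotated])
qed

theorem theorem0p6:
  fixes G :: "('g, 'r) monoid_scheme"
    and Y\<^sub>0 :: "'y measure"
    and X :: "('g \<Rightarrow> 'y) measure"
    and \<sigma> :: "'g \<Rightarrow> ('g \<Rightarrow> 'y) \<Rightarrow> ('g \<Rightarrow> 'y)"
    and R :: "('g \<Rightarrow> 'y) rel"
  assumes "group G" and "countable (carrier G)" and "icc G" and "property_T G"
    and "standard_prob_space Y\<^sub>0" and "not_single_point Y\<^sub>0"
    and X: "X = bernoulli_space G Y\<^sub>0"
    and \<sigma>: "\<sigma> = bernoulli_shift G"
    and R: "R = orbit_rel G X \<sigma>"
  shows
    "(\<forall>(G\<^sub>0 :: ('h, 's) monoid_scheme) (X\<^sub>0 :: 'x measure) \<sigma>\<^sub>0 Y \<Delta>\<^sub>0.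
        group G\<^sub>0 \<and> countable (carrier G\<^sub>0) \<and>
        standard_prob_space X\<^sub>0 \<and> mp_action G\<^sub>0 X\<^sub>0 \<sigma>\<^sub>0 \<and> free_action G\<^sub>0 X\<^sub>0 \<sigma>\<^sub>0 \<and>
        Y \<in> sets X \<and> 0 < measure X Y \<and>
        prob_iso X\<^sub>0 (normalized_restriction X Y) \<Delta>\<^sub>0 \<and>
        image_rel_ae X\<^sub>0 \<Delta>\<^sub>0 (orbit_rel G\<^sub>0 X\<^sub>0 \<sigma>\<^sub>0) (restrict_rel R Y) \<longrightarrow>
        (AE x in X. x \<in> Y) \<and>
        (\<exists>\<alpha> \<delta> \<Delta>. \<alpha> \<in> Inn_rel X R \<and> \<delta> \<in> iso G\<^sub>0 G \<and> prob_iso X\<^sub>0 X \<Delta> \<and>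
           (\<forall>h\<in>carrier G\<^sub>0. AE x in X\<^sub>0. \<sigma> (\<delta> h) (\<Delta> x) = \<Delta> (\<sigma>\<^sub>0 h x)) \<and>
           (AE x in X\<^sub>0. \<Delta>\<^sub>0 x = \<alpha> (\<Delta> x)))) \<and>
     (\<forall>Y\<in>sets X. 0 < measure X Y \<and> measure X Y < 1 \<longrightarrow>
        \<not> (\<exists>(G\<^sub>0 :: ('h, 's) monoid_scheme) (X\<^sub>0 :: 'x measure) \<sigma>\<^sub>0 \<Delta>\<^sub>0.
             group G\<^sub>0 \<and>
             standard_prob_space X\<^sub>0 \<and> mp_action G\<^sub>0 X\<^sub>0 \<sigma>\<^sub>0 \<and> free_action G\<^sub>0 X\<^sub>0 \<sigma>\<^sub>0 \<and>
             prob_iso X\<^sub>0 (normalized_restriction X Y) \<Delta>\<^sub>0 \<and>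
             image_rel_ae X\<^sub>0 \<Delta>\<^sub>0 (orbit_rel G\<^sub>0 X\<^sub>0 \<sigma>\<^sub>0) (restrict_rel R Y)))"
proof (rule conjI)
  show "\<forall>(G\<^sub>0 :: ('h, 's) monoid_scheme) (X\<^sub>0 :: 'x measure) \<sigma>\<^sub>0 Y \<Delta>\<^sub>0.
        group G\<^sub>0 \<and> countable (carrier G\<^sub>0) \<and>
        standard_prob_space X\<^sub>0 \<and> mp_action G\<^sub>0 X\<^sub>0 \<sigma>\<^sub>0 \<and> free_action G\<^sub>0 X\<^sub>0 \<sigma>\<^sub>0 \<and>
        Y \<in> sets X \<and> 0 < measure X Y \<and>
        prob_iso X\<^sub>0 (normalized_restriction X Y) \<Delta>\<^sub>0 \<and>
        image_rel_ae X\<^sub>0 \<Delta>\<^sub>0 (orbit_rel G\<^sub>0 X\<^sub>0 \<sigma>\<^sub>0) (restrict_rel R Y) \<longrightarrow>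
        (AE x in X. x \<in> Y) \<and>
        (\<exists>\<alpha> \<delta> \<Delta>. \<alpha> \<in> Inn_rel X R \<and> \<delta> \<in> iso G\<^sub>0 G \<and> prob_iso X\<^sub>0 X \<Delta> \<and>
           (\<forall>h\<in>carrier G\<^sub>0. AE x in X\<^sub>0. \<sigma> (\<delta> h) (\<Delta> x) = \<Delta> (\<sigma>\<^sub>0 h x)) \<and>
           (AE x in X\<^sub>0. \<Delta>\<^sub>0 x = \<alpha> (\<Delta> x)))"
    unfolding X \<sigma> R
    by (intro allI impI, elim conjE, rule orbit_equivalence_core[OF assms(1-6)])
  show "\<forall>Y\<in>sets X. 0 < measure X Y \<and> measure X Y < 1 \<longrightarrow>
        \<not> (\<exists>(G\<^sub>0 :: ('h, 's) monoid_scheme) (X\<^sub>0 :: 'x measure) \<sigma>\<^sub>0 \<Delta>\<^sub>0.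
             group G\<^sub>0 \<and>
             standard_prob_space X\<^sub>0 \<and> mp_action G\<^sub>0 X\<^sub>0 \<sigma>\<^sub>0 \<and> free_action G\<^sub>0 X\<^sub>0 \<sigma>\<^sub>0 \<and>
             prob_iso X\<^sub>0 (normalized_restriction X Y) \<Delta>\<^sub>0 \<and>
             image_rel_ae X\<^sub>0 \<Delta>\<^sub>0 (orbit_rel G\<^sub>0 X\<^sub>0 \<sigma>\<^sub>0) (restrict_rel R Y))"
    unfolding X \<sigma> R
  proof (intro ballI impI notI, elim conjE exE)
    fix Y G\<^sub>0 X\<^sub>0 \<sigma>\<^sub>0 \<Delta>\<^sub>0
    let ?X = "bernoulli_space G Y\<^sub>0"
    assume Y: "Y \<in> sets ?X" "0 < measure ?X Y" and "measure ?X Y < 1"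
      and G0: "group (G\<^sub>0 :: ('h, 's) monoid_scheme)"
      and X0: "standard_prob_space (X\<^sub>0 :: 'x measure)" "mp_action G\<^sub>0 X\<^sub>0 \<sigma>\<^sub>0" "free_action G\<^sub>0 X\<^sub>0 \<sigma>\<^sub>0"
      and rel: "prob_iso X\<^sub>0 (normalized_restriction ?X Y) \<Delta>\<^sub>0"
        "image_rel_ae X\<^sub>0 \<Delta>\<^sub>0 (orbit_rel G\<^sub>0 X\<^sub>0 \<sigma>\<^sub>0) (restrict_rel (orbit_rel G ?X (bernoulli_shift G)) Y)"
    interpret prob_space ?X
      using assms(5) by (intro prob_space_bernoulli) (simp add: standard_prob_space_def)
    \<comment> \<open>In the second assertion \<open>G\<^sub>0\<close> is an arbitrary group; its
      countability comes from the orbit equivalence and makes the first assertion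
      applicable.\<close>
    have "countable (carrier G\<^sub>0)"
      by (rule countable_if_orbit_equivalent[OF assms(1,2,5) G0 X0 Y rel])
    from orbit_equivalence_core[OF assms(1-6) G0 this X0 Y rel]
    have "AE x in ?X. x \<in> Y" by (rule conjunct1)
    then show False using prob_eq_1[OF Y(1)] \<open>measure ?X Y < 1\<close> by simp
  qed
qed

end
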